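(* Let $\mathcal{H}(T,A,\mu)$ be a Cauchy--de Branges space with $T$ power separated. The following are equivalent: 1. For every $m\in\mathbb{N}$, $\mathcal{H}(T,A,\mu)$ contains a nearly invariant subspace of codimension $m$, and every nontrivial (nonzero) nearly invariant subspace has finite codimension. 2. The set $\mathcal{P}$ of all polynomials is contained in $L^2(\mu)$ and is dense in $L^2(\mu)$. 3. $\mathcal{H}(T,A,\mu)$ has the strong localization property.
   Context: Let $T=\{t_n\}_{n\ge1}\subset\mathbb{C}$ be a set of distinct points with $|t_n|\to\infty$, and let $\mu_n>0$ satisfy $\sum_n\frac{\mu_n}{|t_n|^2+1}<\infty$; $\mu=\sum_n\mu_n\delta_{t_n}$, so $L^2(\mu)$ consists of sequences $(d_n)$ with $\sum_n|d_n|^2\mu_n<\infty$. Let $A$ be an entire function with simple zeros exactly at $T$ and no other zeros. The Cauchy--de Branges space is $\mathcal{H}(T,A,\mu)=\{F(z)=A(z)\sum_n\frac{c_n\mu_n^{1/2}}{z-t_n}:(c_n)\in\ell^2\}$ with norm $\|F\|=\|(c_n)\|_{\ell^2}$. A closed subspace $\mathcal{H}_0$ is nearly invariant if $f\in\mathcal{H}_0$, $f(w)=0$ imply $f(z)/(z-w)\in\mathcal{H}_0$. $T$ is power separated if there exist $C>0$, $N>-1$ with $\operatorname{dist}(t_n,T\setminus\{t_n\})\ge C(|t_n|+1)^{-N}$ for all $n$. The space has the strong localization property if there exist pairwise disjoint disks $D(t_n,r_n)$, $r_n\to0$, such that for every nonzero $f$ in the space the set $\mathcal{Z}(f)\setminus\bigcup_nD(t_n,r_n)$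 is finite and, for all but finitely many $n$, the disk $D(t_n,r_n)$ contains exactly one zero of $f$ (counting multiplicities). *)

theory Defs
  imports "HOL-Complex_Analysis.Complex_Analysis" "HOL-Computational_Algebra.Polynomial"
begin

definition cdb_data :: "(nat \<Rightarrow> complex) \<Rightarrow> (complex \<Rightarrow> complex) \<Rightarrow> (nat \<Rightarrow> real) \<Rightarrow> bool" where
  "cdb_data t A mu \<longleftrightarrow>
     inj t \<and> filterlim (\<lambda>n. cmod (t n)) at_top sequentially \<and>
     (\<forall>n. mu n > 0) \<and> summable (\<lambda>n. mu n / (cmod (t n) ^ 2 + 1)) \<and>
     A holomorphic_on UNIV \<and> {z. A z = 0} = range t \<and>
     (\<forall>n. deriv A (t n) \<noteq> 0)"

text \<open>F is represented by the l^2 coefficient sequence c: F is the entire function that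
  equals A(z) * sum_n c_n mu_n^(1/2) / (z - t_n) off T (its values on T being those of
  the holomorphic extension).\<close>
definition cdb_rep :: "(nat \<Rightarrow> complex) \<Rightarrow> (complex \<Rightarrow> complex) \<Rightarrow> (nat \<Rightarrow> real)
    \<Rightarrow> (complex \<Rightarrow> complex) \<Rightarrow> (nat \<Rightarrow> complex) \<Rightarrow> bool" where
  "cdb_rep t A mu F c \<longleftrightarrow>
     summable (\<lambda>n. (cmod (c n))\<^sup>2) \<and> F holomorphic_on UNIV \<and>
     (\<forall>z. z \<notin> range t \<longrightarrow>
        F z = A z * (\<Sum>n. c n * complex_of_real (sqrt (mu n)) / (z - t n)))"

definition cdb_space :: "(nat \<Rightarrow> complex) \<Rightarrow> (complex \<Rightarrow> complex) \<Rightarrow> (nat \<Rightarrow> real)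
    \<Rightarrow> (complex \<Rightarrow> complex) set" where
  "cdb_space t A mu = {F. \<exists>c. cdb_rep t A mu F c}"

text \<open>Closed (linear) subspace, closedness w.r.t. the norm ||F|| = ||c||_{l^2}.\<close>
definition cdb_closed_subspace :: "(nat \<Rightarrow> complex) \<Rightarrow> (complex \<Rightarrow> complex) \<Rightarrow> (nat \<Rightarrow> real)
    \<Rightarrow> (complex \<Rightarrow> complex) set \<Rightarrow> bool" where
  "cdb_closed_subspace t A mu S \<longleftrightarrow>
     S \<subseteq> cdb_space t A mu \<and> (\<lambda>_. 0) \<in> S \<and>
     (\<forall>f\<in>S. \<forall>g\<in>S. (\<lambda>z. f z + g z) \<in> S) \<and>
     (\<forall>f\<in>S. \<forall>a. (\<lambda>z. a * f z) \<in> S) \<and>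
     (\<forall>Fs F cs c. (\<forall>k. Fs k \<in> S \<and> cdb_rep t A mu (Fs k) (cs k)) \<and> cdb_rep t A mu F c \<and>
        (\<lambda>k. \<Sum>n. (cmod (cs k n - c n))\<^sup>2) \<longlonglongrightarrow> 0 \<longrightarrow> F \<in> S)"

definition nearly_invariant :: "(nat \<Rightarrow> complex) \<Rightarrow> (complex \<Rightarrow> complex) \<Rightarrow> (nat \<Rightarrow> real)
    \<Rightarrow> (complex \<Rightarrow> complex) set \<Rightarrow> bool" where
  "nearly_invariant t A mu S \<longleftrightarrow>
     cdb_closed_subspace t A mu S \<and>
     (\<forall>f\<in>S. \<forall>w. f w = 0 \<longrightarrow> (\<lambda>z. if z = w then deriv f w else f z / (z - w)) \<in> S)"

definition has_codim :: "(complex \<Rightarrow> complex) set \<Rightarrow> (complex \<Rightarrow> complex) set \<Rightarrow> nat \<Rightarrow> bool" where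
  "has_codim H S m \<longleftrightarrow>
     (\<exists>B. finite B \<and> card B = m \<and> B \<subseteq> H \<and>
        (\<forall>a. (\<lambda>z. \<Sum>b\<in>B. a b * b z) \<in> S \<longrightarrow> (\<forall>b\<in>B. a b = 0)) \<and>
        (\<forall>F\<in>H. \<exists>a. \<exists>G\<in>S. F = (\<lambda>z. G z + (\<Sum>b\<in>B. a b * b z))))"

definition power_separated :: "(nat \<Rightarrow> complex) \<Rightarrow> bool" where
  "power_separated t \<longleftrightarrow>
     (\<exists>C>0. \<exists>N::real. N > -1 \<and>
        (\<forall>n m. m \<noteq> n \<longrightarrow> cmod (t n - t m) \<ge> C * (cmod (t n) + 1) powr (-N)))"

definition in_L2mu :: "(nat \<Rightarrow> complex) \<Rightarrow> (nat \<Rightarrow> real) \<Rightarrow> (nat \<Rightarrow> complex) \<Rightarrow> bool" where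
  "in_L2mu t mu d \<longleftrightarrow> summable (\<lambda>n. (cmod (d n))\<^sup>2 * mu n)"

definition polys_dense_L2 :: "(nat \<Rightarrow> complex) \<Rightarrow> (nat \<Rightarrow> real) \<Rightarrow> bool" where
  "polys_dense_L2 t mu \<longleftrightarrow>
     (\<forall>p :: complex poly. in_L2mu t mu (\<lambda>n. poly p (t n))) \<and>
     (\<forall>d e. in_L2mu t mu d \<and> e > 0 \<longrightarrow>
        (\<exists>p :: complex poly. (\<Sum>n. (cmod (d n - poly p (t n)))\<^sup>2 * mu n) < e))"

definition strong_localization :: "(nat \<Rightarrow> complex) \<Rightarrow> (complex \<Rightarrow> complex) \<Rightarrow> (nat \<Rightarrow> real) \<Rightarrow> bool" where
  "strong_localization t A mu \<longleftrightarrow>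
     (\<exists>r :: nat \<Rightarrow> real. (\<forall>n. r n > 0) \<and> r \<longlonglongrightarrow> 0 \<and>
        (\<forall>n m. n \<noteq> m \<longrightarrow> ball (t n) (r n) \<inter> ball (t m) (r m) = {}) \<and>
        (\<forall>f\<in>cdb_space t A mu. f \<noteq> (\<lambda>_. 0) \<longrightarrow>
           finite ({z. f z = 0} - (\<Union>n. ball (t n) (r n))) \<and>
           (\<forall>\<^sub>F n in sequentially.
              finite {z \<in> ball (t n) (r n). f z = 0} \<and>
              (\<Sum>z\<in>{z \<in> ball (t n) (r n). f z = 0}. zorder f z) = 1)))"

end

theory Submission
  imports Defs
begin

text \<open>A function F of the space is determined by its residue sequence b, F = A C with C the Cauchy
  transform of b, and dividing F by z - w for a zero w acts on b by division by t n - w. If all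
  polynomials are in L2, then z^k C(z) is, up to moments of b, again such a transform, so that
  density of the polynomials means that no nonzero C decays faster than all powers off small
  disks around T.

  If the polynomials are dense, C(z) behaves like a power of 1/z off the disks and Rouche's theorem
  localizes the zeros. Also, if u annihilates a nearly invariant subspace S, then the quotient
  U = C(c u) / C(b) does not depend on the member F = A C(b) of S, where c is the coefficient
  sequence of F; it is entire of polynomial growth, hence a polynomial of bounded degree, and
  S has finite codimension. Conversely, for S of finite codimension the functions U form a finite
  dimensional space that is invariant under backward shifts, so they are polynomials, and counting
  dimensions gives moments of all orders.

  Under strong localization, a gliding hump argument shows that no function of the space can
  have zeros that are movable by small perturbations at infinitely many places. This yields moments
  of all orders; moreover, if all moments of b vanish, it yields a zero s n of F extremely close
  to t n for all large n. Moving s n to t n for all large n leaves finitely many residues, still with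
  vanishing moments, hence b = 0.\<close>

text \<open>Strong localization gives disks whose radii tend to 0 without any rate, whereas moving
  zeros into T under control requires distances below a fixed power of 1 / |t n|. Bridging this gap
  shapes the converse. A vector with vanishing moments is divided by several of its zeros: each
  division gains one power of decay of the coefficients and keeps the moments zero. With enough
  decay, zeros off the polynomially small disks of radius \<open>rho q n\<close>, or two zeros in
  one such disk, can be displaced at small cost in norm, which the gliding hump excludes if this
  happens arbitrarily far out. Power separation enters twice: the disks are disjoint for q >= p, and
  an area count makes 1 / tau^(2 p + 4) summable, which bounds the product of all factors caused by
  the moves; hence the exponent p + (2 p + 4). For dense polynomials, one member of S with first
  nonzero moment of index k bounds the degree of all multipliers at once, by k + 1 + p: the residues
  of C(c u) are only absolutely summable, so this numerator is controlled off the disks by the power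
  p.\<close>

lemma norm_add_sq_le:
  fixes a b :: "'a::real_normed_vector"
  shows "(norm (a + b))\<^sup>2 \<le> 2 * (norm a)\<^sup>2 + 2 * (norm b)\<^sup>2"
proof -
  have "(norm (a + b))\<^sup>2 \<le> (norm a + norm b)\<^sup>2"
    by (intro power_mono norm_triangle_ineq) auto
  also have "\<dots> \<le> 2 * (norm a)\<^sup>2 + 2 * (norm b)\<^sup>2"
    using sum_squares_bound[of "norm a" "norm b"] by (simp add: power2_sum)
  finally show ?thesis .
qed

lemma summable_mult_of_sq:
  fixes a b :: "nat \<Rightarrow> complex"
  assumes "summable (\<lambda>n. (cmod (a n))\<^sup>2)" "summable (\<lambda>n. (cmod (b n))\<^sup>2)"
  shows "summable (\<lambda>n. cmod (a n * b n))"
proof (rule summable_comparison_test_ev)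
  show "summable (\<lambda>n. (cmod (a n))\<^sup>2 + (cmod (b n))\<^sup>2)"
    using assms by (rule summable_add)
  have "cmod (a n) * cmod (b n) \<le> (cmod (a n))\<^sup>2 + (cmod (b n))\<^sup>2" for n
  proof -
    have "0 \<le> cmod (a n) * cmod (b n)"
      by simp
    moreover have "2 * cmod (a n) * cmod (b n) \<le> (cmod (a n))\<^sup>2 + (cmod (b n))\<^sup>2"
      by (rule sum_squares_bound)
    ultimately show ?thesis by linarith
  qed
  then show "\<forall>\<^sub>F n in sequentially. norm (cmod (a n * b n)) \<le> (cmod (a n))\<^sup>2 + (cmod (b n))\<^sup>2"
    by (simp add: norm_mult)
qed

lemma summable_comparison_cofinite:
  fixes f :: "nat \<Rightarrow> 'a::banach"
  assumes "summable g" "finite S" "\<And>n. n \<notin> S \<Longrightarrow> norm (f n) \<le> g n"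
  shows "summable f"
proof (rule summable_comparison_test_ev[OF _ assms(1)])
  have "{n. \<not> norm (f n) \<le> g n} \<subseteq> S"
    using assms(3) by blast
  then show "\<forall>\<^sub>F n in sequentially. norm (f n) \<le> g n"
    using assms(2) unfolding cofinite_eq_sequentially[symmetric] eventually_cofinite
    by (rule finite_subset)
qed

section \<open>The Hilbert space of square-summable sequences\<close>

text \<open>A type of its own, so that the coefficient space can be made an instance of
  \<open>real_inner\<close> and \<open>complete_space\<close>. These classes know only real scalars;
  the complex structure is added by \<open>cscale\<close> and \<open>pairing\<close>.\<close>

typedef ell2 = "{c :: nat \<Rightarrow> complex. summable (\<lambda>n. (cmod (c n))\<^sup>2)}"
  morphisms coord Ell2
  by (rule exI[of _ "\<lambda>_. 0"]) simp

setup_lifting type_definition_ell2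

lemma coord_summable: "summable (\<lambda>n. (cmod (coord x n))\<^sup>2)"
  using coord[of x] by simp

lemma coord_Ell2: "summable (\<lambda>n. (cmod (c n))\<^sup>2) \<Longrightarrow> coord (Ell2 c) = c"
  by (simp add: Ell2_inverse)

lemma ell2_eqI: "(\<And>n. coord x n = coord y n) \<Longrightarrow> x = y"
  by (simp add: coord_inject[symmetric] fun_eq_iff)

instantiation ell2 :: real_vector
begin

lift_definition zero_ell2 :: ell2 is "\<lambda>_. 0" by simp

lift_definition plus_ell2 :: "ell2 \<Rightarrow> ell2 \<Rightarrow> ell2" is "\<lambda>x y n. x n + y n"
proof -
  fix x y :: "nat \<Rightarrow> complex"
  assume *: "summable (\<lambda>n. (cmod (x n))\<^sup>2)" "summable (\<lambda>n. (cmod (y n))\<^sup>2)"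
  show "summable (\<lambda>n. (cmod (x n + y n))\<^sup>2)"
    by (rule summable_comparison_test'[where g = "\<lambda>n. 2 * (cmod (x n))\<^sup>2 + 2 * (cmod (y n))\<^sup>2"])
      (auto intro!: summable_add summable_mult * norm_add_sq_le)
qed

lift_definition uminus_ell2 :: "ell2 \<Rightarrow> ell2" is "\<lambda>x n. - x n" by simp

lift_definition minus_ell2 :: "ell2 \<Rightarrow> ell2 \<Rightarrow> ell2" is "\<lambda>x y n. x n - y n"
proof -
  fix x y :: "nat \<Rightarrow> complex"
  assume *: "summable (\<lambda>n. (cmod (x n))\<^sup>2)" "summable (\<lambda>n. (cmod (y n))\<^sup>2)"
  have le: "(cmod (x n - y n))\<^sup>2 \<le> 2 * (cmod (x n))\<^sup>2 + 2 * (cmod (y n))\<^sup>2" for n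
    using norm_add_sq_le[of "x n" "- y n"] by simp
  show "summable (\<lambda>n. (cmod (x n - y n))\<^sup>2)"
    by (rule summable_comparison_test'[where g = "\<lambda>n. 2 * (cmod (x n))\<^sup>2 + 2 * (cmod (y n))\<^sup>2"])
      (auto intro!: summable_add summable_mult * le)
qed

lift_definition scaleR_ell2 :: "real \<Rightarrow> ell2 \<Rightarrow> ell2" is "\<lambda>r x n. r *\<^sub>R x n"
  by (auto simp: power_mult_distrib intro!: summable_mult)

instance
proof
  fix x y z :: ell2 and a b :: real
  note defs = coord_inject[symmetric] fun_eq_iff zero_ell2.rep_eq plus_ell2.rep_eq
    minus_ell2.rep_eq uminus_ell2.rep_eq scaleR_ell2.rep_eq
  show "x + y + z = x + (y + z)" "x + y = y + x" "0 + x = x" "- x + x = 0" "x - y = x + - y"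
    "a *\<^sub>R (x + y) = a *\<^sub>R x + a *\<^sub>R y" "(a + b) *\<^sub>R x = a *\<^sub>R x + b *\<^sub>R x"
    "a *\<^sub>R b *\<^sub>R x = (a * b) *\<^sub>R x" "1 *\<^sub>R x = x"
    by (simp_all add: defs scaleR_add_right scaleR_add_left)
qed

end

lemma coord_simps [simp]:
  "coord 0 n = 0" "coord (x + y) n = coord x n + coord y n"
  "coord (x - y) n = coord x n - coord y n" "coord (- x) n = - coord x n"
  "coord (r *\<^sub>R x) n = of_real r * coord x n"
  by (simp_all add: zero_ell2.rep_eq plus_ell2.rep_eq minus_ell2.rep_eq uminus_ell2.rep_eq
      scaleR_ell2.rep_eq scaleR_conv_of_real)

lemma summable_coord_mult: "summable (\<lambda>n. cmod (coord x n * coord y n))"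
  by (intro summable_mult_of_sq coord_summable)

lemma summable_coord_inner: "summable (\<lambda>n. coord x n \<bullet> coord y n)"
proof (rule summable_norm_cancel, rule summable_comparison_test_ev)
  show "summable (\<lambda>n. cmod (coord x n * coord y n))"
    by (rule summable_coord_mult)
  show "\<forall>\<^sub>F n in sequentially. norm (norm (coord x n \<bullet> coord y n)) \<le> cmod (coord x n * coord y n)"
    using Cauchy_Schwarz_ineq2[of "coord x _" "coord y _"]
    by (intro always_eventually allI) (simp add: norm_mult)
qed

instantiation ell2 :: real_inner
begin

definition inner_ell2 :: "ell2 \<Rightarrow> ell2 \<Rightarrow> real" where
  "inner_ell2 x y = (\<Sum>n. coord x n \<bullet> coord y n)"

definition norm_ell2 :: "ell2 \<Rightarrow> real" where
  "norm_ell2 x = sqrt (inner x x)"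

definition dist_ell2 :: "ell2 \<Rightarrow> ell2 \<Rightarrow> real" where
  "dist_ell2 x y = norm (x - y)"

definition sgn_ell2 :: "ell2 \<Rightarrow> ell2" where
  "sgn_ell2 x = x /\<^sub>R norm x"

definition uniformity_ell2 :: "(ell2 \<times> ell2) filter" where
  "uniformity_ell2 = (INF e\<in>{0<..}. principal {(x, y). dist x y < e})"

definition open_ell2 :: "ell2 set \<Rightarrow> bool" where
  "open_ell2 U \<longleftrightarrow> (\<forall>x\<in>U. eventually (\<lambda>(x', y). x' = x \<longrightarrow> y \<in> U) uniformity)"

instance
proof
  fix x y z :: ell2 and r :: real and U :: "ell2 set"
  show "dist x y = norm (x - y)" by (rule dist_ell2_def)
  show "sgn x = x /\<^sub>R norm x" by (rule sgn_ell2_def)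
  show "(uniformity :: (ell2 \<times> ell2) filter) = (INF e\<in>{0<..}. principal {(x, y). dist x y < e})"
    by (rule uniformity_ell2_def)
  show "open U \<longleftrightarrow> (\<forall>x\<in>U. eventually (\<lambda>(x', y). x' = x \<longrightarrow> y \<in> U) uniformity)"
    by (rule open_ell2_def)
  show "inner x y = inner y x"
    by (simp add: inner_ell2_def inner_commute)
  show "inner (x + y) z = inner x z + inner y z"
    by (simp add: inner_ell2_def inner_add_left suminf_add summable_coord_inner)
  have "(\<Sum>n. coord (r *\<^sub>R x) n \<bullet> coord y n) = (\<Sum>n. r * (coord x n \<bullet> coord y n))"
    by (simp add: scaleR_ell2.rep_eq)
  then show "inner (r *\<^sub>R x) y = r * inner x y"
    by (simp add: inner_ell2_def suminf_mult summable_coord_inner)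
  show "0 \<le> inner x x"
    by (simp add: inner_ell2_def suminf_nonneg summable_coord_inner)
  show "inner x x = 0 \<longleftrightarrow> x = 0"
  proof
    assume "inner x x = 0"
    then have "\<forall>n. coord x n \<bullet> coord x n = 0"
      using suminf_eq_zero_iff[OF summable_coord_inner[of x x]] by (simp add: inner_ell2_def)
    then show "x = 0"
      by (auto intro: ell2_eqI)
  qed (simp add: inner_ell2_def)
  show "norm x = sqrt (inner x x)" by (rule norm_ell2_def)
qed

end

lemma norm_ell2_sq: "(norm x)\<^sup>2 = (\<Sum>n. (cmod (coord x n))\<^sup>2)"
  by (simp only: power2_norm_eq_inner inner_ell2_def)

lemma sum_coord_le_norm: "finite I \<Longrightarrow> (\<Sum>n\<in>I. (cmod (coord x n))\<^sup>2) \<le> (norm x)\<^sup>2"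
  unfolding norm_ell2_sq by (intro sum_le_suminf coord_summable) auto

lemma cmod_coord_le_norm: "cmod (coord x n) \<le> norm x"
  using sum_coord_le_norm[of "{n}" x] by (simp add: power2_le_iff_abs_le)

instance ell2 :: complete_space
proof
  fix X :: "nat \<Rightarrow> ell2"
  assume X: "Cauchy X"
  have "Cauchy (\<lambda>i. coord (X i) n)" for n
  proof (rule metric_CauchyI)
    fix e :: real assume "0 < e"
    then obtain M where "\<And>i j. i \<ge> M \<Longrightarrow> j \<ge> M \<Longrightarrow> dist (X i) (X j) < e"
      using X unfolding Cauchy_def by blast
    moreover have "dist (coord (X i) n) (coord (X j) n) \<le> dist (X i) (X j)" for i j
      using cmod_coord_le_norm[of "X i - X j" n] by (simp add: dist_norm)
    ultimately show "\<exists>M. \<forall>i\<ge>M. \<forall>j\<ge>M. dist (coord (X i) n) (coord (X j) n) < e"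
      by (meson le_less_trans)
  qed
  then obtain c where c: "\<And>n. (\<lambda>i. coord (X i) n) \<longlonglongrightarrow> c n"
    unfolding convergent_eq_Cauchy[symmetric] by metis
  \<comment> \<open>The limit c is not yet known to be square summable, so the Cauchy estimate is
    passed to the limit in finite partial sums only.\<close>
  have tail: "\<exists>M. \<forall>i\<ge>M. \<forall>N. (\<Sum>n<N. (cmod (coord (X i) n - c n))\<^sup>2) \<le> e\<^sup>2" if "e > 0" for e
  proof -
    obtain M where M: "\<And>i j. i \<ge> M \<Longrightarrow> j \<ge> M \<Longrightarrow> dist (X i) (X j) < e"
      using X \<open>e > 0\<close> unfolding Cauchy_def by blast
    have "(\<Sum>n<N. (cmod (coord (X i) n - c n))\<^sup>2) \<le> e\<^sup>2" if "i \<ge> M" for i N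
    proof (rule LIMSEQ_le_const2)
      show "(\<lambda>j. \<Sum>n<N. (cmod (coord (X i) n - coord (X j) n))\<^sup>2) \<longlonglongrightarrow>
          (\<Sum>n<N. (cmod (coord (X i) n - c n))\<^sup>2)"
        by (intro tendsto_intros c)
      have "(\<Sum>n<N. (cmod (coord (X i) n - coord (X j) n))\<^sup>2) \<le> e\<^sup>2" if "j \<ge> M" for j
      proof -
        have "(\<Sum>n<N. (cmod (coord (X i) n - coord (X j) n))\<^sup>2) \<le> (norm (X i - X j))\<^sup>2"
          using sum_coord_le_norm[of "{..<N}" "X i - X j"] by simp
        also have "\<dots> \<le> e\<^sup>2"
          using M[OF \<open>i \<ge> M\<close> that] by (intro power_mono) (auto simp: dist_norm)
        finally show ?thesis .
      qed
      then show "\<exists>M. \<forall>j\<ge>M. (\<Sum>n<N. (cmod (coord (X i) n - coord (X j) n))\<^sup>2) \<le> e\<^sup>2"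
        by blast
    qed
    then show ?thesis by blast
  qed
  have diff: "summable (\<lambda>n. (cmod (coord (X i) n - c n))\<^sup>2) \<and>
      (\<Sum>n. (cmod (coord (X i) n - c n))\<^sup>2) \<le> e"
    if "\<forall>N. (\<Sum>n<N. (cmod (coord (X i) n - c n))\<^sup>2) \<le> e" for i e
  proof (intro conjI)
    show "summable (\<lambda>n. (cmod (coord (X i) n - c n))\<^sup>2)"
      using that by (intro summableI_nonneg_bounded[of _ e]) auto
    then show "(\<Sum>n. (cmod (coord (X i) n - c n))\<^sup>2) \<le> e"
      using that by (intro suminf_le_const) auto
  qed
  obtain i where "summable (\<lambda>n. (cmod (coord (X i) n - c n))\<^sup>2)"
    using tail[of 1] diff by (meson order_refl zero_less_one)
  \<comment> \<open>Only the difference of some X i and c is known to lie in the space; c is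
    recovered from it by subtraction.\<close>
  then obtain y where y: "coord y = (\<lambda>n. coord (X i) n - c n)"
    using coord_Ell2[of "\<lambda>n. coord (X i) n - c n"] by blast
  define x where "x = X i - y"
  have cx: "coord x n = c n" for n
    by (simp add: x_def y)
  have "X \<longlonglongrightarrow> x"
  proof (rule LIMSEQ_I)
    fix e :: real assume "0 < e"
    then obtain M where "\<forall>i\<ge>M. \<forall>N. (\<Sum>n<N. (cmod (coord (X i) n - c n))\<^sup>2) \<le> (e/2)\<^sup>2"
      using tail[of "e/2"] by auto
    then have "(norm (X i - x))\<^sup>2 \<le> (e/2)\<^sup>2" if "i \<ge> M" for i
      using diff[of i "(e/2)\<^sup>2"] that by (simp add: norm_ell2_sq cx)
    then have "norm (X i - x) \<le> e / 2" if "i \<ge> M" for i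
      using that \<open>0 < e\<close> by (meson half_gt_zero less_imp_le power2_le_imp_le)
    then show "\<exists>M. \<forall>i\<ge>M. norm (X i - x) < e"
      using \<open>0 < e\<close> by (intro exI[of _ M]) (force intro: le_less_trans)
  qed
  then show "convergent X"
    by (rule convergentI)
qed

instance ell2 :: banach ..

lift_definition cscale :: "complex \<Rightarrow> ell2 \<Rightarrow> ell2" is "\<lambda>a x n. a * x n"
  by (auto simp: norm_mult power_mult_distrib intro!: summable_mult)

lemma coord_cscale [simp]: "coord (cscale a x) n = a * coord x n"
  by (simp add: cscale.rep_eq)

lemma cscale_of_real: "cscale (of_real r) x = r *\<^sub>R x"
  by (rule ell2_eqI) simp

lemma coord_sum [simp]: "coord (sum f I) n = (\<Sum>i\<in>I. coord (f i) n)"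
  by (induction I rule: infinite_finite_induct) auto

text \<open>Bilinear rather than sesquilinear: annihilators of subspaces are then described by Cauchy
  transforms without complex conjugates.\<close>

definition pairing :: "ell2 \<Rightarrow> ell2 \<Rightarrow> complex" where
  "pairing x u = (\<Sum>n. coord x n * coord u n)"

lemma summable_pairing: "summable (\<lambda>n. coord x n * coord u n)"
  by (rule summable_norm_cancel[OF summable_coord_mult])

lemma pairing_add: "pairing (x + y) u = pairing x u + pairing y u"
  by (simp add: pairing_def distrib_right suminf_add summable_pairing)

lemma pairing_cscale: "pairing (cscale a x) u = a * pairing x u"
  by (simp add: pairing_def mult.assoc suminf_mult summable_pairing)

lemma pairing_0 [simp]: "pairing 0 u = 0"
  by (simp add: pairing_def)

lemma pairing_sum: "pairing (sum f I) u = (\<Sum>i\<in>I. pairing (f i) u)"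
  by (induction I rule: infinite_finite_induct) (auto simp: pairing_add)

lemma pairing_commute: "pairing x u = pairing u x"
  by (simp add: pairing_def mult.commute)

lift_definition cnj_ell2 :: "ell2 \<Rightarrow> ell2" is "\<lambda>x n. cnj (x n)"
  by simp

lemma coord_cnj [simp]: "coord (cnj_ell2 x) n = cnj (coord x n)"
  by (simp add: cnj_ell2.rep_eq)

lemma norm_cnj [simp]: "norm (cnj_ell2 x) = norm x"
  by (rule power2_eq_imp_eq) (simp_all add: norm_ell2_sq)

lemma Re_pairing_cnj: "Re (pairing x (cnj_ell2 u)) = inner x u"
proof -
  have "Re (pairing x (cnj_ell2 u)) = (\<Sum>n. Re (coord x n * cnj (coord u n)))"
    unfolding pairing_def by (subst Re_suminf) (use summable_pairing[of x "cnj_ell2 u"] in auto)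
  also have "\<dots> = inner x u"
    by (simp add: inner_ell2_def inner_complex_def)
  finally show ?thesis .
qed

lemma pairing_cnj_self: "pairing x (cnj_ell2 x) = (norm x)\<^sup>2"
proof -
  have "pairing x (cnj_ell2 x) = (\<Sum>n. of_real ((cmod (coord x n))\<^sup>2))"
    by (simp only: pairing_def coord_cnj complex_norm_square)
  also have "\<dots> = of_real ((norm x)\<^sup>2)"
    by (simp only: suminf_of_real[OF coord_summable] norm_ell2_sq)
  finally show ?thesis .
qed

text \<open>A unimodular factor a turns the pairing into its absolute value; the real Cauchy-Schwarz
  inequality for \<open>inner\<close> then applies, since conjugation preserves the norm.\<close>

lemma norm_pairing_le: "cmod (pairing x u) \<le> norm x * norm u"
proof (cases "pairing x u = 0")
  case False
  define a where "a = cnj (sgn (pairing x u))"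
  have "cmod a = 1"
    using False by (simp add: a_def norm_sgn)
  have "(norm (cscale a x))\<^sup>2 = (norm x)\<^sup>2"
    by (simp add: norm_ell2_sq norm_mult \<open>cmod a = 1\<close>)
  then have na: "norm (cscale a x) = norm x"
    by (simp add: power2_eq_iff_nonneg)
  have "a * pairing x u = of_real (cmod (pairing x u))"
    by (simp add: a_def sgn_eq complex_norm_square[symmetric] power2_eq_square field_simps False
        mult.commute[of "cnj _"])
  then have "cmod (pairing x u) = Re (pairing (cscale a x) u)"
    by (simp add: pairing_cscale)
  also have "\<dots> = inner (cscale a x) (cnj_ell2 u)"
    by (subst Re_pairing_cnj[symmetric]) (simp add: pairing_def)
  also have "\<dots> \<le> norm x * norm u"
    using norm_cauchy_schwarz[of "cscale a x" "cnj_ell2 u"] by (simp add: na)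
  finally show ?thesis .
qed simp

section \<open>Orthogonal projection\<close>

lemma closed_subspace_projection:
  fixes V :: "'a::{real_inner, complete_space} set"
  assumes "subspace V" "closed V"
  obtains p where "p \<in> V" "\<And>v. v \<in> V \<Longrightarrow> inner (x - p) v = 0"
proof -
  have "0 \<in> V" by (rule subspace_0[OF \<open>subspace V\<close>])
  define d where "d = infdist x V"
  have d_le: "d \<le> norm (x - v)" if "v \<in> V" for v
    using infdist_le[OF that, of x] by (simp add: d_def dist_norm)
  have "d \<ge> 0" by (simp add: d_def infdist_nonneg)
  have "\<exists>v\<in>V. norm (x - v) < d + 1 / real (Suc n)" for n
  proof -
    have "infdist x V < d + 1 / real (Suc n)"
      by (simp add: d_def)
    then have "Inf (dist x ` V) < d + 1 / real (Suc n)"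
      using \<open>0 \<in> V\<close> infdist_notempty[of V x] by force
    then obtain y where "y \<in> dist x ` V" "y < d + 1 / real (Suc n)"
      using cInf_lessD[of "dist x ` V"] \<open>0 \<in> V\<close> by blast
    then show ?thesis
      by (auto simp: dist_norm)
  qed
  then obtain v where v: "\<And>n. v n \<in> V" "\<And>n. norm (x - v n) < d + 1 / real (Suc n)"
    by metis
  \<comment> \<open>The parallelogram law makes a minimizing sequence Cauchy.\<close>
  have par: "(norm (v m - v n))\<^sup>2 \<le> 4 * (2 * d + 1) / real (Suc N)"
    if "m \<ge> N" "n \<ge> N" for m n N
  proof -
    let ?e = "1 / real (Suc N)"
    have e: "norm (x - v k) \<le> d + ?e" if "k \<ge> N" for k
    proof -
      have "1 / real (Suc k) \<le> ?e"
        using that by (simp add: field_simps)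
      then show ?thesis
        using v(2)[of k] by linarith
    qed
    have sq: "(norm (x - v k))\<^sup>2 \<le> (d + ?e)\<^sup>2" if "k \<ge> N" for k
      by (intro power_mono e that) auto
    have "(1/2) *\<^sub>R (v m + v n) \<in> V"
      by (intro subspace_scale subspace_add \<open>subspace V\<close> v)
    from d_le[OF this] have "d\<^sup>2 \<le> (norm (x - (1/2) *\<^sub>R (v m + v n)))\<^sup>2"
      using \<open>d \<ge> 0\<close> by (intro power_mono) auto
    moreover have "(norm (v m - v n))\<^sup>2 = 2 * (norm (x - v m))\<^sup>2 + 2 * (norm (x - v n))\<^sup>2
        - 4 * (norm (x - (1/2) *\<^sub>R (v m + v n)))\<^sup>2"
      by (simp add: power2_norm_eq_inner inner_simps inner_commute algebra_simps)
    ultimately have "(norm (v m - v n))\<^sup>2 \<le> 4 * (d + ?e)\<^sup>2 - 4 * d\<^sup>2"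
      using sq[OF that(1)] sq[OF that(2)] by linarith
    also have "\<dots> = 4 * (2 * d * ?e + ?e * ?e)"
      by (simp add: power2_eq_square algebra_simps)
    also have "\<dots> \<le> 4 * (2 * d * ?e + 1 * ?e)"
      by (intro mult_left_mono add_left_mono mult_right_mono) auto
    finally show ?thesis
      by (simp add: field_simps)
  qed
  have "Cauchy v"
  proof (rule metric_CauchyI)
    fix e :: real assume "0 < e"
    obtain N where N: "4 * (2 * d + 1) / e\<^sup>2 < real N"
      using reals_Archimedean2 by blast
    have "norm (v m - v n) < e" if "m \<ge> N" "n \<ge> N" for m n
    proof -
      have "4 * (2 * d + 1) < e\<^sup>2 * real (Suc N)"
        using N \<open>0 < e\<close> by (simp add: field_simps) (smt (verit) zero_less_power)
      then have "4 * (2 * d + 1) / real (Suc N) < e\<^sup>2"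
        by (simp add: field_simps)
      then have "(norm (v m - v n))\<^sup>2 < e\<^sup>2"
        using par[OF that] by linarith
      then show ?thesis
        using \<open>0 < e\<close> by (simp add: power2_less_imp_less)
    qed
    then show "\<exists>M. \<forall>m\<ge>M. \<forall>n\<ge>M. dist (v m) (v n) < e"
      by (auto simp: dist_norm)
  qed
  then obtain p where p: "v \<longlonglongrightarrow> p"
    using Cauchy_convergent_iff convergent_def by blast
  have "p \<in> V"
    using closed_sequentially[OF \<open>closed V\<close> _ p] v(1) by blast
  have "norm (x - p) \<le> d"
  proof (rule LIMSEQ_le)
    show "(\<lambda>n. norm (x - v n)) \<longlonglongrightarrow> norm (x - p)"
      by (intro tendsto_intros p)
    show "(\<lambda>n. d + 1 / real (Suc n)) \<longlonglongrightarrow> d"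
      using tendsto_add[OF tendsto_const[of d] lim_inverse_n'[THEN LIMSEQ_Suc]] by simp
    show "\<exists>N. \<forall>n\<ge>N. norm (x - v n) \<le> d + 1 / real (Suc n)"
      using v(2) by (auto intro: less_imp_le)
  qed
  have "inner (x - p) w = 0" if "w \<in> V" for w
  proof -
    define s where "s = inner (x - p) w"
    \<comment> \<open>The best step along w would be s / inner w w; adding 1 to the denominator
      covers w = 0 and still yields s * s / q <= 0.\<close>
    define q where "q = inner w w + 1"
    have "q > 0" by (simp add: q_def add_nonneg_pos)
    have "norm (x - p) \<le> norm (x - (p + (s/q) *\<^sub>R w))"
      using \<open>norm (x - p) \<le> d\<close> d_le[of "p + (s/q) *\<^sub>R w"] \<open>p \<in> V\<close> that \<open>subspace V\<close>
      by (meson order_trans subspace_add subspace_scale)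
    then have "(norm (x - p))\<^sup>2 \<le> (norm ((x - p) - (s/q) *\<^sub>R w))\<^sup>2"
      by (intro power_mono) (auto simp: algebra_simps)
    also have "(norm (y - r *\<^sub>R w))\<^sup>2 = (norm y)\<^sup>2 - 2 * r * inner y w + r\<^sup>2 * inner w w" for y r
      unfolding power2_norm_eq_inner
      by (simp add: inner_diff_left inner_diff_right inner_commute power2_eq_square algebra_simps)
    then have "(norm ((x - p) - (s/q) *\<^sub>R w))\<^sup>2 = (norm (x - p))\<^sup>2 - 2 * (s/q) * s + (s/q)\<^sup>2 * inner w w"
      by (simp add: s_def)
    finally have "2 * (s/q) * s \<le> (s/q)\<^sup>2 * inner w w"
      by simp
    also have "\<dots> \<le> (s/q)\<^sup>2 * q"
      by (intro mult_left_mono) (auto simp: q_def)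
    also have "\<dots> = (s/q) * s"
      using \<open>q > 0\<close> by (simp add: power2_eq_square)
    finally have "s * s / q \<le> 0"
      by simp
    then have "s = 0"
      using \<open>q > 0\<close> by (metis divide_le_eq mult_zero_left not_less not_square_less_zero order_antisym_conv
          mult_eq_0_iff)
    then show ?thesis by (simp add: s_def)
  qed
  then show ?thesis
    using that \<open>p \<in> V\<close> by blast
qed

text \<open>The functional is the conjugate of x minus its projection. Real orthogonality kills the
  real part of the pairing; applied to \<open>cscale (- \<i>) v\<close> it also kills the imaginary
  part.\<close>

lemma closed_csubspace_separation:
  fixes V :: "ell2 set"
  assumes "0 \<in> V" "\<And>x y. x \<in> V \<Longrightarrow> y \<in> V \<Longrightarrow> x + y \<in> V" "\<And>a x. x \<in> V \<Longrightarrow> cscale a x \<in> V"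
    and "closed V" "x \<notin> V"
  obtains u where "\<And>v. v \<in> V \<Longrightarrow> pairing v u = 0" "pairing x u \<noteq> 0"
proof -
  have "subspace V"
    unfolding subspace_def using assms(1-3) by (auto simp flip: cscale_of_real)
  then obtain p where p: "p \<in> V" "\<And>v. v \<in> V \<Longrightarrow> inner (x - p) v = 0"
    using closed_subspace_projection \<open>closed V\<close> by metis
  define u where "u = cnj_ell2 (x - p)"
  have Re: "Re (pairing v u) = 0" if "v \<in> V" for v
    using p(2)[OF that] unfolding u_def Re_pairing_cnj by (simp add: inner_commute)
  have V: "pairing v u = 0" if "v \<in> V" for v
  proof (rule complex_eqI)
    have "Re (pairing (cscale (- \<i>) v) u) = 0"
      by (intro Re assms(3) that)
    then show "Im (pairing v u) = Im 0"
      by (simp add: pairing_cscale)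
  qed (use Re[OF that] in simp)
  have "pairing x u = pairing (x - p) u + pairing p u"
    by (simp flip: pairing_add)
  also have "\<dots> = of_real ((norm (x - p))\<^sup>2)"
    using V[OF p(1)] by (simp add: u_def pairing_cnj_self)
  finally have "pairing x u \<noteq> 0"
    using p(1) \<open>x \<notin> V\<close> by auto
  then show ?thesis
    using that V by blast
qed

section \<open>Homogeneous linear systems\<close>

text \<open>More unknowns than equations: Gaussian elimination, one equation and one unknown at a
  time. The unknowns are indexed by an arbitrary finite set because complement bases as well as
  index ranges occur below.\<close>

lemma homogeneous_nontrivial:
  fixes \<beta> :: "'i \<Rightarrow> nat \<Rightarrow> complex"
  assumes "finite B" "card B > k"
  shows "\<exists>a. (\<exists>b\<in>B. a b \<noteq> 0) \<and> (\<forall>b. b \<notin> B \<longrightarrow> a b = 0) \<and> (\<forall>i<k. (\<Sum>b\<in>B. a b * \<beta> b i) = 0)"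
  using assms
proof (induction k arbitrary: B \<beta>)
  case 0
  then obtain b where "b \<in> B" by fastforce
  then show ?case
    by (intro exI[of _ "\<lambda>x. if x = b then 1 else 0"]) auto
next
  case (Suc k)
  show ?case
  proof (cases "\<forall>b\<in>B. \<beta> b k = 0")
    case True
    obtain a where "(\<exists>b\<in>B. a b \<noteq> 0)" "\<forall>b. b \<notin> B \<longrightarrow> a b = 0" "\<forall>i<k. (\<Sum>b\<in>B. a b * \<beta> b i) = 0"
      using Suc.IH[of B \<beta>] Suc.prems by auto
    with True show ?thesis
      by (intro exI[of _ a]) (auto simp: less_Suc_eq)
  next
    case False
    then obtain c where c: "c \<in> B" "\<beta> c k \<noteq> 0" by auto
    define B' where "B' = B - {c}"
    define \<gamma> where "\<gamma> b i = \<beta> b i - \<beta> b k / \<beta> c k * \<beta> c i" for b i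
    have "finite B'" "card B' > k" "c \<notin> B'" and B: "B = insert c B'"
      using Suc.prems c by (auto simp: B'_def)
    then obtain a where a: "(\<exists>b\<in>B'. a b \<noteq> 0)" "\<forall>b. b \<notin> B' \<longrightarrow> a b = 0"
      "\<forall>i<k. (\<Sum>b\<in>B'. a b * \<gamma> b i) = 0"
      using Suc.IH[of B' \<gamma>] by auto
    define a' where "a' = a(c := - (\<Sum>b\<in>B'. a b * \<beta> b k / \<beta> c k))"
    have eq: "(\<Sum>b\<in>B. a' b * \<beta> b i) = (\<Sum>b\<in>B'. a b * \<gamma> b i)" for i
    proof -
      have "(\<Sum>b\<in>B'. a' b * \<beta> b i) = (\<Sum>b\<in>B'. a b * \<beta> b i)"
        using \<open>c \<notin> B'\<close> by (intro sum.cong) (auto simp: a'_def)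
      then show ?thesis
        using \<open>finite B'\<close> \<open>c \<notin> B'\<close>
        by (simp add: B \<gamma>_def a'_def right_diff_distrib sum_subtractf sum_distrib_right
            sum_distrib_left mult.assoc)
    qed
    have "\<gamma> b k = 0" for b
      using c by (simp add: \<gamma>_def)
    then have "(\<Sum>b\<in>B. a' b * \<beta> b i) = 0" if "i < Suc k" for i
      using that a(3) by (auto simp: eq less_Suc_eq)
    moreover have "\<exists>b\<in>B. a' b \<noteq> 0"
      using a(1) \<open>c \<notin> B'\<close> by (auto simp: a'_def B)
    moreover have "\<forall>b. b \<notin> B \<longrightarrow> a' b = 0"
      using a(2) by (auto simp: a'_def B)
    ultimately show ?thesis by blast
  qed
qed

section \<open>Cauchy transforms and entire functions\<close>

locale cdb =
  fixes t :: "nat \<Rightarrow> complex" and A :: "complex \<Rightarrow> complex" and mu :: "nat \<Rightarrow> real"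
  assumes data: "cdb_data t A mu"
begin

lemma inj_t: "inj t"
  and t_lim: "filterlim (\<lambda>n. cmod (t n)) at_top sequentially"
  and mu_pos: "mu n > 0"
  and mu_summable: "summable (\<lambda>n. mu n / (cmod (t n) ^ 2 + 1))"
  and A_holo: "A holomorphic_on UNIV"
  and A_eq_0_iff: "A z = 0 \<longleftrightarrow> z \<in> range t"
  and deriv_A: "deriv A (t n) \<noteq> 0"
  using data unfolding cdb_data_def by auto

lemma t_eq_iff [simp]: "t m = t n \<longleftrightarrow> m = n"
  using inj_t by (auto dest: injD)

text \<open>Comparable to |t n| for large n, but at least 1, so that its powers increase with the
  exponent and division is harmless at t n = 0.\<close>

definition tau :: "nat \<Rightarrow> real" where
  "tau n = 1 + cmod (t n)"

lemma tau_ge_1: "tau n \<ge> 1" and tau_pos: "tau n > 0"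
  by (simp_all add: tau_def add_pos_nonneg)

lemma finite_t_le: "finite {n. cmod (t n) \<le> R}"
proof -
  have "\<forall>\<^sub>F n in sequentially. R < cmod (t n)"
    using t_lim by (simp add: filterlim_at_top_dense)
  then obtain N where "\<forall>n\<ge>N. R < cmod (t n)"
    by (auto simp: eventually_sequentially)
  then have "{n. cmod (t n) \<le> R} \<subseteq> {..<N}"
    by (auto simp: not_le[symmetric])
  then show ?thesis
    by (rule finite_subset) simp
qed

lemma finite_t_eq: "finite {n. t n = w}"
  using finite_t_le[of "cmod w"] by (rule finite_subset[rotated]) auto

text \<open>The finitely many t n near z0, other than z0 itself, keep a positive distance; for the
  remaining ones |z - t n| grows like |t n|. Uniformity on a ball is what the Weierstrass test asks
  for.\<close>

lemma dist_lower:
  obtains \<delta> \<kappa> where "\<delta> > 0" "\<kappa> > 0"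
    "\<And>z n. z \<in> ball z0 \<delta> \<Longrightarrow> t n \<noteq> z0 \<Longrightarrow> \<kappa> * tau n \<le> cmod (z - t n)"
proof -
  define F where "F = {n. cmod (t n) \<le> cmod z0 + 1 \<and> t n \<noteq> z0}"
  define d where "d = Min (insert 1 ((\<lambda>n. cmod (t n - z0)) ` F))"
  have "finite F"
    using finite_t_le by (rule finite_subset[rotated]) (auto simp: F_def)
  have "d > 0"
    using \<open>finite F\<close> by (auto simp: d_def F_def)
  have d: "d \<le> cmod (t n - z0)" if "t n \<noteq> z0" for n
  proof (cases "n \<in> F")
    case True
    then show ?thesis
      using \<open>finite F\<close> by (auto simp: d_def intro!: Min_le)
  next
    case False
    then have "cmod (t n) > cmod z0 + 1"
      using that by (auto simp: F_def)
    then have "1 \<le> cmod (t n - z0)"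
      using norm_triangle_ineq2[of "t n" z0] by linarith
    moreover have "d \<le> 1"
      using \<open>finite F\<close> by (auto simp: d_def)
    ultimately show ?thesis by linarith
  qed
  define q where "q = (1 + cmod z0) / d + 1"
  have "q > 0"
    using \<open>d > 0\<close> by (simp add: q_def add_nonneg_pos)
  have "(1 / (2 * q)) * tau n \<le> cmod (z - t n)" if "z \<in> ball z0 (d / 2)" "t n \<noteq> z0" for z n
  proof -
    have "cmod (z - z0) < d / 2"
      using that(1) by (simp add: dist_norm norm_minus_commute)
    moreover have "cmod (t n - z0) \<le> cmod (z - t n) + cmod (z - z0)"
      using norm_triangle_ineq[of "t n - z" "z - z0"] by (simp add: norm_minus_commute)
    ultimately have *: "cmod (t n - z0) \<le> 2 * cmod (z - t n)"
      using d[OF that(2)] by linarith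
    have "tau n \<le> (1 + cmod z0) * 1 + cmod (t n - z0)"
      using norm_triangle_ineq[of "t n - z0" z0] by (simp add: tau_def)
    also have "\<dots> \<le> (1 + cmod z0) * (cmod (t n - z0) / d) + cmod (t n - z0)"
      using d[OF that(2)] \<open>d > 0\<close> by (intro add_right_mono mult_left_mono) auto
    also have "\<dots> = q * cmod (t n - z0)"
      by (simp add: q_def algebra_simps add_divide_distrib)
    also have "\<dots> \<le> q * (2 * cmod (z - t n))"
      using * \<open>q > 0\<close> by (intro mult_left_mono) auto
    finally show ?thesis
      using \<open>q > 0\<close> by (simp add: field_simps)
  qed
  moreover have "d / 2 > 0" "1 / (2 * q) > 0"
    using \<open>d > 0\<close> \<open>q > 0\<close> by simp_all
  ultimately show ?thesis
    using that by blast
qed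

lemma t_lower:
  obtains \<kappa> where "\<kappa> > 0" "\<And>n. t n \<noteq> w \<Longrightarrow> \<kappa> * tau n \<le> cmod (w - t n)"
  using dist_lower[of w] by (metis centre_in_ball)

text \<open>Weaker than absolute summability: the kernel 1 / (z - t n) contributes another factor 1
  / \<open>tau n\<close>. It makes Cauchy transforms converge absolutely, and locally uniformly off
  T.\<close>

definition adm :: "(nat \<Rightarrow> complex) \<Rightarrow> bool" where
  "adm a \<longleftrightarrow> summable (\<lambda>n. cmod (a n) / tau n)"

text \<open>As x / 0 = 0, the value at a point t k is that of the regular part of the transform.\<close>

definition cauchy :: "(nat \<Rightarrow> complex) \<Rightarrow> complex \<Rightarrow> complex" where
  "cauchy a z = (\<Sum>n. a n / (z - t n))"

lemma adm_le:
  assumes "adm b" "\<And>n. cmod (a n) \<le> K * cmod (b n)"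
  shows "adm a"
  unfolding adm_def
proof (rule summable_comparison_test')
  show "summable (\<lambda>n. K * (cmod (b n) / tau n))"
    using \<open>adm b\<close> unfolding adm_def by (rule summable_mult)
  show "norm (cmod (a n) / tau n) \<le> K * (cmod (b n) / tau n)" if "n \<ge> 0" for n
    using divide_right_mono[OF assms(2), of "tau n" n] tau_pos[of n] by (simp add: abs_of_pos)
qed

lemma adm_cmult: "adm a \<Longrightarrow> adm (\<lambda>n. c * a n)"
  by (erule adm_le[where K = "cmod c"]) (simp add: norm_mult)

lemma summable_cauchy_norm:
  assumes "adm a"
  shows "summable (\<lambda>n. cmod (a n / (z - t n)))"
proof -
  obtain \<kappa> where k: "\<kappa> > 0" "\<And>n. t n \<noteq> z \<Longrightarrow> \<kappa> * tau n \<le> cmod (z - t n)"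
    using t_lower by blast
  show ?thesis
  proof (rule summable_comparison_test'[where N = 0])
    show "summable (\<lambda>n. (1 / \<kappa>) * (cmod (a n) / tau n))"
      using assms unfolding adm_def by (rule summable_mult)
    show "norm (cmod (a n / (z - t n))) \<le> (1 / \<kappa>) * (cmod (a n) / tau n)" for n
    proof (cases "t n = z")
      case False
      have "0 < \<kappa> * tau n"
        using \<open>\<kappa> > 0\<close> tau_pos[of n] by simp
      then have "cmod (a n) / cmod (z - t n) \<le> cmod (a n) / (\<kappa> * tau n)"
        using k(2)[OF False] by (intro frac_le) auto
      then show ?thesis by (simp add: norm_divide)
    qed (use \<open>\<kappa> > 0\<close> tau_pos[of n] in auto)
  qed
qed

lemma summable_cauchy: "adm a \<Longrightarrow> summable (\<lambda>n. a n / (z - t n))"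
  by (rule summable_norm_cancel[OF summable_cauchy_norm])

lemma cauchy_add: "adm a \<Longrightarrow> adm b \<Longrightarrow> cauchy (\<lambda>n. a n + b n) z = cauchy a z + cauchy b z"
  by (simp add: cauchy_def add_divide_distrib suminf_add summable_cauchy)

lemma cauchy_cmult: "adm a \<Longrightarrow> cauchy (\<lambda>n. c * a n) z = c * cauchy a z"
  using suminf_mult[OF summable_cauchy, of a c z] by (simp add: cauchy_def)

lemma cauchy_finite: "finite F \<Longrightarrow> (\<And>n. n \<notin> F \<Longrightarrow> a n = 0) \<Longrightarrow> cauchy a z = (\<Sum>n\<in>F. a n / (z - t n))"
  unfolding cauchy_def by (rule suminf_finite) auto

text \<open>The center may be a point of T if its residue is zero; this case provides the regular
  part in \<open>ent_holomorphic\<close>.\<close>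

lemma cauchy_holomorphic:
  assumes "adm a" "\<And>n. t n = z0 \<Longrightarrow> a n = 0"
  obtains \<delta> where "\<delta> > 0" "cauchy a holomorphic_on ball z0 \<delta>"
    "\<And>n. t n \<noteq> z0 \<Longrightarrow> t n \<notin> ball z0 \<delta>"
proof -
  obtain \<delta> \<kappa> where dk: "\<delta> > 0" "\<kappa> > 0"
    "\<And>z n. z \<in> ball z0 \<delta> \<Longrightarrow> t n \<noteq> z0 \<Longrightarrow> \<kappa> * tau n \<le> cmod (z - t n)"
    using dist_lower by blast
  have ne: "z \<noteq> t n" if "z \<in> ball z0 \<delta>" "t n \<noteq> z0" for z n
    using dk(3)[OF that] mult_pos_pos[OF \<open>\<kappa> > 0\<close> tau_pos[of n]] by auto
  define M where "M n = (1 / \<kappa>) * (cmod (a n) / tau n)" for n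
  have bound: "cmod (a n / (z - t n)) \<le> M n" if "z \<in> ball z0 \<delta>" for n z
  proof (cases "t n = z0")
    case False
    have "0 < \<kappa> * tau n"
      using \<open>\<kappa> > 0\<close> tau_pos[of n] by simp
    then have "cmod (a n) / cmod (z - t n) \<le> cmod (a n) / (\<kappa> * tau n)"
      using dk(3)[OF that False] by (intro frac_le) auto
    then show ?thesis by (simp add: norm_divide M_def)
  qed (use assms(2) in \<open>auto simp: M_def\<close>)
  have "summable M"
    unfolding M_def using \<open>adm a\<close> unfolding adm_def by (rule summable_mult)
  have ul: "uniform_limit (ball z0 \<delta>) (\<lambda>N z. \<Sum>n<N. a n / (z - t n)) (cauchy a) sequentially"
    unfolding cauchy_def using bound \<open>summable M\<close> by (rule Weierstrass_m_test)
  have "cauchy a holomorphic_on ball z0 \<delta>"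
  proof (rule holomorphic_uniform_sequence[where f = "\<lambda>N z. \<Sum>n<N. a n / (z - t n)"])
    show "(\<lambda>z. \<Sum>n<N. a n / (z - t n)) holomorphic_on ball z0 \<delta>" for N
    proof (rule holomorphic_on_sum)
      fix n
      show "(\<lambda>z. a n / (z - t n)) holomorphic_on ball z0 \<delta>"
      proof (cases "t n = z0")
        case True
        then show ?thesis using assms(2) by simp
      next
        case False
        then show ?thesis using ne by (intro holomorphic_intros) auto
      qed
    qed
    show "\<exists>d>0. cball x d \<subseteq> ball z0 \<delta> \<and>
        uniform_limit (cball x d) (\<lambda>N z. \<Sum>n<N. a n / (z - t n)) (cauchy a) sequentially"
      if x: "x \<in> ball z0 \<delta>" for x
    proof -
      obtain d where "d > 0" "cball x d \<subseteq> ball z0 \<delta>"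
        using x by (meson open_ball open_contains_cball)
      then show ?thesis
        using uniform_limit_on_subset[OF ul] by blast
    qed
  qed auto
  then show ?thesis
    using that dk(1) ne by blast
qed

text \<open>The simple zero of A at t k cancels the simple pole of the transform, and A z * a k / (z
  - t k) tends to A'(t k) a k; this is the value of the extension on T.\<close>

definition ent :: "(nat \<Rightarrow> complex) \<Rightarrow> complex \<Rightarrow> complex" where
  "ent a z = (if z \<in> range t then deriv A z * a (inv t z) else A z * cauchy a z)"

lemma ent_t [simp]: "ent a (t k) = deriv A (t k) * a k"
  using inj_t by (simp add: ent_def)

lemma ent_off: "z \<notin> range t \<Longrightarrow> ent a z = A z * cauchy a z"
  by (simp add: ent_def)

lemma ent_eq_0_off: "z \<notin> range t \<Longrightarrow> ent a z = 0 \<longleftrightarrow> cauchy a z = 0"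
  by (simp add: ent_off A_eq_0_iff)

lemma ent_add: "adm a \<Longrightarrow> adm b \<Longrightarrow> ent (\<lambda>n. a n + b n) z = ent a z + ent b z"
  by (simp add: ent_def cauchy_add algebra_simps)

lemma ent_cmult: "adm a \<Longrightarrow> ent (\<lambda>n. c * a n) z = c * ent a z"
  by (simp add: ent_def cauchy_cmult)

lemma quotient_holomorphic:
  assumes "f holomorphic_on UNIV" "f w = 0"
  shows "(\<lambda>z. if z = w then deriv f w else f z / (z - w)) holomorphic_on UNIV"
  using pole_lemma_open[OF assms(1) open_UNIV, of w] by (simp only: assms(2) diff_zero)

lemma ent_holomorphic:
  assumes "adm a"
  shows "ent a holomorphic_on UNIV"
proof -
  have "ent a field_differentiable at z0" for z0
  proof (cases "z0 \<in> range t")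
    case False
    then obtain \<delta> where d: "\<delta> > 0" "cauchy a holomorphic_on ball z0 \<delta>"
      "\<And>n. t n \<noteq> z0 \<Longrightarrow> t n \<notin> ball z0 \<delta>"
      using cauchy_holomorphic[OF assms, of z0] by (metis rangeI)
    have "(\<lambda>z. A z * cauchy a z) holomorphic_on ball z0 \<delta>"
      by (intro holomorphic_intros d holomorphic_on_subset[OF A_holo]) auto
    moreover have "ent a z = A z * cauchy a z" if "z \<in> ball z0 \<delta>" for z
      using d(3) False that by (metis ent_off imageE rangeI)
    ultimately have "ent a holomorphic_on ball z0 \<delta>"
      by (metis (no_types, lifting) holomorphic_transform)
    then show ?thesis
      using d(1) by (intro holomorphic_on_imp_differentiable_at[of _ "ball z0 \<delta>"]) auto
  next
    case True
    then obtain k where k: "z0 = t k" by auto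
    \<comment> \<open>The residue at t k is split off: its pole is absorbed into the quotient A z /
      (z - t k), and the rest is regular near t k.\<close>
    define a1 where "a1 n = (if n = k then 0 else a n)" for n
    define a2 where "a2 n = (if n = k then a k else 0)" for n
    have a: "a = (\<lambda>n. a1 n + a2 n)"
      by (auto simp: a1_def a2_def)
    have adm: "adm a1" "adm a2"
      using \<open>adm a\<close> by (auto intro!: adm_le[of a _ 1] simp: a1_def a2_def)
    obtain \<delta> where d: "\<delta> > 0" "cauchy a1 holomorphic_on ball z0 \<delta>"
      "\<And>n. t n \<noteq> z0 \<Longrightarrow> t n \<notin> ball z0 \<delta>"
      using cauchy_holomorphic[of a1 z0] adm by (auto simp: k a1_def)
    define q where "q z = (if z = t k then deriv A (t k) else A z / (z - t k))" for z
    have "q holomorphic_on UNIV"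
      unfolding q_def using quotient_holomorphic[OF A_holo, of "t k"] by (simp add: A_eq_0_iff)
    then have "(\<lambda>z. q z * a k + A z * cauchy a1 z) holomorphic_on ball z0 \<delta>"
      by (intro holomorphic_intros d holomorphic_on_subset[OF A_holo]) (auto intro: holomorphic_on_subset)
    moreover have "ent a z = q z * a k + A z * cauchy a1 z" if "z \<in> ball z0 \<delta>" for z
    proof (cases "z = t k")
      case True
      then show ?thesis
        by (simp add: q_def A_eq_0_iff)
    next
      case False
      then have "z \<notin> range t"
        using d(3) that k by auto
      have "cauchy a2 z = (\<Sum>n\<in>{k}. a2 n / (z - t n))"
        by (rule cauchy_finite) (auto simp: a2_def)
      then have "cauchy a z = cauchy a1 z + a k / (z - t k)"
        by (subst a, subst cauchy_add[OF adm]) (simp add: a2_def)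
      then show ?thesis
        using False \<open>z \<notin> range t\<close> by (simp add: ent_off q_def algebra_simps)
    qed
    ultimately have "ent a holomorphic_on ball z0 \<delta>"
      by (metis (no_types, lifting) holomorphic_transform)
    then show ?thesis
      using d(1) by (intro holomorphic_on_imp_differentiable_at[of _ "ball z0 \<delta>"]) auto
  qed
  then show ?thesis
    by (simp add: holomorphic_on_def field_differentiable_at_within)
qed

lemma eventually_not_t: "\<forall>\<^sub>F z in at z0. z \<notin> range t"
proof -
  obtain \<delta> where d: "\<delta> > 0" "\<And>n. t n \<noteq> z0 \<Longrightarrow> t n \<notin> ball z0 \<delta>"
    using cauchy_holomorphic[of "\<lambda>_. 0" z0] by (auto simp: adm_def)
  then show ?thesis
    unfolding eventually_at by (intro exI[of _ \<delta>]) (auto simp: dist_commute)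
qed

text \<open>T is discrete, so equality off T and off one further point extends by continuity. The
  exceptional point w serves the quotients by z - w.\<close>

lemma entire_eqI:
  assumes "f holomorphic_on UNIV" "g holomorphic_on UNIV"
    and eq: "\<And>z. z \<notin> range t \<Longrightarrow> z \<noteq> w \<Longrightarrow> f z = g z"
  shows "f = g"
proof
  fix z0
  have "isCont f z0" "isCont g z0"
    using assms(1,2) by (auto simp: continuous_on_eq_continuous_at dest!: holomorphic_on_imp_continuous_on)
  then have lim: "f \<midarrow>z0\<rightarrow> f z0" "g \<midarrow>z0\<rightarrow> g z0"
    by (simp_all add: isCont_def)
  have "\<forall>\<^sub>F z in at z0. z \<noteq> w"
    by (cases "z0 = w") (auto intro: eventually_neq_at_within)
  then have "\<forall>\<^sub>F z in at z0. f z = g z"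
    using eventually_not_t[of z0] by eventually_elim (rule eq)
  then have "g \<midarrow>z0\<rightarrow> f z0"
    using lim(1) by (simp cong: filterlim_cong)
  then show "f z0 = g z0"
    using lim(2) by (intro LIM_unique)
qed

subsection \<open>Division by a zero\<close>

text \<open>The residues of C(z) / (z - w). If w = t k is a zero of F, then a k = 0, and the
  quotient acquires at w the residue C(w), the regular value.\<close>

definition divc :: "(nat \<Rightarrow> complex) \<Rightarrow> complex \<Rightarrow> nat \<Rightarrow> complex" where
  "divc a w n = (if t n = w then cauchy a w else a n / (t n - w))"

lemma divc_le:
  obtains K where "\<And>n. t n \<noteq> w \<Longrightarrow> tau n * cmod (divc a w n) \<le> K * cmod (a n)" "K > 0"
proof -
  obtain \<kappa> where k: "\<kappa> > 0" "\<And>n. t n \<noteq> w \<Longrightarrow> \<kappa> * tau n \<le> cmod (w - t n)"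
    using t_lower by blast
  have "tau n * cmod (divc a w n) \<le> (1 / \<kappa>) * cmod (a n)" if "t n \<noteq> w" for n
  proof -
    have "cmod (t n - w) > 0" using that by simp
    moreover have "\<kappa> * tau n * cmod (a n) \<le> cmod (t n - w) * cmod (a n)"
      using k(2)[OF that] by (intro mult_right_mono) (auto simp: norm_minus_commute)
    ultimately show ?thesis
      using that \<open>\<kappa> > 0\<close> by (simp add: divc_def norm_divide field_simps)
  qed
  with \<open>\<kappa> > 0\<close> show ?thesis
    using that[of "1 / \<kappa>"] by simp
qed

lemma norm_divc_le:
  obtains K where "\<And>n. t n \<noteq> w \<Longrightarrow> cmod (divc a w n) \<le> K * cmod (a n)"
proof -
  obtain K where K: "\<And>n. t n \<noteq> w \<Longrightarrow> tau n * cmod (divc a w n) \<le> K * cmod (a n)"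
    using divc_le by blast
  have "cmod (divc a w n) \<le> K * cmod (a n)" if "t n \<noteq> w" for n
    using K[OF that] mult_right_mono[OF tau_ge_1[of n], of "cmod (divc a w n)"] by simp
  then show ?thesis using that by blast
qed

lemma adm_divc:
  assumes "adm a"
  shows "adm (divc a w)"
proof -
  obtain K where K: "\<And>n. t n \<noteq> w \<Longrightarrow> cmod (divc a w n) \<le> K * cmod (a n)"
    using norm_divc_le by blast
  show ?thesis
    unfolding adm_def
  proof (rule summable_comparison_cofinite[OF _ finite_t_eq])
    show "summable (\<lambda>n. K * (cmod (a n) / tau n))"
      using assms unfolding adm_def by (rule summable_mult)
    show "norm (cmod (divc a w n) / tau n) \<le> K * (cmod (a n) / tau n)" if "n \<notin> {n. t n = w}" for n
      using divide_right_mono[OF K, of n "tau n"] that tau_pos[of n] by simp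
  qed
qed

lemma ent_zero_t: "ent a w = 0 \<Longrightarrow> t n = w \<Longrightarrow> a n = 0"
  using deriv_A[of n] by auto

text \<open>Treats zeros in T and off T alike: off T there is no index with t n = w, but then ent a
  w = 0 forces \<open>cauchy a w\<close> to be 0.\<close>

lemma sums_single_t:
  assumes "ent a w = 0"
  shows "(\<lambda>n. if t n = w then cauchy a w else 0) sums cauchy a w"
proof (cases "w \<in> range t")
  case True
  then obtain k where "w = t k" by auto
  then show ?thesis
    using sums_single[of k "\<lambda>_. cauchy a w"] by simp
next
  case False
  then have "cauchy a w = 0"
    using assms ent_eq_0_off by blast
  then have "(if t n = w then cauchy a w else 0) = 0" for n
    by simp
  with \<open>cauchy a w = 0\<close> show ?thesis by simp
qed

lemma cauchy_divc:
  assumes "adm a" "ent a w = 0" "z \<notin> range t" "z \<noteq> w"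
  shows "(z - w) * cauchy (divc a w) z = cauchy a z"
proof -
  \<comment> \<open>Partial fractions; the last summand covers an index with t n = w, where a n = 0
    and both fractions vanish.\<close>
  have "(z - w) * (divc a w n / (z - t n)) =
      a n / (z - t n) - a n / (w - t n) + (if t n = w then cauchy a w else 0)" for n
  proof (cases "t n = w")
    case True
    then show ?thesis
      using ent_zero_t[OF assms(2) True] \<open>z \<noteq> w\<close> by (simp add: divc_def)
  next
    case False
    have "z \<noteq> t n" using assms(3) by auto
    with False show ?thesis
      by (simp add: divc_def divide_simps) (simp add: algebra_simps)
  qed
  moreover have "(\<lambda>n. a n / (z - t n) - a n / (w - t n) + (if t n = w then cauchy a w else 0)) sums
      (cauchy a z - cauchy a w + cauchy a w)"
    unfolding cauchy_def[of a z] by (intro sums_add sums_diff sums_single_t assms)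
      (auto simp: cauchy_def intro!: summable_sums summable_cauchy assms)
  ultimately have "(\<lambda>n. (z - w) * (divc a w n / (z - t n))) sums cauchy a z"
    by simp
  moreover have "(\<lambda>n. (z - w) * (divc a w n / (z - t n))) sums ((z - w) * cauchy (divc a w) z)"
    unfolding cauchy_def by (intro sums_mult summable_sums summable_cauchy adm_divc assms)
  ultimately show ?thesis
    by (rule sums_unique2[rotated])
qed

lemma ent_divc:
  assumes "adm a" "ent a w = 0"
  shows "(\<lambda>z. if z = w then deriv (ent a) w else ent a z / (z - w)) = ent (divc a w)"
proof (rule entire_eqI[where w = w])
  show "(\<lambda>z. if z = w then deriv (ent a) w else ent a z / (z - w)) holomorphic_on UNIV"
    by (intro quotient_holomorphic ent_holomorphic assms)
  show "ent (divc a w) holomorphic_on UNIV"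
    by (intro ent_holomorphic adm_divc assms)
  show "(if z = w then deriv (ent a) w else ent a z / (z - w)) = ent (divc a w) z"
    if "z \<notin> range t" "z \<noteq> w" for z
    using cauchy_divc[OF assms that] that by (simp add: ent_off field_simps)
qed

subsection \<open>The space as an image of the sequence space\<close>

text \<open>\<open>coord x\<close> carries the norm, \<open>res x\<close> lists the residues of F /
  A; mu enters only through the passage between the two.\<close>

definition res :: "ell2 \<Rightarrow> nat \<Rightarrow> complex" where
  "res x n = coord x n * of_real (sqrt (mu n))"

lemma summable_mu_tau: "summable (\<lambda>n. mu n / (tau n)\<^sup>2)"
proof (rule summable_comparison_test'[OF mu_summable])
  show "norm (mu n / (tau n)\<^sup>2) \<le> mu n / (cmod (t n) ^ 2 + 1)" for n
  proof -
    have "(cmod (t n))\<^sup>2 + 1 \<le> (tau n)\<^sup>2"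
      by (simp add: tau_def power2_sum)
    moreover have "0 < (cmod (t n))\<^sup>2 + 1" "0 < (tau n)\<^sup>2"
      using tau_pos[of n] by (auto simp: add_nonneg_pos)
    ultimately have "mu n / (tau n)\<^sup>2 \<le> mu n / ((cmod (t n))\<^sup>2 + 1)"
      using mu_pos[of n] by (intro divide_left_mono mult_pos_pos) auto
    then show ?thesis
      using mu_pos[of n] by (simp add: less_imp_le)
  qed
qed

lemma adm_res: "adm (res x)"
proof -
  have "(cmod (of_real (sqrt (mu n) / tau n) :: complex))\<^sup>2 = mu n / (tau n)\<^sup>2" for n
    using mu_pos[of n] by (simp only: norm_of_real power2_abs) (simp add: power_divide)
  then have "summable (\<lambda>n. (cmod (of_real (sqrt (mu n) / tau n) :: complex))\<^sup>2)"
    using summable_mu_tau by simp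
  from summable_mult_of_sq[OF coord_summable[of x] this] show ?thesis
    unfolding adm_def res_def using tau_pos by (simp add: norm_mult less_imp_le mult.assoc norm_divide)
qed

definition Phi :: "ell2 \<Rightarrow> complex \<Rightarrow> complex" where
  "Phi x = ent (res x)"

lemma res_add: "res (x + y) = (\<lambda>n. res x n + res y n)"
  by (auto simp: res_def distrib_right)

lemma res_cscale: "res (cscale a x) = (\<lambda>n. a * res x n)"
  by (auto simp: res_def)

lemma Phi_add: "Phi (x + y) z = Phi x z + Phi y z"
  by (simp add: Phi_def res_add ent_add adm_res)

lemma Phi_cscale: "Phi (cscale a x) z = a * Phi x z"
  by (simp add: Phi_def res_cscale ent_cmult adm_res)

lemma Phi_0 [simp]: "Phi 0 z = 0"
  using Phi_cscale[of 0 0 z] by (simp add: ell2_eqI[of "cscale 0 0" 0])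

lemma Phi_diff: "Phi (x - y) z = Phi x z - Phi y z"
  using Phi_add[of "x - y" y z] by simp

lemma Phi_sum: "Phi (sum f I) z = (\<Sum>i\<in>I. Phi (f i) z)"
  by (induction I rule: infinite_finite_induct) (auto simp: Phi_add)

lemma Phi_holomorphic: "Phi x holomorphic_on UNIV"
  unfolding Phi_def by (intro ent_holomorphic adm_res)

lemma sqrt_mu [simp]: "sqrt (mu n) \<noteq> 0" "mu n \<noteq> 0" "sqrt (mu n) > 0" "mu n \<ge> 0" "mu n > 0"
  using mu_pos[of n] by auto

lemma Phi_t: "Phi x (t n) = deriv A (t n) * (coord x n * of_real (sqrt (mu n)))"
  by (simp add: Phi_def res_def)

lemma Phi_t_eq_0 [simp]: "Phi x (t n) = 0 \<longleftrightarrow> coord x n = 0"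
  by (simp add: Phi_t deriv_A)

lemma Phi_inj: "Phi x = Phi y \<longleftrightarrow> x = y"
proof
  assume eq: "Phi x = Phi y"
  have "Phi x (t n) = Phi y (t n)" for n
    by (simp add: eq)
  then show "x = y"
    by (intro ell2_eqI) (simp add: Phi_t deriv_A)
qed simp

lemma Phi_eq_0_iff: "Phi x = (\<lambda>_. 0) \<longleftrightarrow> x = 0"
  using Phi_inj[of x 0] by (simp add: fun_eq_iff)

text \<open>By \<open>entire_eqI\<close> the extension to T is forced, and by \<open>Phi_inj\<close>
  the coefficients are unique. So everything below is done with vectors of \<open>ell2\<close>, and
  subspaces are pulled back along \<open>Phi\<close>.\<close>

lemma cdb_rep_iff: "cdb_rep t A mu F c \<longleftrightarrow> (\<exists>x. c = coord x \<and> F = Phi x)"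
proof
  assume rep: "cdb_rep t A mu F c"
  define x where "x = Ell2 c"
  have c: "coord x = c"
    using rep by (simp add: cdb_rep_def x_def coord_Ell2)
  have "F = Phi x"
  proof (rule entire_eqI[where w = "t 0"])
    show "F z = Phi x z" if "z \<notin> range t" for z
      using rep that by (simp add: cdb_rep_def Phi_def ent_off cauchy_def res_def[abs_def] c)
  qed (use rep Phi_holomorphic in \<open>auto simp: cdb_rep_def\<close>)
  with c show "\<exists>x. c = coord x \<and> F = Phi x" by blast
next
  assume "\<exists>x. c = coord x \<and> F = Phi x"
  then show "cdb_rep t A mu F c"
    by (auto simp: cdb_rep_def coord_summable Phi_holomorphic Phi_def ent_off cauchy_def res_def
        intro!: ent_holomorphic adm_res)
qed

lemma cdb_space_eq: "cdb_space t A mu = range Phi"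
  by (auto simp: cdb_space_def cdb_rep_iff)

text \<open>Total in w and always square summable; it represents F(z) / (z - w) only if F vanishes
  at w (\<open>Phi_quot\<close>).\<close>

definition quot :: "ell2 \<Rightarrow> complex \<Rightarrow> ell2" where
  "quot x w = Ell2 (\<lambda>n. if t n = w then cauchy (res x) w / of_real (sqrt (mu n))
                        else coord x n / (t n - w))"

lemma coord_quot:
  "coord (quot x w) n = (if t n = w then cauchy (res x) w / of_real (sqrt (mu n))
                         else coord x n / (t n - w))"
proof -
  define c where "c n = (if t n = w then cauchy (res x) w / of_real (sqrt (mu n))
                         else coord x n / (t n - w))" for n
  obtain \<kappa> where k: "\<kappa> > 0" "\<And>n. t n \<noteq> w \<Longrightarrow> \<kappa> * tau n \<le> cmod (w - t n)"
    using t_lower by blast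
  have "summable (\<lambda>n. (cmod (c n))\<^sup>2)"
  proof (rule summable_comparison_cofinite[OF _ finite_t_eq])
    show "summable (\<lambda>n. (1 / \<kappa>)\<^sup>2 * (cmod (coord x n))\<^sup>2)"
      by (intro summable_mult coord_summable)
    fix n assume "n \<notin> {n. t n = w}"
    then have n: "t n \<noteq> w" by simp
    have "\<kappa> * 1 \<le> \<kappa> * tau n"
      using \<open>\<kappa> > 0\<close> tau_ge_1 by (intro mult_left_mono) auto
    then have "\<kappa> \<le> cmod (t n - w)"
      using k(2)[OF n] by (simp add: norm_minus_commute)
    then have "cmod (c n) \<le> cmod (coord x n) / \<kappa>"
      using n \<open>\<kappa> > 0\<close> by (auto simp: c_def norm_divide intro!: divide_left_mono)
    then have "(cmod (c n))\<^sup>2 \<le> (cmod (coord x n) / \<kappa>)\<^sup>2"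
      by (intro power_mono) auto
    then show "norm ((cmod (c n))\<^sup>2) \<le> (1 / \<kappa>)\<^sup>2 * (cmod (coord x n))\<^sup>2"
      by (simp add: power_divide)
  qed
  then have "coord (Ell2 c) = c"
    by (rule coord_Ell2)
  moreover have "quot x w = Ell2 c"
    unfolding quot_def c_def ..
  ultimately show ?thesis
    by (simp add: c_def)
qed

lemma res_quot: "res (quot x w) = divc (res x) w"
  by (auto simp: res_def divc_def coord_quot)

lemma Phi_quot:
  "Phi x w = 0 \<Longrightarrow> (\<lambda>z. if z = w then deriv (Phi x) w else Phi x z / (z - w)) = Phi (quot x w)"
  unfolding Phi_def res_quot by (intro ent_divc adm_res)

lemma Phi_quot_at: "Phi x w = 0 \<Longrightarrow> z \<noteq> w \<Longrightarrow> Phi (quot x w) z = Phi x z / (z - w)"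
  using fun_cong[OF Phi_quot, of x w z] by simp

text \<open>If F vanishes at s, then F(z) (z - w) / (z - s) = F(z) + (s - w) F(z) / (z - s).\<close>

definition move :: "ell2 \<Rightarrow> complex \<Rightarrow> complex \<Rightarrow> ell2" where
  "move x s w = x + cscale (s - w) (quot x s)"

lemma Phi_move: "Phi x s = 0 \<Longrightarrow> z \<noteq> s \<Longrightarrow> Phi (move x s w) z = Phi x z * ((z - w) / (z - s))"
  by (simp add: move_def Phi_add Phi_cscale Phi_quot_at field_simps)

lemma coord_move: "t n \<noteq> s \<Longrightarrow> coord (move x s w) n = coord x n * ((t n - w) / (t n - s))"
  by (simp add: move_def coord_quot field_simps)

lemma Phi_move_zero: "Phi x s = 0 \<Longrightarrow> Phi (move x s w) w = 0"
  by (cases "w = s") (simp_all add: Phi_move, simp add: move_def Phi_add Phi_cscale)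

lemma Phi_move_keep: "Phi x s = 0 \<Longrightarrow> Phi x z = 0 \<Longrightarrow> z \<noteq> s \<Longrightarrow> Phi (move x s w) z = 0"
  by (simp add: Phi_move)


end

section \<open>Closed and nearly invariant subspaces\<close>

definition csub :: "ell2 set \<Rightarrow> bool" where
  "csub V \<longleftrightarrow> 0 \<in> V \<and> (\<forall>x\<in>V. \<forall>y\<in>V. x + y \<in> V) \<and> (\<forall>a. \<forall>x\<in>V. cscale a x \<in> V) \<and> closed V"

lemma csub_sum: "csub V \<Longrightarrow> (\<And>i. i \<in> I \<Longrightarrow> f i \<in> V) \<Longrightarrow> sum f I \<in> V"
  by (induction I rule: infinite_finite_induct) (auto simp: csub_def)

lemma csub_lincomb: "csub V \<Longrightarrow> (\<And>i. i \<in> I \<Longrightarrow> f i \<in> V) \<Longrightarrow> (\<Sum>i\<in>I. cscale (a i) (f i)) \<in> V"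
  by (intro csub_sum) (auto simp: csub_def)

lemma cscale_minus_one: "cscale (- 1) x = - x"
  by (rule ell2_eqI) simp

lemma csub_minus: "csub V \<Longrightarrow> x \<in> V \<Longrightarrow> - x \<in> V"
  unfolding csub_def by (metis cscale_minus_one)

lemma csub_diff: "csub V \<Longrightarrow> x \<in> V \<Longrightarrow> y \<in> V \<Longrightarrow> x - y \<in> V"
  using csub_minus[of V y] unfolding csub_def by (metis add_uminus_conv_diff)

lemma bounded_linear_pairing: "bounded_linear (\<lambda>x. pairing x u)"
proof (rule bounded_linear_intro)
  show "norm (pairing x u) \<le> norm x * norm u" for x
    by (rule norm_pairing_le)
  show "pairing (r *\<^sub>R x) u = r *\<^sub>R pairing x u" for r x
    by (simp only: cscale_of_real[symmetric] pairing_cscale scaleR_conv_of_real)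
qed (rule pairing_add)

lemma closed_pairing: "closed {x. pairing x u = 0}"
  by (intro closed_Collect_eq continuous_intros bounded_linear.continuous_on[OF bounded_linear_pairing])

lemma csub_annihilator: "csub {x. \<forall>u\<in>U. pairing x u = 0}"
proof -
  have "{x. \<forall>u\<in>U. pairing x u = 0} = (\<Inter>u\<in>U. {x. pairing x u = 0})"
    by auto
  then have "closed {x. \<forall>u\<in>U. pairing x u = 0}"
    by (simp add: closed_pairing closed_INT)
  then show ?thesis
    by (simp add: csub_def pairing_add pairing_cscale)
qed

lemma csub_bipolar:
  assumes "csub V" "\<And>u. (\<And>v. v \<in> V \<Longrightarrow> pairing v u = 0) \<Longrightarrow> pairing x u = 0"
  shows "x \<in> V"
proof (rule ccontr)
  assume "x \<notin> V"
  then obtain u where "\<And>v. v \<in> V \<Longrightarrow> pairing v u = 0" "pairing x u \<noteq> 0"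
    using assms(1) closed_csubspace_separation[of V x] unfolding csub_def by metis
  then show False
    using assms(2) by blast
qed

definition codim :: "ell2 set \<Rightarrow> nat \<Rightarrow> bool" where
  "codim V m \<longleftrightarrow> (\<exists>B. finite B \<and> card B = m \<and>
     (\<forall>a. (\<Sum>b\<in>B. cscale (a b) b) \<in> V \<longrightarrow> (\<forall>b\<in>B. a b = 0)) \<and>
     (\<forall>x. \<exists>a. \<exists>y\<in>V. x = y + (\<Sum>b\<in>B. cscale (a b) b)))"

text \<open>A finite spanning set modulo V of least cardinality is independent modulo V: a
  nontrivial relation would express one of its elements by the others and an element of V.\<close>

lemma codim_if_spanning:
  assumes V: "csub V" and B: "finite B" "\<And>x. \<exists>a. \<exists>y\<in>V. x = y + (\<Sum>b\<in>B. cscale (a b) b)"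
  shows "\<exists>m. codim V m"
proof -
  define P where "P B \<longleftrightarrow> finite B \<and> (\<forall>x. \<exists>a. \<exists>y\<in>V. x = y + (\<Sum>b\<in>B. cscale (a b) b))" for B
  have "P B" using B by (auto simp: P_def)
  then obtain C where C: "P C" and min: "\<And>D. P D \<Longrightarrow> card C \<le> card D"
    using ex_has_least_nat[of P B card] by blast
  have fin: "finite C" using C by (simp add: P_def)
  have "\<forall>b\<in>C. a b = 0" if a: "(\<Sum>b\<in>C. cscale (a b) b) \<in> V" for a
  proof (rule ccontr)
    assume "\<not> (\<forall>b\<in>C. a b = 0)"
    then obtain c where c: "c \<in> C" "a c \<noteq> 0" by auto
    define D where "D = C - {c}"
    have D: "finite D" "C = insert c D" "c \<notin> D"
      using fin c by (auto simp: D_def)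
    define v where "v = (\<Sum>b\<in>C. cscale (a b) b)"
    have ceq: "c = cscale (1 / a c) v - (\<Sum>b\<in>D. cscale (a b / a c) b)"
    proof (rule ell2_eqI)
      fix n
      have "coord v n = a c * coord c n + (\<Sum>b\<in>D. a b * coord b n)"
        using D by (simp add: v_def)
      then show "coord c n = coord (cscale (1 / a c) v - (\<Sum>b\<in>D. cscale (a b / a c) b)) n"
        using c(2) by (simp add: field_simps sum_divide_distrib sum_distrib_left sum_distrib_right)
    qed
    have "P D"
      unfolding P_def
    proof (intro conjI allI \<open>finite D\<close>)
      fix x
      obtain f y where y: "y \<in> V" "x = y + (\<Sum>b\<in>C. cscale (f b) b)"
        using C unfolding P_def by metis
      have "x = (y + cscale (f c / a c) v) + (\<Sum>b\<in>D. cscale (f b - f c * (a b / a c)) b)"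
      proof (rule ell2_eqI)
        fix n
        have "coord x n = coord y n + f c * coord c n + (\<Sum>b\<in>D. f b * coord b n)"
          unfolding y(2) using D by simp
        also have "coord c n = coord v n / a c - (\<Sum>b\<in>D. a b / a c * coord b n)"
          by (subst ceq) simp
        finally show "coord x n =
            coord ((y + cscale (f c / a c) v) + (\<Sum>b\<in>D. cscale (f b - f c * (a b / a c)) b)) n"
          by (simp add: algebra_simps sum_subtractf sum_distrib_left)
      qed
      moreover have "y + cscale (f c / a c) v \<in> V"
        using V y(1) a by (simp add: csub_def v_def)
      ultimately show "\<exists>g. \<exists>y\<in>V. x = y + (\<Sum>b\<in>D. cscale (g b) b)"
        by (intro exI[of _ "\<lambda>b. f b - f c * (a b / a c)"] bexI)
    qed
    from min[OF this] show False
      using D by simp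
  qed
  with C show ?thesis
    unfolding codim_def P_def by blast
qed

definition unit_seq :: "nat \<Rightarrow> ell2" where
  "unit_seq i = Ell2 (\<lambda>n. if n = i then 1 else 0)"

lemma coord_unit_seq [simp]: "coord (unit_seq i) n = (if n = i then 1 else 0)"
proof -
  have "summable (\<lambda>n. (cmod (if n = i then 1 else 0))\<^sup>2)"
    by (rule summable_finite[of "{i}"]) auto
  then show ?thesis
    by (simp add: unit_seq_def coord_Ell2)
qed

text \<open>The quotient by V has dimension m, so any m + 1 vectors are dependent in it: the
  coordinates in a complement basis give m equations in m + 1 unknowns.\<close>

lemma codim_dependent:
  assumes V: "csub V" and "codim V m"
  obtains \<alpha> where "\<exists>i\<le>m. \<alpha> i \<noteq> 0" "(\<Sum>i\<le>m. cscale (\<alpha> i) (f i)) \<in> V"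
proof -
  obtain B where B: "finite B" "card B = m"
    "\<And>x. \<exists>a. \<exists>y\<in>V. x = y + (\<Sum>b\<in>B. cscale (a b) b)"
    using assms(2) unfolding codim_def by blast
  obtain b where b: "bij_betw b {..<m} B"
    using ex_bij_betw_nat_finite[OF B(1)] B(2) by (auto simp: atLeast0LessThan)
  have "\<exists>a y. y \<in> V \<and> f i = y + (\<Sum>b\<in>B. cscale (a b) b)" for i
    using B(3)[of "f i"] by blast
  then obtain a y where ay: "\<And>i. y i \<in> V" "\<And>i. f i = y i + (\<Sum>b\<in>B. cscale (a i b) b)"
    by metis
  obtain \<alpha> where \<alpha>: "\<exists>i\<in>{..m}. \<alpha> i \<noteq> 0" "\<forall>j<m. (\<Sum>i\<in>{..m}. \<alpha> i * a i (b j)) = 0"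
    using homogeneous_nontrivial[of "{..m}" m "\<lambda>i j. a i (b j)"] by auto
  have zero: "(\<Sum>i\<le>m. \<alpha> i * a i c) = 0" if "c \<in> B" for c
    using \<alpha>(2) b that unfolding bij_betw_def by auto
  have "(\<Sum>i\<le>m. cscale (\<alpha> i) (f i)) = (\<Sum>i\<le>m. cscale (\<alpha> i) (y i))"
  proof (rule ell2_eqI)
    fix n
    have "(\<Sum>i\<le>m. \<alpha> i * (\<Sum>b\<in>B. a i b * coord b n)) = (\<Sum>b\<in>B. (\<Sum>i\<le>m. \<alpha> i * a i b) * coord b n)"
      by (simp add: sum_distrib_left sum_distrib_right mult.assoc) (rule sum.swap)
    also have "\<dots> = 0"
      by (intro sum.neutral ballI) (simp add: zero)
    finally show "coord (\<Sum>i\<le>m. cscale (\<alpha> i) (f i)) n = coord (\<Sum>i\<le>m. cscale (\<alpha> i) (y i)) n"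
      by (simp add: ay(2) distrib_left sum.distrib)
  qed
  moreover have "(\<Sum>i\<le>m. cscale (\<alpha> i) (y i)) \<in> V"
    using ay(1) by (intro csub_lincomb V)
  ultimately show ?thesis
    using \<alpha>(1) by (intro that[of \<alpha>]) auto
qed

lemma summable_norm_add:
  fixes f g :: "nat \<Rightarrow> 'a::real_normed_vector"
  assumes "summable (\<lambda>n. norm (f n))" "summable (\<lambda>n. norm (g n))"
  shows "summable (\<lambda>n. norm (f n + g n))"
  by (rule summable_comparison_test'[OF summable_add[OF assms], where N = 0])
    (simp add: norm_triangle_ineq)

lemma poly_growth:
  fixes p :: "complex poly"
  obtains K where "K > 0" "\<And>z. cmod (poly p z) \<le> K * (1 + cmod z) ^ degree p"
proof -
  define K where "K = (\<Sum>i\<le>degree p. cmod (coeff p i)) + 1"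
  have "cmod (poly p z) \<le> K * (1 + cmod z) ^ degree p" for z
  proof -
    have "cmod (poly p z) \<le> (\<Sum>i\<le>degree p. cmod (coeff p i) * cmod z ^ i)"
      unfolding poly_altdef by (rule sum_norm_le) (simp add: norm_mult norm_power)
    also have "\<dots> \<le> (\<Sum>i\<le>degree p. cmod (coeff p i) * (1 + cmod z) ^ degree p)"
    proof (intro sum_mono mult_left_mono)
      fix i assume "i \<in> {..degree p}"
      have "cmod z ^ i \<le> (1 + cmod z) ^ i"
        by (intro power_mono) auto
      also have "\<dots> \<le> (1 + cmod z) ^ degree p"
        using \<open>i \<in> {..degree p}\<close> by (intro power_increasing) auto
      finally show "cmod z ^ i \<le> (1 + cmod z) ^ degree p" .
    qed auto
    also have "\<dots> \<le> K * (1 + cmod z) ^ degree p"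
      by (simp add: K_def sum_distrib_right[symmetric] mult_right_mono)
    finally show ?thesis .
  qed
  moreover have "K > 0"
    by (simp add: K_def add_nonneg_pos sum_nonneg)
  ultimately show ?thesis
    using that by blast
qed

context cdb
begin

lemma Phi_mem_image [simp]: "Phi x \<in> Phi ` V \<longleftrightarrow> x \<in> V"
  by (auto simp: Phi_inj)

lemma norm_diff_sq: "(norm (x - y))\<^sup>2 = (\<Sum>n. (cmod (coord x n - coord y n))\<^sup>2)"
  by (simp add: norm_ell2_sq)

lemma tendsto_iff_coord:
  "X \<longlonglongrightarrow> l \<longleftrightarrow> (\<lambda>k. \<Sum>n. (cmod (coord (X k) n - coord l n))\<^sup>2) \<longlonglongrightarrow> 0"
proof -
  have "X \<longlonglongrightarrow> l \<longleftrightarrow> (\<lambda>k. norm (X k - l)) \<longlonglongrightarrow> 0"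
    by (simp add: LIM_zero_iff tendsto_norm_zero_iff)
  also have "\<dots> \<longleftrightarrow> (\<lambda>k. (norm (X k - l))\<^sup>2) \<longlonglongrightarrow> 0"
    by (auto intro: tendsto_eq_intros)
  finally show ?thesis
    by (simp add: norm_diff_sq)
qed

lemma cdb_closed_subspace_iff: "cdb_closed_subspace t A mu S \<longleftrightarrow> (\<exists>V. csub V \<and> S = Phi ` V)"
proof
  assume S: "cdb_closed_subspace t A mu S"
  define V where "V = {x. Phi x \<in> S}"
  have SV: "S = Phi ` V"
    using S by (auto simp: cdb_closed_subspace_def V_def cdb_space_eq)
  have "csub V"
    unfolding csub_def
  proof (intro conjI ballI allI)
    have "Phi 0 = (\<lambda>_. 0)" by auto
    then show "0 \<in> V"
      using S by (simp add: V_def cdb_closed_subspace_def)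
    show "x + y \<in> V" if "x \<in> V" "y \<in> V" for x y
    proof -
      have "Phi (x + y) = (\<lambda>z. Phi x z + Phi y z)" by (auto simp: Phi_add)
      then show ?thesis
        using S that by (simp add: V_def cdb_closed_subspace_def)
    qed
    show "cscale a x \<in> V" if "x \<in> V" for a x
    proof -
      have "Phi (cscale a x) = (\<lambda>z. a * Phi x z)" by (auto simp: Phi_cscale)
      then show ?thesis
        using S that by (simp add: V_def cdb_closed_subspace_def)
    qed
    show "closed V"
      unfolding closed_sequential_limits
    proof (intro allI impI, elim conjE)
      fix X l assume X: "\<forall>n. X n \<in> V" "X \<longlonglongrightarrow> l"
      have "(\<forall>k. Phi (X k) \<in> S \<and> cdb_rep t A mu (Phi (X k)) (coord (X k))) \<and>
          cdb_rep t A mu (Phi l) (coord l) \<and>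
          (\<lambda>k. \<Sum>n. (cmod (coord (X k) n - coord l n))\<^sup>2) \<longlonglongrightarrow> 0"
        using X unfolding cdb_rep_iff tendsto_iff_coord V_def by blast
      then have "Phi l \<in> S"
        using S unfolding cdb_closed_subspace_def by meson
      then show "l \<in> V" by (simp add: V_def)
    qed
  qed
  with SV show "\<exists>V. csub V \<and> S = Phi ` V" by blast
next
  assume "\<exists>V. csub V \<and> S = Phi ` V"
  then obtain V where V: "csub V" and S: "S = Phi ` V" by blast
  show "cdb_closed_subspace t A mu S"
    unfolding cdb_closed_subspace_def
  proof (intro conjI ballI allI impI)
    show "S \<subseteq> cdb_space t A mu"
      by (auto simp: S cdb_space_eq)
    have "(\<lambda>_. 0) = Phi 0" by auto
    then show "(\<lambda>_. 0) \<in> S"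
      using V by (auto simp: S csub_def)
    show "(\<lambda>z. f z + g z) \<in> S" if fg: "f \<in> S" "g \<in> S" for f g
    proof -
      obtain x y where xy: "x \<in> V" "y \<in> V" "f = Phi x" "g = Phi y"
        using fg unfolding S by blast
      then have "(\<lambda>z. f z + g z) = Phi (x + y)" by (auto simp: Phi_add)
      then show ?thesis
        using V xy by (simp add: S csub_def)
    qed
    show "(\<lambda>z. a * f z) \<in> S" if fg: "f \<in> S" for f a
    proof -
      obtain x where x: "x \<in> V" "f = Phi x"
        using fg unfolding S by blast
      then have "(\<lambda>z. a * f z) = Phi (cscale a x)" by (auto simp: Phi_cscale)
      then show ?thesis
        using V x by (simp add: S csub_def)
    qed
    fix Fs F cs c
    assume *: "(\<forall>k. Fs k \<in> S \<and> cdb_rep t A mu (Fs k) (cs k)) \<and> cdb_rep t A mu F c \<and>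
        (\<lambda>k. \<Sum>n. (cmod (cs k n - c n))\<^sup>2) \<longlonglongrightarrow> 0"
    then obtain l where l: "c = coord l" "F = Phi l"
      unfolding cdb_rep_iff by blast
    have "\<forall>k. \<exists>x. cs k = coord x \<and> Fs k = Phi x"
      using * unfolding cdb_rep_iff by blast
    then obtain X where X: "\<And>k. cs k = coord (X k)" "\<And>k. Fs k = Phi (X k)"
      by metis
    have "X \<longlonglongrightarrow> l"
      using * unfolding tendsto_iff_coord X l by blast
    moreover have "X k \<in> V" for k
      using * by (simp add: X S)
    ultimately have "l \<in> V"
      using V unfolding csub_def by (meson closed_sequentially)
    then show "F \<in> S" by (simp add: l S)
  qed
qed

definition ninv :: "ell2 set \<Rightarrow> bool" where
  "ninv V \<longleftrightarrow> csub V \<and> (\<forall>x\<in>V. \<forall>w. Phi x w = 0 \<longrightarrow> quot x w \<in> V)"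

lemma nearly_invariant_image: "nearly_invariant t A mu (Phi ` V) \<longleftrightarrow> ninv V"
proof -
  have "cdb_closed_subspace t A mu (Phi ` V) \<longleftrightarrow> csub V"
    unfolding cdb_closed_subspace_iff by (metis Phi_mem_image subsetI subset_antisym)
  moreover have "(\<forall>f\<in>Phi ` V. \<forall>w. f w = 0 \<longrightarrow> (\<lambda>z. if z = w then deriv f w else f z / (z - w)) \<in> Phi ` V)
      \<longleftrightarrow> (\<forall>x\<in>V. \<forall>w. Phi x w = 0 \<longrightarrow> quot x w \<in> V)"
    by (simp add: Phi_quot cong: imp_cong)
  ultimately show ?thesis
    unfolding nearly_invariant_def ninv_def by blast
qed

lemma nearly_invariant_iff: "nearly_invariant t A mu S \<longleftrightarrow> (\<exists>V. ninv V \<and> S = Phi ` V)"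
proof
  assume S: "nearly_invariant t A mu S"
  then obtain V where "S = Phi ` V"
    unfolding nearly_invariant_def cdb_closed_subspace_iff by blast
  with S show "\<exists>V. ninv V \<and> S = Phi ` V"
    by (auto simp: nearly_invariant_image)
qed (auto simp: nearly_invariant_image)

lemma has_codim_iff: "has_codim (cdb_space t A mu) (Phi ` V) m \<longleftrightarrow> codim V m"
proof -
  have inj: "inj_on Phi B" for B
    by (simp add: inj_on_def Phi_inj)
  have eq: "(\<lambda>z. \<Sum>b\<in>Phi ` B. a b * b z) = Phi (\<Sum>b\<in>B. cscale (a (Phi b)) b)" for a B
    by (auto simp: Phi_sum Phi_cscale sum.reindex[OF inj])
  have eq2: "(\<lambda>z. Phi y z + (\<Sum>b\<in>Phi ` B. a b * b z)) = Phi (y + (\<Sum>b\<in>B. cscale (a (Phi b)) b))" for y a B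
    using fun_cong[OF eq] by (auto simp: Phi_add)
  have main: "(finite (Phi ` B) \<and> card (Phi ` B) = m \<and>
        (\<forall>a. (\<lambda>z. \<Sum>b\<in>Phi ` B. a b * b z) \<in> Phi ` V \<longrightarrow> (\<forall>b\<in>Phi ` B. a b = 0)) \<and>
        (\<forall>F\<in>range Phi. \<exists>a. \<exists>G\<in>Phi ` V. F = (\<lambda>z. G z + (\<Sum>b\<in>Phi ` B. a b * b z)))) \<longleftrightarrow>
      (finite B \<and> card B = m \<and> (\<forall>a. (\<Sum>b\<in>B. cscale (a b) b) \<in> V \<longrightarrow> (\<forall>b\<in>B. a b = 0)) \<and>
       (\<forall>x. \<exists>a. \<exists>y\<in>V. x = y + (\<Sum>b\<in>B. cscale (a b) b)))" for B
  proof -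
    have lift: "(\<exists>a. Q (\<lambda>b. a (Phi b))) \<longleftrightarrow> (\<exists>a. Q a)" for Q :: "(ell2 \<Rightarrow> complex) \<Rightarrow> bool"
    proof
      assume "\<exists>a. Q a"
      then obtain a where "Q a" by blast
      moreover have "(\<lambda>b. (\<lambda>f. a (inv Phi f)) (Phi b)) = a"
        using inv_f_f[OF inj] by auto
      ultimately show "\<exists>a. Q (\<lambda>b. a (Phi b))"
        by (intro exI[of _ "\<lambda>f. a (inv Phi f)"]) simp
    qed blast
    have ind: "(\<forall>a. (\<Sum>b\<in>B. cscale (a (Phi b)) b) \<in> V \<longrightarrow> (\<forall>b\<in>B. a (Phi b) = 0)) \<longleftrightarrow>
        (\<forall>a. (\<Sum>b\<in>B. cscale (a b) b) \<in> V \<longrightarrow> (\<forall>b\<in>B. a b = 0))"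
      using lift[of "\<lambda>a. \<not> ((\<Sum>b\<in>B. cscale (a b) b) \<in> V \<longrightarrow> (\<forall>b\<in>B. a b = 0))"] by blast
    have span: "(\<exists>a. \<exists>y\<in>V. x = y + (\<Sum>b\<in>B. cscale (a (Phi b)) b)) \<longleftrightarrow>
        (\<exists>a. \<exists>y\<in>V. x = y + (\<Sum>b\<in>B. cscale (a b) b))" for x
      by (rule lift)
    show ?thesis
      using ind span by (simp add: eq eq2 Phi_inj finite_image_iff[OF inj] card_image[OF inj])
  qed
  have "(\<exists>C. finite C \<and> card C = m \<and> C \<subseteq> range Phi \<and> Q C) \<longleftrightarrow>
      (\<exists>B. finite (Phi ` B) \<and> card (Phi ` B) = m \<and> Q (Phi ` B))" for Q
    by (metis subset_imageE image_mono subset_UNIV)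
  then show ?thesis
    unfolding has_codim_def codim_def cdb_space_eq using main by simp
qed

subsection \<open>Moments\<close>

definition rapid :: "(nat \<Rightarrow> complex) \<Rightarrow> bool" where
  "rapid a \<longleftrightarrow> (\<forall>k. summable (\<lambda>n. cmod (a n) * tau n ^ k))"

definition mom :: "nat \<Rightarrow> (nat \<Rightarrow> complex) \<Rightarrow> complex" where
  "mom j a = (\<Sum>n. a n * t n ^ j)"

lemma cmod_t_le_tau: "cmod (t n) \<le> tau n"
  by (simp add: tau_def)

lemma rapid_imp_adm:
  assumes "rapid a"
  shows "adm a"
proof -
  have "summable (\<lambda>n. cmod (a n) * tau n ^ 0)"
    using assms unfolding rapid_def by blast
  then show ?thesis
    unfolding adm_def
  proof (rule summable_comparison_test'[where N = 0])
    show "norm (cmod (a n) / tau n) \<le> cmod (a n) * tau n ^ 0" for n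
    proof -
      have "cmod (a n) / tau n \<le> cmod (a n) / 1"
        using tau_ge_1[of n] by (intro divide_left_mono) auto
      then show ?thesis
        using tau_pos[of n] by (simp add: abs_of_pos)
    qed
  qed
qed

lemma rapid_le:
  assumes "rapid a" "\<And>n. cmod (b n) \<le> K * tau n ^ k * cmod (a n)"
  shows "rapid b"
  unfolding rapid_def
proof
  fix j
  have "summable (\<lambda>n. K * (cmod (a n) * tau n ^ (k + j)))"
    using assms(1) unfolding rapid_def by (intro summable_mult) blast
  then show "summable (\<lambda>n. cmod (b n) * tau n ^ j)"
  proof (rule summable_comparison_test'[where N = 0])
    show "norm (cmod (b n) * tau n ^ j) \<le> K * (cmod (a n) * tau n ^ (k + j))" for n
      using mult_right_mono[OF assms(2)[of n], of "tau n ^ j"] tau_pos[of n]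
      by (simp add: power_add algebra_simps abs_mult abs_of_pos)
  qed
qed

lemma rapid_finite: "finite {n. a n \<noteq> 0} \<Longrightarrow> rapid a"
  unfolding rapid_def by (intro allI summable_finite) auto

lemma rapid_add:
  assumes "rapid a" "rapid b"
  shows "rapid (\<lambda>n. a n + b n)"
  unfolding rapid_def
proof
  fix k
  have *: "summable (\<lambda>n. norm (a n * of_real (tau n ^ k)))" "summable (\<lambda>n. norm (b n * of_real (tau n ^ k)))"
    using assms tau_pos unfolding rapid_def by (simp_all add: norm_mult norm_power less_imp_le)
  show "summable (\<lambda>n. cmod (a n + b n) * tau n ^ k)"
    using summable_norm_add[OF *] tau_pos
    by (simp add: norm_mult norm_power less_imp_le distrib_right[symmetric])
qed

lemma rapid_summable_poly_norm:
  assumes "rapid a"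
  shows "summable (\<lambda>n. cmod (a n * poly p (t n)))"
proof -
  obtain K where K: "K > 0" "\<And>z. cmod (poly p z) \<le> K * (1 + cmod z) ^ degree p"
    using poly_growth by blast
  have "rapid (\<lambda>n. a n * poly p (t n))"
    using assms
  proof (rule rapid_le)
    show "cmod (a n * poly p (t n)) \<le> K * tau n ^ degree p * cmod (a n)" for n
      using mult_left_mono[OF K(2)[of "t n"], of "cmod (a n)"] by (simp add: norm_mult tau_def mult_ac)
  qed
  then have "summable (\<lambda>n. cmod (a n * poly p (t n)) * tau n ^ 0)"
    unfolding rapid_def by blast
  then show ?thesis by simp
qed

lemma rapid_summable_poly: "rapid a \<Longrightarrow> summable (\<lambda>n. a n * poly p (t n))"
  by (rule summable_norm_cancel[OF rapid_summable_poly_norm])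

lemma rapid_summable_mom: "rapid a \<Longrightarrow> summable (\<lambda>n. a n * t n ^ j)"
  using rapid_summable_poly[of a "monom 1 j"] by (simp add: poly_monom)

lemma mom_poly:
  assumes "rapid a"
  shows "(\<Sum>n. a n * poly p (t n)) = (\<Sum>j\<le>degree p. coeff p j * mom j a)"
proof -
  have "(\<lambda>n. \<Sum>j\<le>degree p. coeff p j * (a n * t n ^ j)) sums (\<Sum>j\<le>degree p. coeff p j * mom j a)"
    unfolding mom_def by (intro sums_sum sums_mult summable_sums rapid_summable_mom assms)
  moreover have "(\<Sum>j\<le>degree p. coeff p j * (a n * t n ^ j)) = a n * poly p (t n)" for n
    by (simp add: poly_altdef sum_distrib_left mult_ac)
  ultimately show ?thesis
    by (simp add: sums_iff)
qed

lemma rapid_divc: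
  assumes "rapid a"
  shows "rapid (divc a w)"
  unfolding rapid_def
proof
  fix k
  obtain K where K: "\<And>n. t n \<noteq> w \<Longrightarrow> cmod (divc a w n) \<le> K * cmod (a n)"
    using norm_divc_le by blast
  show "summable (\<lambda>n. cmod (divc a w n) * tau n ^ k)"
  proof (rule summable_comparison_cofinite[OF _ finite_t_eq])
    show "summable (\<lambda>n. K * (cmod (a n) * tau n ^ k))"
      using assms unfolding rapid_def by (intro summable_mult) blast
    show "norm (cmod (divc a w n) * tau n ^ k) \<le> K * (cmod (a n) * tau n ^ k)" if "n \<notin> {n. t n = w}" for n
      using mult_right_mono[OF K, of n "tau n ^ k"] that tau_pos[of n] by (simp add: mult.assoc)
  qed
qed

text \<open>The entries - a n / (w - t n) sum to - \<open>cauchy a w\<close>, and the exceptional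
  entry \<open>cauchy a w\<close> cancels this. If w is not in T, both are 0 because F(w) =
  0.\<close>

lemma mom_divc_0:
  assumes "adm a" "ent a w = 0"
  shows "mom 0 (divc a w) = 0"
proof -
  have "divc a w n = - (a n / (w - t n)) + (if t n = w then cauchy a w else 0)" for n
    using ent_zero_t[OF assms(2), of n] by (auto simp: divc_def minus_divide_right)
  moreover have "(\<lambda>n. - (a n / (w - t n)) + (if t n = w then cauchy a w else 0)) sums
      (- cauchy a w + cauchy a w)"
    by (intro sums_add sums_minus sums_single_t assms)
      (auto simp: cauchy_def intro!: summable_sums summable_cauchy assms)
  ultimately have "divc a w sums 0"
    by (simp add: sums_def)
  then show ?thesis
    by (simp add: mom_def sums_iff)
qed

text \<open>From t n / (t n - w) = 1 + w / (t n - w); at an index with t n = w the residue a n is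
  zero.\<close>

lemma mom_divc_Suc:
  assumes "rapid a" "ent a w = 0"
  shows "mom (Suc j) (divc a w) = mom j a + w * mom j (divc a w)"
proof -
  have "divc a w n * t n ^ Suc j = a n * t n ^ j + w * (divc a w n * t n ^ j)" for n
    using ent_zero_t[OF assms(2), of n] by (auto simp: divc_def field_simps)
  then have "mom (Suc j) (divc a w) = (\<Sum>n. a n * t n ^ j + w * (divc a w n * t n ^ j))"
    by (simp only: mom_def)
  also have "\<dots> = mom j a + w * mom j (divc a w)"
    unfolding mom_def using assms(1)
    by (subst suminf_add[symmetric])
      (auto intro!: summable_mult rapid_summable_mom rapid_divc simp: suminf_mult rapid_summable_mom rapid_divc)
  finally show ?thesis .
qed

text \<open>Division raises the order of vanishing by one: if the moments of a below j vanish, so do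
  those of the quotient up to j. This makes conditions on initial moments nearly invariant.\<close>

lemma mom_divc:
  assumes "rapid a" "ent a w = 0" "\<And>i. i < j \<Longrightarrow> mom i a = 0"
  shows "mom j (divc a w) = 0"
  using assms(3)
proof (induction j)
  case 0
  show ?case
    by (intro mom_divc_0 rapid_imp_adm assms)
next
  case (Suc j)
  then show ?case
    by (simp add: mom_divc_Suc assms)
qed

lemma mom_quot:
  assumes "rapid (res x)" "Phi x w = 0" "\<And>i. i < j \<Longrightarrow> mom i (res x) = 0"
  shows "mom j (res (quot x w)) = 0"
  using mom_divc[OF assms(1) _ assms(3)] assms(2) by (simp add: res_quot Phi_def)

lemma mom_add: "rapid a \<Longrightarrow> rapid b \<Longrightarrow> mom j (\<lambda>n. a n + b n) = mom j a + mom j b"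
  by (simp add: mom_def distrib_right suminf_add rapid_summable_mom)

lemma mom_cmult: "rapid a \<Longrightarrow> mom j (\<lambda>n. c * a n) = c * mom j a"
  by (simp add: mom_def mult.assoc suminf_mult rapid_summable_mom)

lemma mom_finite: "finite F \<Longrightarrow> (\<And>n. n \<notin> F \<Longrightarrow> a n = 0) \<Longrightarrow> mom j a = (\<Sum>n\<in>F. a n * t n ^ j)"
  unfolding mom_def by (rule suminf_finite) auto

lemma rapid_quot: "rapid (res x) \<Longrightarrow> rapid (res (quot x w))"
  by (simp add: res_quot rapid_divc)

lemma rapid_cmult: "rapid a \<Longrightarrow> rapid (\<lambda>n. c * a n)"
  by (erule rapid_le[where K = "cmod c" and k = 0]) (simp add: norm_mult)

lemma rapid_move: "rapid (res x) \<Longrightarrow> rapid (res (move x s w))"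
  by (simp add: move_def res_add res_cscale rapid_add rapid_cmult rapid_quot)

lemma mom_move:
  assumes "rapid (res x)" "Phi x s = 0" "\<And>i. i \<le> j \<Longrightarrow> mom i (res x) = 0"
  shows "mom j (res (move x s w)) = 0"
  using assms mom_quot[OF assms(1,2), of j]
  by (simp add: move_def res_add res_cscale mom_add mom_cmult rapid_cmult rapid_quot)

text \<open>The unnormalized Lagrange polynomial of the node t i among t 0, ..., t (m - 1).\<close>

definition nodal :: "nat \<Rightarrow> nat \<Rightarrow> complex poly" where
  "nodal m i = (\<Prod>l\<in>{..<m} - {i}. [:- t l, 1:])"

lemma poly_nodal: "poly (nodal m i) z = (\<Prod>l\<in>{..<m} - {i}. z - t l)"
  by (simp add: nodal_def poly_prod)

lemma poly_nodal_other: "j < m \<Longrightarrow> j \<noteq> i \<Longrightarrow> poly (nodal m i) (t j) = 0"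
  by (auto simp: poly_nodal prod_zero_iff)

lemma poly_nodal_self: "poly (nodal m i) (t i) \<noteq> 0"
  by (auto simp: poly_nodal prod_zero_iff)

lemma degree_nodal: "i < m \<Longrightarrow> degree (nodal m i) < m"
  unfolding nodal_def by (rule le_less_trans[OF degree_prod_sum_le]) (auto simp: card_Diff_singleton)

text \<open>The Vandermonde argument in Lagrange form: vanishing moments below m annihilate the
  nodal polynomial, whose sum against a reduces to the single term at i.\<close>

lemma moments_finite_support:
  assumes "\<And>n. n \<ge> m \<Longrightarrow> a n = 0" "\<And>j. j < m \<Longrightarrow> mom j a = 0"
  shows "a i = 0"
proof (cases "i < m")
  case True
  have sub: "{n. a n \<noteq> 0} \<subseteq> {..<m}"
    using assms(1) by (force simp: not_le[symmetric])
  then have "rapid a"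
    by (intro rapid_finite) (rule finite_subset, auto)
  have "(\<Sum>n. a n * poly (nodal m i) (t n)) = a i * poly (nodal m i) (t i)"
  proof (subst suminf_finite[of "{i}"])
    fix n assume "n \<notin> {i}"
    then show "a n * poly (nodal m i) (t n) = 0"
      using assms(1)[of n] poly_nodal_other[of n m i] by (cases "n < m") auto
  qed auto
  moreover have "(\<Sum>n. a n * poly (nodal m i) (t n)) = 0"
    unfolding mom_poly[OF \<open>rapid a\<close>]
    using assms(2) degree_nodal[OF True] by (intro sum.neutral) auto
  ultimately show ?thesis
    using poly_nodal_self by simp
qed (use assms in auto)

end

lemma csub_closure:
  assumes "0 \<in> S" "\<And>x y. x \<in> S \<Longrightarrow> y \<in> S \<Longrightarrow> x + y \<in> S" "\<And>a x. x \<in> S \<Longrightarrow> cscale a x \<in> S"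
  shows "csub (closure S)"
  unfolding csub_def
proof (intro conjI ballI allI)
  show "0 \<in> closure S"
    using assms(1) closure_subset by blast
  show "x + y \<in> closure S" if xy: "x \<in> closure S" "y \<in> closure S" for x y
  proof -
    obtain X Y where "\<And>n. X n \<in> S" "X \<longlonglongrightarrow> x" "\<And>n. Y n \<in> S" "Y \<longlonglongrightarrow> y"
      using xy unfolding closure_sequential by blast
    then show ?thesis
      unfolding closure_sequential using assms(2) by (intro exI[of _ "\<lambda>n. X n + Y n"]) (auto intro: tendsto_add)
  qed
  show "cscale a x \<in> closure S" if x: "x \<in> closure S" for a x
  proof -
    obtain X where X: "\<And>n. X n \<in> S" "X \<longlonglongrightarrow> x"
      using x unfolding closure_sequential by blast
    have nsc: "norm (cscale a y) = cmod a * norm y" for y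
    proof (rule power2_eq_imp_eq)
      have "(norm (cscale a y))\<^sup>2 = (\<Sum>n. (cmod a)\<^sup>2 * (cmod (coord y n))\<^sup>2)"
        by (simp only: norm_ell2_sq coord_cscale norm_mult power_mult_distrib)
      also have "\<dots> = (cmod a * norm y)\<^sup>2"
        by (simp only: suminf_mult[OF coord_summable] norm_ell2_sq power_mult_distrib)
      finally show "(norm (cscale a y))\<^sup>2 = (cmod a * norm y)\<^sup>2" .
    qed auto
    have "cscale a (X n) - cscale a x = cscale a (X n - x)" for n
      by (rule ell2_eqI) (simp add: right_diff_distrib)
    then have "norm (cscale a (X n) - cscale a x) = cmod a * norm (X n - x)" for n
      by (simp only: nsc)
    moreover have "(\<lambda>n. cmod a * norm (X n - x)) \<longlonglongrightarrow> 0"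
      using X(2) by (intro tendsto_mult_right_zero tendsto_norm_zero LIM_zero)
    ultimately have "(\<lambda>n. cscale a (X n)) \<longlonglongrightarrow> cscale a x"
      by (subst LIM_zero_iff[symmetric], subst tendsto_norm_zero_iff[symmetric]) simp
    then show ?thesis
      unfolding closure_sequential using X(1) assms(3)
      by (intro exI[of _ "\<lambda>n. cscale a (X n)"]) auto
  qed
qed simp

lemma pairing_unit_seq [simp]: "pairing (unit_seq n) u = coord u n"
proof -
  have "pairing (unit_seq n) u = (\<Sum>i\<in>{n}. coord (unit_seq n) i * coord u i)"
    unfolding pairing_def by (rule suminf_finite) auto
  then show ?thesis by simp
qed

section \<open>Lower bounds for polynomials, and entire functions of polynomial growth\<close>

lemma poly_lower:
  fixes q :: "complex poly"
  assumes "q \<noteq> 0"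
  obtains c R where "c > 0" "\<And>z. cmod z \<ge> R \<Longrightarrow> cmod (poly q z) \<ge> c * (1 + cmod z) ^ degree q"
proof -
  have "\<exists>c>0. \<exists>R. \<forall>z. cmod z \<ge> R \<longrightarrow> cmod (poly q z) \<ge> c * (1 + cmod z) ^ degree q"
    using assms
  proof (induction q)
    case (pCons a q)
    show ?case
    proof (cases "q = 0")
      case True
      with pCons show ?thesis
        by (intro exI[of _ "cmod a"]) auto
    next
      case False
      obtain c R where cR: "c > 0" "\<And>z. cmod z \<ge> R \<Longrightarrow> cmod (poly q z) \<ge> c * (1 + cmod z) ^ degree q"
        using pCons.IH[OF False] by blast
      \<comment> \<open>For |z| >= 1 the bound |z| >= (1 + |z|) / 2 leaves c / 2; half of this
        absorbs the constant term a once |z| >= 4 |a| / c.\<close>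
      have "(c / 4) * (1 + cmod z) ^ degree (pCons a q) \<le> cmod (poly (pCons a q) z)"
        if z: "cmod z \<ge> max R (max 1 (4 * cmod a / c))" for z
      proof -
        let ?d = "(1 + cmod z) ^ degree q"
        have "1 \<le> ?d" by (intro one_le_power) auto
        have "(1 + cmod z) / 2 * (c * ?d) \<le> cmod z * cmod (poly q z)"
          using z cR by (intro mult_mono) auto
        moreover have "cmod a \<le> c / 4 * ((1 + cmod z) * ?d)"
        proof -
          have "4 * cmod a \<le> c * cmod z"
            using z \<open>c > 0\<close> by (simp add: field_simps)
          also have "\<dots> \<le> c * ((1 + cmod z) * 1)"
            using \<open>c > 0\<close> by (intro mult_left_mono) auto
          also have "\<dots> \<le> c * ((1 + cmod z) * ?d)"
            using \<open>c > 0\<close> \<open>1 \<le> ?d\<close> by (intro mult_left_mono) auto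
          finally show ?thesis by simp
        qed
        moreover have "cmod (z * poly q z) - cmod a \<le> cmod (a + z * poly q z)"
          using norm_diff_ineq[of "z * poly q z" a] by (simp add: add.commute)
        ultimately have "c / 4 * ((1 + cmod z) * ?d) \<le> cmod (a + z * poly q z)"
          unfolding norm_mult by argo
        then show ?thesis
          using False by simp
      qed
      with \<open>c > 0\<close> show ?thesis
        by (metis divide_pos_pos zero_less_numeral)
    qed
  qed simp
  then show ?thesis using that by blast
qed

lemma entire_poly_growth:
  assumes "U holomorphic_on UNIV" "\<And>z. cmod z \<ge> R \<Longrightarrow> cmod (U z) \<le> K * (1 + cmod z) ^ D"
  obtains q where "degree q \<le> D" "\<And>z. U z = poly q z"
proof -
  define q where "q = (\<Sum>k\<le>D. monom ((deriv ^^ k) U 0 / fact k) k)"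
  have "U z = poly q z" for z
  proof -
    have "U z = (\<Sum>k\<le>D. (deriv ^^ k) U 0 / fact k * z ^ k)"
    proof (rule Liouville_polynomial[OF assms(1), where A = "max R 1" and B = "\<bar>K\<bar> * 2 ^ D"])
      fix z :: complex assume z: "max R 1 \<le> cmod z"
      have "cmod (U z) \<le> \<bar>K\<bar> * (1 + cmod z) ^ D"
        using assms(2)[of z] z by (intro order_trans[OF assms(2)] mult_right_mono) auto
      also have "\<dots> \<le> \<bar>K\<bar> * (2 * cmod z) ^ D"
        using z by (intro mult_left_mono power_mono) auto
      finally show "cmod (U z) \<le> \<bar>K\<bar> * 2 ^ D * cmod z ^ D"
        by (simp add: power_mult_distrib mult.assoc)
    qed
    then show ?thesis
      by (simp add: q_def poly_sum poly_monom)
  qed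
  moreover have "degree q \<le> D"
    unfolding q_def by (intro degree_sum_le) (auto intro: order_trans[OF degree_monom_le])
  ultimately show ?thesis
    using that by blast
qed

context cdb
begin

section \<open>Density of polynomials and vanishing moments\<close>

text \<open>That all polynomials lie in L2(mu), expressed by powers of \<open>tau n\<close> to avoid
  quantifying over polynomials; \<open>poly_growth\<close> and \<open>poly_lower\<close> translate
  between the two forms.\<close>

definition polyL2 :: bool where
  "polyL2 \<longleftrightarrow> (\<forall>k. summable (\<lambda>n. tau n ^ (2 * k) * mu n))"

text \<open>The image of q under the isometry of L2(mu) onto \<open>ell2\<close> that multiplies by
  sqrt mu; meaningful only if q lies in L2(mu). Pairing with it sums residues against q, so
  \<open>pvec (monom 1 j)\<close> represents the j-th moment.\<close>

definition pvec :: "complex poly \<Rightarrow> ell2" where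
  "pvec q = Ell2 (\<lambda>n. of_real (sqrt (mu n)) * poly q (t n))"

lemma cmod_sqrt_mu_sq: "(cmod (of_real (sqrt (mu n)) * z))\<^sup>2 = (cmod z)\<^sup>2 * mu n"
  by (simp add: norm_mult power_mult_distrib)

lemma summable_poly_mu:
  assumes "summable (\<lambda>n. tau n ^ (2 * k) * mu n)" "degree q \<le> k"
  shows "summable (\<lambda>n. (cmod (poly q (t n)))\<^sup>2 * mu n)"
proof -
  obtain K where K: "K > 0" "\<And>z. cmod (poly q z) \<le> K * (1 + cmod z) ^ degree q"
    using poly_growth by blast
  show ?thesis
  proof (rule summable_comparison_test'[where N = 0])
    show "summable (\<lambda>n. K\<^sup>2 * (tau n ^ (2 * k) * mu n))"
      by (intro summable_mult assms)
    fix n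
    have "cmod (poly q (t n)) \<le> K * tau n ^ degree q"
      using K(2)[of "t n"] by (simp add: tau_def)
    also have "\<dots> \<le> K * tau n ^ k"
      using \<open>K > 0\<close> tau_ge_1[of n] assms(2) by (intro mult_left_mono power_increasing) auto
    finally have "(cmod (poly q (t n)))\<^sup>2 \<le> (K * tau n ^ k)\<^sup>2"
      by (intro power_mono) auto
    then have "(cmod (poly q (t n)))\<^sup>2 * mu n \<le> (K * tau n ^ k)\<^sup>2 * mu n"
      by (intro mult_right_mono) auto
    then show "norm ((cmod (poly q (t n)))\<^sup>2 * mu n) \<le> K\<^sup>2 * (tau n ^ (2 * k) * mu n)"
      by (simp add: power_mult_distrib power_mult mult.assoc mult.commute[of 2])
  qed
qed

lemma coord_pvec:
  assumes "summable (\<lambda>n. (cmod (poly q (t n)))\<^sup>2 * mu n)"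
  shows "coord (pvec q) n = of_real (sqrt (mu n)) * poly q (t n)"
  unfolding pvec_def by (subst coord_Ell2) (simp_all add: cmod_sqrt_mu_sq assms del: norm_mult)

lemma pairing_pvec:
  assumes "summable (\<lambda>n. (cmod (poly q (t n)))\<^sup>2 * mu n)"
  shows "pairing x (pvec q) = (\<Sum>n. res x n * poly q (t n))"
  by (simp add: pairing_def coord_pvec[OF assms] res_def mult.assoc)

lemma polyL2_poly: "polyL2 \<Longrightarrow> summable (\<lambda>n. (cmod (poly q (t n)))\<^sup>2 * mu n)"
  unfolding polyL2_def by (rule summable_poly_mu) auto

lemma polyL2_rapid:
  assumes polyL2
  shows "rapid (res x)"
  unfolding rapid_def
proof
  fix k
  have eq: "(cmod (of_real (sqrt (mu n) * tau n ^ k) :: complex))\<^sup>2 = tau n ^ (2 * k) * mu n" for n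
    using mu_pos[of n] by (simp only: norm_of_real power2_abs)
      (simp add: power_mult_distrib power_mult mult.commute[of 2] mult.commute[of "mu n"])
  have "summable (\<lambda>n. (cmod (of_real (sqrt (mu n) * tau n ^ k) :: complex))\<^sup>2)"
    unfolding eq using assms unfolding polyL2_def by blast
  from summable_mult_of_sq[OF coord_summable[of x] this]
  show "summable (\<lambda>n. cmod (res x n) * tau n ^ k)"
    using tau_pos by (simp add: res_def norm_mult norm_power less_imp_le mult.assoc)
qed

lemma mom_eq_pairing: "polyL2 \<Longrightarrow> mom j (res x) = pairing x (pvec (monom 1 j))"
  using pairing_pvec[OF polyL2_poly, of x "monom 1 j"] by (simp add: mom_def poly_monom)

lemma mom_lincomb:
  "polyL2 \<Longrightarrow> mom j (res (\<Sum>i\<in>I. cscale (a i) (f i))) = (\<Sum>i\<in>I. a i * mom j (res (f i)))"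
  by (simp add: mom_eq_pairing pairing_sum pairing_cscale)

text \<open>At infinity |q| is bounded below by a multiple of its leading power, so a polynomial in
  L2(mu) puts the power of its degree there.\<close>

lemma in_L2mu_poly_growth:
  assumes "summable (\<lambda>n. (cmod (poly q (t n)))\<^sup>2 * mu n)" "q \<noteq> 0"
  shows "summable (\<lambda>n. tau n ^ (2 * degree q) * mu n)"
proof -
  obtain c R where c: "c > 0" "\<And>z. cmod z \<ge> R \<Longrightarrow> cmod (poly q z) \<ge> c * (1 + cmod z) ^ degree q"
    using poly_lower[OF assms(2)] by blast
  show ?thesis
  proof (rule summable_comparison_test_ev)
    show "summable (\<lambda>n. (1 / c)\<^sup>2 * ((cmod (poly q (t n)))\<^sup>2 * mu n))"
      by (intro summable_mult assms)
    have "norm (tau n ^ (2 * degree q) * mu n) \<le> (1 / c)\<^sup>2 * ((cmod (poly q (t n)))\<^sup>2 * mu n)"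
      if "R \<le> cmod (t n)" for n
    proof -
      have "c * tau n ^ degree q \<le> cmod (poly q (t n))"
        using c(2)[OF that] by (simp add: tau_def)
      then have "tau n ^ degree q \<le> (1 / c) * cmod (poly q (t n))"
        using \<open>c > 0\<close> by (simp add: field_simps)
      then have "(tau n ^ degree q)\<^sup>2 \<le> ((1 / c) * cmod (poly q (t n)))\<^sup>2"
        using tau_pos[of n] by (intro power_mono) auto
      then have "(tau n ^ degree q)\<^sup>2 * mu n \<le> ((1 / c) * cmod (poly q (t n)))\<^sup>2 * mu n"
        by (intro mult_right_mono) auto
      moreover have "0 \<le> tau n ^ (2 * degree q) * mu n"
        using tau_pos[of n] by simp
      ultimately show ?thesis
        by (simp add: power_mult_distrib power_mult mult.assoc mult.commute[of 2] power_divide)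
    qed
    moreover have "\<forall>\<^sub>F n in sequentially. R \<le> cmod (t n)"
      using t_lim by (simp add: filterlim_at_top)
    ultimately show "\<forall>\<^sub>F n in sequentially. norm (tau n ^ (2 * degree q) * mu n)
        \<le> (1 / c)\<^sup>2 * ((cmod (poly q (t n)))\<^sup>2 * mu n)"
      by (auto elim: eventually_mono)
  qed
qed

text \<open>Duality: under the isometry, density means that no nonzero vector annihilates all
  \<open>pvec q\<close>, and annihilating them is the vanishing of all moments.\<close>

lemma polys_dense_iff:
  "polys_dense_L2 t mu \<longleftrightarrow> polyL2 \<and> (\<forall>x. (\<forall>j. mom j (res x) = 0) \<longrightarrow> x = 0)"
proof
  assume D: "polys_dense_L2 t mu"
  then have L2: "summable (\<lambda>n. (cmod (poly q (t n)))\<^sup>2 * mu n)" for q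
    by (simp add: polys_dense_L2_def in_L2mu_def)
  have P: polyL2
    unfolding polyL2_def
  proof
    fix k
    show "summable (\<lambda>n. tau n ^ (2 * k) * mu n)"
      using in_L2mu_poly_growth[OF L2, of "monom 1 k"] by (simp add: degree_monom_eq)
  qed
  have "x = 0" if x: "\<forall>j. mom j (res x) = 0" for x
  proof (rule ccontr)
    assume "x \<noteq> 0"
    \<comment> \<open>d corresponds to the conjugate of x, whose pairing with x is the squared norm;
      as all polynomials pair to 0 with x, none comes closer to it than norm x.\<close>
    define d where "d n = cnj (coord x n) / of_real (sqrt (mu n))" for n
    have "(cmod (d n))\<^sup>2 * mu n = (cmod (coord x n))\<^sup>2" for n
      by (simp add: d_def norm_divide power_divide)
    then have "in_L2mu t mu d"
      by (simp add: in_L2mu_def coord_summable)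
    then obtain p where p: "(\<Sum>n. (cmod (d n - poly p (t n)))\<^sup>2 * mu n) < (norm x)\<^sup>2"
      using D \<open>x \<noteq> 0\<close> unfolding polys_dense_L2_def by (meson zero_less_norm_iff zero_less_power)
    have "(cmod (coord (cnj_ell2 x - pvec p) n))\<^sup>2 = (cmod (d n - poly p (t n)))\<^sup>2 * mu n" for n
    proof -
      have "coord (cnj_ell2 x - pvec p) n = of_real (sqrt (mu n)) * (d n - poly p (t n))"
        by (simp add: coord_pvec[OF L2] d_def right_diff_distrib)
      then show ?thesis
        by (simp only: cmod_sqrt_mu_sq)
    qed
    then have "(norm (cnj_ell2 x - pvec p))\<^sup>2 < (norm x)\<^sup>2"
      using p by (simp only: norm_ell2_sq[of "cnj_ell2 x - pvec p"])
    then have less: "norm (cnj_ell2 x - pvec p) < norm x"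
      by (simp add: power2_less_imp_less)
    have "pairing x (pvec p) = 0"
      using x by (simp add: pairing_pvec[OF L2] mom_poly polyL2_rapid[OF P])
    moreover have "pairing x (cnj_ell2 x) = pairing x (cnj_ell2 x - pvec p) + pairing x (pvec p)"
      by (simp add: pairing_commute[of x] flip: pairing_add)
    ultimately have "cmod (pairing x (cnj_ell2 x)) \<le> norm x * norm (cnj_ell2 x - pvec p)"
      using norm_pairing_le[of x "cnj_ell2 x - pvec p"] by simp
    moreover have "cmod (pairing x (cnj_ell2 x)) = norm x * norm x"
      by (simp add: pairing_cnj_self norm_power power2_eq_square norm_mult)
    ultimately show False
      using less \<open>x \<noteq> 0\<close> by simp
  qed
  with P show "polyL2 \<and> (\<forall>x. (\<forall>j. mom j (res x) = 0) \<longrightarrow> x = 0)" by blast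
next
  assume "polyL2 \<and> (\<forall>x. (\<forall>j. mom j (res x) = 0) \<longrightarrow> x = 0)"
  then have P: polyL2 and det: "\<And>x. (\<And>j. mom j (res x) = 0) \<Longrightarrow> x = 0" by blast+
  note L2 = polyL2_poly[OF P]
  have add: "pvec p + pvec q = pvec (p + q)" for p q
    by (rule ell2_eqI) (simp add: coord_pvec[OF L2] distrib_left)
  have scale: "cscale a (pvec q) = pvec (smult a q)" for a q
    by (rule ell2_eqI) (simp add: coord_pvec[OF L2])
  have zero: "0 = pvec 0"
    by (rule ell2_eqI) (simp add: coord_pvec[OF L2])
  have cs: "csub (closure (range pvec))"
    by (rule csub_closure) (auto simp: add scale zero)
  have all: "y \<in> closure (range pvec)" for y
  proof (rule csub_bipolar[OF cs])
    fix u assume u: "\<And>v. v \<in> closure (range pvec) \<Longrightarrow> pairing v u = 0"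
    have "mom j (res u) = 0" for j
      unfolding mom_eq_pairing[OF P] using u[of "pvec (monom 1 j)"] closure_subset[of "range pvec"]
      by (auto simp: pairing_commute[of u])
    then have "u = 0" by (rule det)
    then show "pairing y u = 0" by (simp add: pairing_commute[of y])
  qed
  show "polys_dense_L2 t mu"
    unfolding polys_dense_L2_def
  proof (intro conjI allI impI)
    show "in_L2mu t mu (\<lambda>n. poly p (t n))" for p
      by (simp add: in_L2mu_def L2)
    fix d and e :: real
    assume d: "in_L2mu t mu d \<and> e > 0"
    define y where "y = Ell2 (\<lambda>n. of_real (sqrt (mu n)) * d n)"
    have y: "coord y n = of_real (sqrt (mu n)) * d n" for n
      unfolding y_def using d by (subst coord_Ell2) (simp_all add: cmod_sqrt_mu_sq in_L2mu_def del: norm_mult)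
    have "\<forall>\<epsilon>>0. \<exists>v\<in>range pvec. dist v y < \<epsilon>"
      using all[of y] unfolding closure_approachable .
    then have "\<exists>v\<in>range pvec. dist v y < sqrt e"
      using d by simp
    then obtain p where p: "dist (pvec p) y < sqrt e"
      by blast
    have "(cmod (coord (y - pvec p) n))\<^sup>2 = (cmod (d n - poly p (t n)))\<^sup>2 * mu n" for n
    proof -
      have "coord (y - pvec p) n = of_real (sqrt (mu n)) * (d n - poly p (t n))"
        by (simp add: coord_pvec[OF L2] y right_diff_distrib)
      then show ?thesis
        by (simp only: cmod_sqrt_mu_sq)
    qed
    then have "(\<Sum>n. (cmod (d n - poly p (t n)))\<^sup>2 * mu n) = (norm (y - pvec p))\<^sup>2"
      by (simp only: norm_ell2_sq)
    also have "\<dots> < (sqrt e)\<^sup>2"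
      using p by (intro power_strict_mono) (auto simp: dist_norm norm_minus_commute)
    finally show "\<exists>p. (\<Sum>n. (cmod (d n - poly p (t n)))\<^sup>2 * mu n) < e"
      using d by auto
  qed
qed

section \<open>The subspaces of functions with vanishing moments\<close>

definition Wsub :: "nat set \<Rightarrow> ell2 set" where
  "Wsub J = {x. \<forall>j\<in>J. mom j (res x) = 0}"

lemma csub_Wsub: "polyL2 \<Longrightarrow> csub (Wsub J)"
  using csub_annihilator[of "(\<lambda>j. pvec (monom 1 j)) ` J"] by (simp add: Wsub_def mom_eq_pairing)

text \<open>J is downward closed because the j-th moment of a quotient involves the moments of x
  below j. The cases used are \<open>{..<m}\<close> and \<open>UNIV\<close>.\<close>

lemma ninv_Wsub:
  assumes polyL2 "\<And>i j. j \<in> J \<Longrightarrow> i < j \<Longrightarrow> i \<in> J"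
  shows "ninv (Wsub J)"
  unfolding ninv_def
  using assms csub_Wsub by (auto simp: Wsub_def intro!: mom_quot polyL2_rapid)

lemma inj_unit_seq: "inj unit_seq"
  by (rule injI) (metis coord_unit_seq zero_neq_one)

lemma unit_seq_independent:
  assumes polyL2 "{..<m} \<subseteq> J" "(\<Sum>i<m. cscale (a i) (unit_seq i)) \<in> Wsub J" "i < m"
  shows "a i = 0"
proof -
  define x where "x = (\<Sum>i<m. cscale (a i) (unit_seq i))"
  have cx: "coord x n = (if n < m then a n else 0)" for n
    by (simp add: x_def if_distrib[of "\<lambda>c. a _ * c"] cong: if_cong)
  have "res x i = 0"
  proof (rule moments_finite_support[where m = m])
    show "res x n = 0" if "n \<ge> m" for n
      using that by (simp add: res_def cx)
    show "mom j (res x) = 0" if "j < m" for j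
      using assms(2,3) that by (auto simp: Wsub_def x_def)
  qed
  then show ?thesis
    using assms(4) by (simp add: res_def cx)
qed

text \<open>The first m unit vectors form a complement: they are independent by the Vandermonde
  argument, and for any x the m moment equations in m + 1 unknowns give a combination of x and the
  unit vectors in the subspace, in which x must occur.\<close>

lemma codim_Wsub:
  assumes polyL2
  shows "codim (Wsub {..<m}) m"
  unfolding codim_def
proof (intro exI[of _ "unit_seq ` {..<m}"] conjI allI impI)
  have inj: "inj_on unit_seq I" for I
    using inj_unit_seq by (rule inj_on_subset) simp
  show "card (unit_seq ` {..<m}) = m"
    by (simp add: card_image inj)
  have sum_eq: "(\<Sum>b\<in>unit_seq ` {..<m}. cscale (a b) b) = (\<Sum>i<m. cscale (a (unit_seq i)) (unit_seq i))" for a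
    by (simp add: sum.reindex inj)
  show "\<forall>b\<in>unit_seq ` {..<m}. a b = 0"
    if a: "(\<Sum>b\<in>unit_seq ` {..<m}. cscale (a b) b) \<in> Wsub {..<m}" for a
    using unit_seq_independent[OF assms order_refl, where m = m and a = "\<lambda>i. a (unit_seq i)"] a by (auto simp: sum_eq)
  fix x
  define f where "f i = (if i < m then unit_seq i else x)" for i
  obtain \<alpha> where \<alpha>: "\<exists>i\<in>{..m}. \<alpha> i \<noteq> 0" "\<forall>j<m. (\<Sum>i\<in>{..m}. \<alpha> i * mom j (res (f i))) = 0"
    using homogeneous_nontrivial[of "{..m}" m "\<lambda>i j. mom j (res (f i))"] by auto
  define y where "y = (\<Sum>i\<le>m. cscale (\<alpha> i) (f i))"
  have yW: "y \<in> Wsub {..<m}"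
    using \<alpha>(2) by (simp add: y_def Wsub_def mom_lincomb[OF assms])
  have y: "y = (\<Sum>i<m. cscale (\<alpha> i) (unit_seq i)) + cscale (\<alpha> m) x"
    by (simp add: y_def f_def lessThan_Suc_atMost[symmetric])
  have "\<alpha> m \<noteq> 0"
  proof
    assume "\<alpha> m = 0"
    then have "y = (\<Sum>i<m. cscale (\<alpha> i) (unit_seq i))"
      unfolding y by (intro ell2_eqI) simp
    then have "\<alpha> i = 0" if "i < m" for i
      using unit_seq_independent[OF assms order_refl] yW that by metis
    then show False
      using \<alpha>(1) \<open>\<alpha> m = 0\<close> by (auto simp: le_less)
  qed
  have "x = cscale (1 / \<alpha> m) y + (\<Sum>b\<in>unit_seq ` {..<m}. cscale (- \<alpha> (inv unit_seq b) / \<alpha> m) b)"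
  proof (rule ell2_eqI)
    fix n
    have "coord y n = (\<Sum>i<m. \<alpha> i * coord (unit_seq i) n) + \<alpha> m * coord x n"
      by (simp add: y)
    then show "coord x n = coord (cscale (1 / \<alpha> m) y
        + (\<Sum>b\<in>unit_seq ` {..<m}. cscale (- \<alpha> (inv unit_seq b) / \<alpha> m) b)) n"
      using \<open>\<alpha> m \<noteq> 0\<close>
      by (simp add: sum_eq inv_f_f[OF inj_unit_seq] add_divide_distrib sum_divide_distrib sum_negf
          del: coord_unit_seq)
  qed
  moreover have "cscale (1 / \<alpha> m) y \<in> Wsub {..<m}"
    using csub_Wsub[OF assms] yW by (simp add: csub_def)
  ultimately show "\<exists>a. \<exists>y\<in>Wsub {..<m}. x = y + (\<Sum>b\<in>unit_seq ` {..<m}. cscale (a b) b)"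
    by (intro exI[of _ "\<lambda>b. - \<alpha> (inv unit_seq b) / \<alpha> m"] bexI)
qed simp

lemma codim_of_supset_Wsub:
  assumes polyL2 "csub V" "Wsub {..<m} \<subseteq> V"
  shows "\<exists>m. codim V m"
proof -
  obtain B where "finite B" "\<And>x. \<exists>a. \<exists>y\<in>Wsub {..<m}. x = y + (\<Sum>b\<in>B. cscale (a b) b)"
    using codim_Wsub[OF assms(1), of m] unfolding codim_def by blast
  with assms(2,3) show ?thesis
    by (intro codim_if_spanning[of V B]) blast+
qed

section \<open>Annihilators of nearly invariant subspaces\<close>

lemma Phi_funpow_quot:
  assumes "\<And>k. Phi (((\<lambda>y. quot y w) ^^ k) x) w = 0" "z \<noteq> w"
  shows "Phi x z = (z - w) ^ k * Phi (((\<lambda>y. quot y w) ^^ k) x) z"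
proof (induction k)
  case (Suc k)
  then show ?case
    using Phi_quot_at[OF assms(1) assms(2), of k] assms(2) by simp
qed simp

text \<open>If all members vanished at w, near invariance would allow division by z - w without end,
  and x would have a zero of infinite order.\<close>

lemma ninv_no_common_zero:
  assumes V: "ninv V" and "x \<in> V" "x \<noteq> 0"
  obtains y where "y \<in> V" "Phi y w \<noteq> 0"
proof -
  have "\<exists>y\<in>V. Phi y w \<noteq> 0"
  proof (rule ccontr)
    assume "\<not> ?thesis"
    then have zero: "Phi y w = 0" if "y \<in> V" for y
      using that by blast
    define y where "y k = ((\<lambda>y. quot y w) ^^ k) x" for k
    have yV: "y k \<in> V" for k
      by (induction k) (use V \<open>x \<in> V\<close> zero in \<open>auto simp: y_def ninv_def\<close>)
    have fac: "Phi x z = (z - w) ^ k * Phi (y k) z" if "z \<noteq> w" for z k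
      using Phi_funpow_quot[of w x z k] zero[OF yV] that by (simp add: y_def)
    obtain z1 where z1: "Phi x z1 \<noteq> 0"
      using \<open>x \<noteq> 0\<close> Phi_eq_0_iff[of x] by auto
    then have "z1 \<noteq> w" using zero[OF \<open>x \<in> V\<close>] by auto
    have "\<not> Phi x constant_on UNIV"
      using z1 zero[OF \<open>x \<in> V\<close>] unfolding constant_on_def by (metis UNIV_I)
    then obtain g r n where g: "r > 0" "g holomorphic_on ball w r"
      "\<And>z. z \<in> ball w r \<Longrightarrow> Phi x z = (z - w) ^ n * g z" "\<And>z. z \<in> ball w r \<Longrightarrow> g z \<noteq> 0"
      using holomorphic_factor_zero_nonconstant[OF Phi_holomorphic open_UNIV connected_UNIV, of w x]
        zero[OF \<open>x \<in> V\<close>] by (metis UNIV_I)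
    \<comment> \<open>n is the order of the zero at w, so dividing n + 1 times contradicts g w
      \<noteq> 0.\<close>
    have "g z = (z - w) * Phi (y (Suc n)) z" if "z \<in> ball w r" "z \<noteq> w" for z
      using g(3)[OF that(1)] fac[OF that(2), of "Suc n"] that(2) by simp
    then have "\<forall>\<^sub>F z in at w. g z = (z - w) * Phi (y (Suc n)) z"
      unfolding eventually_at using \<open>r > 0\<close> by (intro exI[of _ r]) (auto simp: dist_commute)
    moreover have "isCont g w"
      using g(1,2) by (intro continuous_on_interior[of "ball w r"] holomorphic_on_imp_continuous_on) auto
    then have "g \<midarrow>w\<rightarrow> g w"
      by (simp add: isCont_def)
    moreover have "isCont (\<lambda>z. (z - w) * Phi (y (Suc n)) z) w"
      by (intro continuous_on_interior[of UNIV] holomorphic_on_imp_continuous_on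
          holomorphic_intros Phi_holomorphic) auto
    then have "(\<lambda>z. (z - w) * Phi (y (Suc n)) z) \<midarrow>w\<rightarrow> 0"
      by (simp add: isCont_def)
    ultimately have "g \<midarrow>w\<rightarrow> 0"
      by (simp cong: filterlim_cong)
    then have "g w = 0"
      using \<open>g \<midarrow>w\<rightarrow> g w\<close> LIM_unique by blast
    then show False
      using g(4)[of w] \<open>r > 0\<close> by simp
  qed
  then show ?thesis using that by blast
qed

definition annihilates :: "ell2 \<Rightarrow> ell2 set \<Rightarrow> bool" where
  "annihilates u V \<longleftrightarrow> (\<forall>v\<in>V. pairing v u = 0)"

text \<open>The residues c u of the transform in the numerator of the multiplier; absolutely
  summable by Cauchy-Schwarz, with no further decay known.\<close>

definition xu :: "ell2 \<Rightarrow> ell2 \<Rightarrow> nat \<Rightarrow> complex" where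
  "xu x u n = coord x n * coord u n"

lemma adm_xu: "adm (xu x u)"
  unfolding adm_def xu_def
proof (rule summable_comparison_test'[OF summable_coord_mult[of x u], where N = 0])
  show "norm (cmod (coord x n * coord u n) / tau n) \<le> cmod (coord x n * coord u n)" for n
  proof -
    have "cmod (coord x n * coord u n) / tau n \<le> cmod (coord x n * coord u n) / 1"
      using tau_ge_1[of n] by (intro divide_left_mono) auto
    then show ?thesis
      using tau_pos[of n] by (simp add: abs_of_pos)
  qed
qed

text \<open>Stated as a product so that zeros of the individual \<open>Phi x\<close> need no
  exception; using \<open>ent\<close> on the left also covers the points of T.\<close>

definition multiplier :: "ell2 set \<Rightarrow> ell2 \<Rightarrow> (complex \<Rightarrow> complex) \<Rightarrow> bool" where
  "multiplier V u U \<longleftrightarrow> U holomorphic_on UNIV \<and> (\<forall>x\<in>V. \<forall>z. ent (xu x u) z = U z * Phi x z)"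

text \<open>Two members of V can be combined to a member that vanishes at any given point; dividing
  by that zero and pairing with u shows that the quotients defining the multiplier agree.\<close>

lemma ent_xu_cross:
  assumes V: "ninv V" and u: "annihilates u V" and xy: "x \<in> V" "y \<in> V"
  shows "Phi y z * ent (xu x u) z = Phi x z * ent (xu y u) z"
proof -
  have "(\<lambda>z. Phi y z * ent (xu x u) z) = (\<lambda>z. Phi x z * ent (xu y u) z)"
  proof (rule entire_eqI)
    show "(\<lambda>z. Phi y z * ent (xu x u) z) holomorphic_on UNIV"
      "(\<lambda>z. Phi x z * ent (xu y u) z) holomorphic_on UNIV"
      by (intro holomorphic_intros Phi_holomorphic ent_holomorphic adm_xu)+
    fix z assume z: "z \<notin> range t"
    define a where "a = cauchy (res x) z"
    define b where "b = cauchy (res y) z"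
    define v where "v = cscale b x - cscale a y"
    have "v \<in> V"
      unfolding v_def using V xy by (intro csub_diff) (auto simp: ninv_def csub_def)
    moreover have "Phi v z = 0"
    proof -
      have "Phi x z = A z * a" "Phi y z = A z * b"
        by (simp_all add: Phi_def ent_off z a_def b_def)
      then show ?thesis
        by (simp add: v_def Phi_diff Phi_cscale)
    qed
    ultimately have "quot v z \<in> V"
      using V by (simp add: ninv_def)
    then have "pairing (quot v z) u = 0"
      using u by (simp add: annihilates_def)
    moreover have "coord (quot v z) n * coord u n = - (b * (xu x u n / (z - t n)) - a * (xu y u n / (z - t n)))" for n
    proof -
      have "t n - z \<noteq> 0" "z - t n \<noteq> 0" "t n \<noteq> z" using z by auto
      then show ?thesis
        by (simp add: coord_quot v_def xu_def divide_simps) (simp add: algebra_simps)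
    qed
    moreover have "(\<lambda>n. - (b * (xu x u n / (z - t n)) - a * (xu y u n / (z - t n)))) sums
        - (b * cauchy (xu x u) z - a * cauchy (xu y u) z)"
      unfolding cauchy_def[of "xu _ _"]
      by (intro sums_minus sums_diff sums_mult summable_sums summable_cauchy adm_xu)
    ultimately have "b * cauchy (xu x u) z = a * cauchy (xu y u) z"
      by (simp add: pairing_def sums_iff)
    then show "Phi y z * ent (xu x u) z = Phi x z * ent (xu y u) z"
      by (simp add: Phi_def ent_off z a_def b_def)
  qed
  then show ?thesis by (rule fun_cong)
qed

text \<open>Near each point some member of V has no zero, so U is locally a quotient with
  nonvanishing denominator; by \<open>ent_xu_cross\<close> these quotients agree.\<close>

lemma multiplier_exists:
  assumes V: "ninv V" "x0 \<in> V" "x0 \<noteq> 0" and u: "annihilates u V"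
  obtains U where "multiplier V u U"
proof -
  have "\<forall>z. \<exists>y\<in>V. Phi y z \<noteq> 0"
    using ninv_no_common_zero[OF V] by blast
  then obtain g where g: "\<And>z. g z \<in> V" "\<And>z. Phi (g z) z \<noteq> 0"
    by metis
  define U where "U z = ent (xu (g z) u) z / Phi (g z) z" for z
  have U: "ent (xu x u) z = U z * Phi x z" if "x \<in> V" for x z
    using ent_xu_cross[OF V(1) u that g(1), of z z] g(2)[of z] by (simp add: U_def field_simps)
  have "U field_differentiable at z0" for z0
  proof -
    define S where "S = {z. Phi (g z0) z \<noteq> 0}"
    have "open S"
      unfolding S_def by (intro open_Collect_neq holomorphic_on_imp_continuous_on Phi_holomorphic) auto
    have "(\<lambda>z. ent (xu (g z0) u) z / Phi (g z0) z) holomorphic_on S"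
      by (intro holomorphic_intros holomorphic_on_subset[OF ent_holomorphic[OF adm_xu]]
          holomorphic_on_subset[OF Phi_holomorphic]) (auto simp: S_def)
    then have "U holomorphic_on S"
      by (rule holomorphic_transform) (simp add: S_def U[OF g(1)])
    then show ?thesis
      using \<open>open S\<close> g(2)[of z0] by (intro holomorphic_on_imp_differentiable_at) (auto simp: S_def)
  qed
  then have "U holomorphic_on UNIV"
    by (simp add: holomorphic_on_def field_differentiable_at_within)
  then show ?thesis
    using that U unfolding multiplier_def by blast
qed

text \<open>At t k both sides reduce to a single residue, which recovers u from U: seen in L2(mu),
  the annihilator u is the restriction of U to T.\<close>

lemma multiplier_at_t:
  assumes V: "ninv V" "x0 \<in> V" "x0 \<noteq> 0" and U: "multiplier V u U"
  shows "coord u k = of_real (sqrt (mu k)) * U (t k)"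
proof -
  obtain y where y: "y \<in> V" "Phi y (t k) \<noteq> 0"
    using ninv_no_common_zero[OF V] by blast
  have "ent (xu y u) (t k) = U (t k) * Phi y (t k)"
    using U y unfolding multiplier_def by blast
  then show ?thesis
    using y(2) deriv_A[of k] by (simp add: Phi_t xu_def)
qed

lemma multiplier_zero:
  assumes V: "ninv V" "x0 \<in> V" "x0 \<noteq> 0" and U: "multiplier V 0 U"
  shows "U z = 0"
proof -
  obtain y where y: "y \<in> V" "Phi y z \<noteq> 0"
    using ninv_no_common_zero[OF V] by blast
  have "ent (xu y 0) z = U z * Phi y z"
    using U y unfolding multiplier_def by blast
  moreover have "ent (xu y 0) z = 0"
    by (simp add: ent_def xu_def[abs_def] cauchy_def)
  ultimately show ?thesis
    using y(2) by simp
qed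

lemma multiplier_lincomb:
  assumes "\<And>i. i \<in> I \<Longrightarrow> multiplier V (u i) (U i)"
  shows "multiplier V (\<Sum>i\<in>I. cscale (a i) (u i)) (\<lambda>z. \<Sum>i\<in>I. a i * U i z)"
proof -
  have lin: "ent (xu x (\<Sum>i\<in>I. cscale (a i) (u i))) z = (\<Sum>i\<in>I. a i * ent (xu x (u i)) z)" for x z
  proof (induction I rule: infinite_finite_induct)
    case (insert i I)
    have "xu x (cscale (a i) (u i) + v) = (\<lambda>n. a i * xu x (u i) n + xu x v n)" for v
      by (auto simp: xu_def algebra_simps)
    then show ?case
      using insert by (simp add: ent_add ent_cmult adm_cmult adm_xu)
  qed (auto simp: ent_def xu_def[abs_def] cauchy_def)
  show ?thesis
    using assms unfolding multiplier_def
    by (auto simp: lin sum_distrib_right mult.assoc intro!: holomorphic_intros)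
qed

lemma multiplier_off:
  assumes "multiplier V u U" "x \<in> V" "z \<notin> range t"
  shows "cauchy (xu x u) z = U z * cauchy (res x) z"
proof -
  have "ent (xu x u) z = U z * Phi x z"
    using assms(1,2) unfolding multiplier_def by blast
  then have "A z * cauchy (xu x u) z = A z * (U z * cauchy (res x) z)"
    unfolding Phi_def ent_off[OF assms(3)] by (simp only: mult.left_commute)
  then show ?thesis
    using assms(3) by (simp add: A_eq_0_iff)
qed

text \<open>(U - U(w)) / (z - w) is again the multiplier of an annihilator. The point w is taken off
  T so that all divisions by t n - w are legitimate.\<close>

lemma backward_shift:
  assumes V: "ninv V" "x0 \<in> V" "x0 \<noteq> 0" and u: "annihilates u V" "multiplier V u U" and w: "w \<notin> range t"
  obtains u' U' where "annihilates u' V" "multiplier V u' U'" "\<And>z. (z - w) * U' z = U z - U w"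
proof -
  \<comment> \<open>By \<open>multiplier_at_t\<close> these are the values of (U - U(w)) / (z - w)
    on T times sqrt mu. They are square summable since u is and since mu / tau^2 is
    summable.\<close>
  define c where "c n = (coord u n - U w * of_real (sqrt (mu n))) / (t n - w)" for n
  obtain \<kappa> where k: "\<kappa> > 0" "\<And>n. t n \<noteq> w \<Longrightarrow> \<kappa> * tau n \<le> cmod (w - t n)"
    using t_lower by blast
  have ne: "t n - w \<noteq> 0" for n
    using w by auto
  have bound: "cmod (1 / (t n - w)) \<le> (1 / \<kappa>) / tau n" for n
  proof -
    have "\<kappa> * tau n \<le> cmod (t n - w)"
      using k(2)[of n] w by (auto simp: norm_minus_commute)
    then show ?thesis
      using \<open>\<kappa> > 0\<close> tau_pos[of n] ne[of n] by (simp add: norm_divide field_simps)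
  qed
  have "summable (\<lambda>n. (cmod (c n))\<^sup>2)"
  proof (rule summable_comparison_test'[where N = 0])
    show "summable (\<lambda>n. 2 * ((1 / \<kappa>)\<^sup>2 * (cmod (coord u n))\<^sup>2)
        + 2 * ((cmod (U w))\<^sup>2 * (1 / \<kappa>)\<^sup>2 * (mu n / (tau n)\<^sup>2)))"
      by (intro summable_add summable_mult coord_summable summable_mu_tau)
    fix n
    have "c n = coord u n * (1 / (t n - w)) + - (U w * of_real (sqrt (mu n))) * (1 / (t n - w))"
      by (simp add: c_def diff_divide_distrib)
    then have "(cmod (c n))\<^sup>2 \<le> 2 * (cmod (coord u n * (1 / (t n - w))))\<^sup>2
        + 2 * (cmod (- (U w * of_real (sqrt (mu n))) * (1 / (t n - w))))\<^sup>2"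
      using norm_add_sq_le by metis
    also have "(cmod (coord u n * (1 / (t n - w))))\<^sup>2 \<le> (1 / \<kappa>)\<^sup>2 * (cmod (coord u n))\<^sup>2"
    proof -
      have "(1 / \<kappa>) / tau n \<le> (1 / \<kappa>) / 1"
        using \<open>\<kappa> > 0\<close> tau_ge_1[of n] by (intro divide_left_mono) auto
      then have "cmod (1 / (t n - w)) \<le> 1 / \<kappa>"
        using bound[of n] by linarith
      then have "cmod (coord u n * (1 / (t n - w))) \<le> cmod (coord u n) * (1 / \<kappa>)"
        unfolding norm_mult by (intro mult_left_mono) auto
      then have "(cmod (coord u n * (1 / (t n - w))))\<^sup>2 \<le> (cmod (coord u n) * (1 / \<kappa>))\<^sup>2"
        by (intro power_mono) auto
      then show ?thesis
        by (simp add: power_mult_distrib power_divide)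
    qed
    also have "(cmod (- (U w * of_real (sqrt (mu n))) * (1 / (t n - w))))\<^sup>2
        \<le> (cmod (U w))\<^sup>2 * (1 / \<kappa>)\<^sup>2 * (mu n / (tau n)\<^sup>2)"
    proof -
      have "cmod (- (U w * of_real (sqrt (mu n))) * (1 / (t n - w))) \<le> (cmod (U w) * sqrt (mu n)) * ((1 / \<kappa>) / tau n)"
        using mult_left_mono[OF bound[of n], of "cmod (U w) * sqrt (mu n)"] by (simp add: norm_mult norm_divide)
      then have "(cmod (- (U w * of_real (sqrt (mu n))) * (1 / (t n - w))))\<^sup>2
          \<le> ((cmod (U w) * sqrt (mu n)) * ((1 / \<kappa>) / tau n))\<^sup>2"
        by (intro power_mono) auto
      also have "\<dots> = (cmod (U w))\<^sup>2 * (1 / \<kappa>)\<^sup>2 * (mu n / (tau n)\<^sup>2)"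
        by (simp add: power_mult_distrib power_divide)
      finally show ?thesis .
    qed
    finally show "norm ((cmod (c n))\<^sup>2) \<le> 2 * ((1 / \<kappa>)\<^sup>2 * (cmod (coord u n))\<^sup>2)
        + 2 * ((cmod (U w))\<^sup>2 * (1 / \<kappa>)\<^sup>2 * (mu n / (tau n)\<^sup>2))"
      by simp
  qed
  then obtain u' where u': "coord u' = c"
    using coord_Ell2 by blast
  have key: "(t n - w) * xu x u' n = xu x u n - U w * res x n" for x n
    using ne[of n] by (simp add: xu_def u' c_def res_def field_simps)
  \<comment> \<open>Dividing \<open>key\<close> by t n - w and summing gives - C(x u)(w) + U(w)
    C(res x)(w), which is zero by the multiplier identity at w.\<close>
  have ann: "pairing x u' = 0" if "x \<in> V" for x
  proof -
    have "xu x u' n = - (xu x u n / (w - t n)) + U w * (res x n / (w - t n))" for n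
    proof -
      have "xu x u' n = (xu x u n - U w * res x n) / (t n - w)"
        using key[of n x] ne[of n] by (metis nonzero_mult_div_cancel_left)
      also have "\<dots> = xu x u n / - (w - t n) - U w * (res x n / - (w - t n))"
        by (simp add: diff_divide_distrib)
      finally show ?thesis
        by (simp only: divide_minus_right) simp
    qed
    moreover have "(\<lambda>n. - (xu x u n / (w - t n)) + U w * (res x n / (w - t n))) sums
        (- cauchy (xu x u) w + U w * cauchy (res x) w)"
      unfolding cauchy_def
      by (intro sums_add sums_minus sums_mult summable_sums summable_cauchy adm_xu adm_res)
    moreover have "cauchy (xu x u) w = U w * cauchy (res x) w"
      by (rule multiplier_off[OF u(2) that w])
    ultimately have "xu x u' sums 0"
      by (simp add: sums_def)
    then show ?thesis
      by (simp add: pairing_def sums_iff xu_def[abs_def])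
  qed
  then have "annihilates u' V"
    by (simp add: annihilates_def)
  then obtain U' where U': "multiplier V u' U'"
    using multiplier_exists[OF V] by blast
  have shift: "(z - w) * cauchy (xu x u') z = cauchy (xu x u) z - U w * cauchy (res x) z"
    if "x \<in> V" "z \<notin> range t" for x z
  proof -
    have "(z - w) * (xu x u' n / (z - t n)) = xu x u' n + (xu x u n / (z - t n) - U w * (res x n / (z - t n)))" for n
    proof -
      have "z - t n \<noteq> 0" using that(2) by auto
      then have "(z - w) * (xu x u' n / (z - t n)) = xu x u' n + (t n - w) * xu x u' n / (z - t n)"
        by (simp add: field_simps)
      then show ?thesis
        unfolding key by (simp add: diff_divide_distrib)
    qed
    moreover have "xu x u' sums 0"
      using ann[OF that(1)] summable_sums[OF summable_pairing, of x u']
      by (simp add: pairing_def xu_def[abs_def])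
    then have "(\<lambda>n. xu x u' n + (xu x u n / (z - t n) - U w * (res x n / (z - t n)))) sums
        (0 + (cauchy (xu x u) z - U w * cauchy (res x) z))"
      unfolding cauchy_def
      by (intro sums_add sums_diff sums_mult summable_sums summable_cauchy adm_xu adm_res)
    moreover have "(\<lambda>n. (z - w) * (xu x u' n / (z - t n))) sums ((z - w) * cauchy (xu x u') z)"
      unfolding cauchy_def by (intro sums_mult summable_sums summable_cauchy adm_xu)
    ultimately show ?thesis
      using sums_unique2 by fastforce
  qed
  have "(\<lambda>z. (z - w) * U' z) = (\<lambda>z. U z - U w)"
  proof (rule entire_eqI)
    show "(\<lambda>z. (z - w) * U' z) holomorphic_on UNIV" "(\<lambda>z. U z - U w) holomorphic_on UNIV"
      using U' u(2) by (auto simp: multiplier_def intro!: holomorphic_intros)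
    fix z assume z: "z \<notin> range t"
    obtain x where x: "x \<in> V" "Phi x z \<noteq> 0"
      using ninv_no_common_zero[OF V] by blast
    have "(z - w) * U' z * cauchy (res x) z = (U z - U w) * cauchy (res x) z"
      using shift[OF x(1) z] multiplier_off[OF U' x(1) z] multiplier_off[OF u(2) x(1) z]
      by (simp add: algebra_simps)
    then show "(z - w) * U' z = U z - U w"
      using x(2) z by (simp add: Phi_def ent_off)
  qed
  then show ?thesis
    using that \<open>annihilates u' V\<close> U' by (metis (no_types, lifting))
qed

text \<open>The iterated backward shifts of U all come from annihilators, a space of dimension at
  most m. A linear relation among m + 1 of them shows that U is rational; being entire, it is a
  polynomial.\<close>

lemma finite_codim_annihilator:
  assumes V: "ninv V" "x0 \<in> V" "x0 \<noteq> 0" and "codim V m" and u: "annihilates u V"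
  obtains q where "\<And>n. coord u n = of_real (sqrt (mu n)) * poly q (t n)"
proof -
  obtain w where w: "w \<notin> range t"
    using eventually_happens[OF eventually_not_t[of 0]] by auto
  obtain U where U: "multiplier V u U"
    using multiplier_exists[OF V u] .
  define P where "P n p \<longleftrightarrow> annihilates (fst p) V \<and> multiplier V (fst p) (snd p) \<and> (n = (0::nat) \<longrightarrow> p = (u, U))" for n p
  define Q where "Q n p p' \<longleftrightarrow> (\<forall>z. (z - w) * snd p' z = snd p z - snd p w)"
    for n :: nat and p p' :: "ell2 \<times> (complex \<Rightarrow> complex)"
  have "\<exists>f. \<forall>n. P n (f n) \<and> Q n (f n) (f (Suc n))"
  proof (rule dependent_nat_choice)
    show "\<exists>p. P 0 p"
      using u U by (auto simp: P_def)
    show "\<exists>p'. P (Suc n) p' \<and> Q n p p'" if "P n p" for p n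
    proof -
      have "annihilates (fst p) V" "multiplier V (fst p) (snd p)"
        using that by (auto simp: P_def)
      then obtain u' U' where "annihilates u' V" "multiplier V u' U'" "\<And>z. (z - w) * U' z = snd p z - snd p w"
        using backward_shift[OF V _ _ w] by blast
      then show ?thesis
        by (intro exI[of _ "(u', U')"]) (auto simp: P_def Q_def)
    qed
  qed
  then obtain f where f: "\<And>n. P n (f n)" "\<And>n. Q n (f n) (f (Suc n))" by blast
  define us where "us j = fst (f j)" for j
  define Us where "Us j = snd (f j)" for j
  have us: "annihilates (us j) V" "multiplier V (us j) (Us j)" and U0: "Us 0 = U"
    and step: "(z - w) * Us (Suc j) z = Us j z - Us j w" for j z
    using f[of j] f(1)[of 0] by (auto simp: P_def Q_def us_def Us_def)
  \<comment> \<open>T is the Taylor polynomial of U at w of degree below j: each shift removes one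
    Taylor coefficient.\<close>
  have "\<exists>T. \<forall>z. (z - w) ^ j * Us j z = U z - poly T z" for j
  proof (induction j)
    case 0
    show ?case
      by (intro exI[of _ 0]) (simp add: U0)
  next
    case (Suc j)
    then obtain T where T: "\<And>z. (z - w) ^ j * Us j z = U z - poly T z" by blast
    have "(z - w) ^ Suc j * Us (Suc j) z = U z - poly (T + smult (Us j w) ([:- w, 1:] ^ j)) z" for z
    proof -
      have "(z - w) ^ Suc j * Us (Suc j) z = (z - w) ^ j * ((z - w) * Us (Suc j) z)"
        by simp
      also have "\<dots> = (z - w) ^ j * Us j z - Us j w * (z - w) ^ j"
        unfolding step by (simp add: algebra_simps)
      also have "\<dots> = U z - poly T z - Us j w * (z - w) ^ j"
        by (simp only: T)
      finally show ?thesis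
        by simp
    qed
    then show ?case by blast
  qed
  then obtain T where T: "\<And>j z. (z - w) ^ j * Us j z = U z - poly (T j) z" by metis
  obtain B where B: "finite B" "card B = m" "\<And>x. \<exists>a. \<exists>y\<in>V. x = y + (\<Sum>b\<in>B. cscale (a b) b)"
    using \<open>codim V m\<close> unfolding codim_def by blast
  obtain b where b: "bij_betw b {..<m} B"
    using ex_bij_betw_nat_finite[OF B(1)] B(2) by (auto simp: atLeast0LessThan)
  \<comment> \<open>The combination is chosen to annihilate the m complement vectors; as it also
    annihilates V, it is 0.\<close>
  obtain \<alpha> where \<alpha>: "\<exists>i\<in>{..m}. \<alpha> i \<noteq> 0" "\<forall>i<m. (\<Sum>j\<in>{..m}. \<alpha> j * pairing (us j) (b i)) = 0"
    using homogeneous_nontrivial[of "{..m}" m "\<lambda>j i. pairing (us j) (b i)"] by auto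
  define v where "v = (\<Sum>j\<le>m. cscale (\<alpha> j) (us j))"
  have vB: "pairing c v = 0" if c: "c \<in> B" for c
  proof -
    obtain i where "i < m" "c = b i"
      using b c unfolding bij_betw_def by auto
    then have "pairing v c = 0"
      using \<alpha>(2) by (simp add: v_def pairing_sum pairing_cscale)
    then show ?thesis
      by (simp add: pairing_commute[of c])
  qed
  have vV: "pairing y v = 0" if "y \<in> V" for y
    using us(1) that by (simp add: pairing_commute[of y] v_def pairing_sum pairing_cscale)
      (simp add: annihilates_def pairing_commute)
  have "pairing x v = 0" for x
  proof -
    obtain a y where "y \<in> V" "x = y + (\<Sum>b\<in>B. cscale (a b) b)"
      using B(3)[of x] by blast
    then show ?thesis
      by (simp add: pairing_add pairing_sum pairing_cscale vB vV)
  qed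
  then have "v = 0"
    by (intro ell2_eqI) (metis coord_simps(1) pairing_unit_seq)
  have zero: "(\<Sum>j\<le>m. \<alpha> j * Us j z) = 0" for z
    using multiplier_zero[OF V, of "\<lambda>z. \<Sum>j\<le>m. \<alpha> j * Us j z" z] multiplier_lincomb[of "{..m}" V us Us \<alpha>] us(2) \<open>v = 0\<close>
    by (simp add: v_def)
  \<comment> \<open>The relation times (z - w)^m, with (z - w)^j * Us j replaced by U - T j, reads U
    * Pp = Qp.\<close>
  define Pp where "Pp = (\<Sum>j\<le>m. smult (\<alpha> j) ([:- w, 1:] ^ (m - j)))"
  define Qp where "Qp = (\<Sum>j\<le>m. smult (\<alpha> j) ([:- w, 1:] ^ (m - j) * T j))"
  have UP: "U z * poly Pp z = poly Qp z" for z
  proof -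
    have "(z - w) ^ m * Us j z = (z - w) ^ (m - j) * (U z - poly (T j) z)" if "j \<le> m" for j
    proof -
      have "(z - w) ^ m = (z - w) ^ (m - j) * (z - w) ^ j"
        using that by (simp flip: power_add)
      then show ?thesis
        by (simp add: mult.assoc T)
    qed
    then have "(\<Sum>j\<le>m. \<alpha> j * ((z - w) ^ (m - j) * (U z - poly (T j) z))) = (\<Sum>j\<le>m. (z - w) ^ m * (\<alpha> j * Us j z))"
      by (intro sum.cong) auto
    also have "\<dots> = 0"
      by (simp add: zero flip: sum_distrib_left)
    finally show ?thesis
      by (simp add: Pp_def Qp_def poly_sum sum_distrib_left algebra_simps sum_subtractf)
  qed
  have "Pp \<noteq> 0"
  proof
    assume "Pp = 0"
    \<comment> \<open>Shifting the variable by w turns Pp into R, whose coefficients are the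
      \<alpha> in reversed order.\<close>
    define R where "R = (\<Sum>j\<le>m. monom (\<alpha> j) (m - j))"
    have "poly R y = poly Pp (y + w)" for y
      by (simp add: R_def Pp_def poly_sum poly_monom)
    then have "R = 0"
      using \<open>Pp = 0\<close> by (simp add: poly_all_0_iff_0[symmetric])
    have "\<alpha> i = 0" if "i \<le> m" for i
    proof -
      have "coeff R (m - i) = (\<Sum>j\<le>m. if j = i then \<alpha> j else 0)"
        unfolding R_def coeff_sum coeff_monom using that by (intro sum.cong) auto
      then show ?thesis
        using that \<open>R = 0\<close> by simp
    qed
    then show False
      using \<alpha>(1) by auto
  qed
  then obtain c R where c: "c > 0" "\<And>z. cmod z \<ge> R \<Longrightarrow> cmod (poly Pp z) \<ge> c * (1 + cmod z) ^ degree Pp"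
    using poly_lower by blast
  obtain K where K: "K > 0" "\<And>z. cmod (poly Qp z) \<le> K * (1 + cmod z) ^ degree Qp"
    using poly_growth by blast
  \<comment> \<open>Since |Pp| >= c outside a disk, the entire quotient U has polynomial growth,
    which replaces a divisibility argument.\<close>
  have "cmod (U z) \<le> (K / c) * (1 + cmod z) ^ degree Qp" if "cmod z \<ge> R" for z
  proof -
    have "c * 1 \<le> c * (1 + cmod z) ^ degree Pp"
      using \<open>c > 0\<close> by (intro mult_left_mono one_le_power) auto
    then have "c \<le> cmod (poly Pp z)"
      using c(2)[OF that] by linarith
    then have "c * cmod (U z) \<le> cmod (poly Pp z) * cmod (U z)"
      by (intro mult_right_mono) auto
    also have "\<dots> \<le> K * (1 + cmod z) ^ degree Qp"
      using K(2)[of z] UP[of z] by (metis mult.commute norm_mult)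
    finally show ?thesis
      using \<open>c > 0\<close> by (simp add: field_simps)
  qed
  then obtain q where "\<And>z. U z = poly q z"
    using entire_poly_growth[of U R "K / c" "degree Qp"] U unfolding multiplier_def by metis
  then show ?thesis
    using that[of q] multiplier_at_t[OF V U] by simp
qed

theorem finite_codim_imp_dense:
  assumes ex: "\<And>m. \<exists>V. ninv V \<and> codim V m"
    and fin: "\<And>V. ninv V \<Longrightarrow> V \<noteq> {0} \<Longrightarrow> \<exists>m. codim V m"
  shows "polys_dense_L2 t mu"
proof -
  have nontrivial: "\<exists>x\<in>V. x \<noteq> 0" if V: "csub V" "codim V m" for V m
  proof -
    obtain \<alpha> where \<alpha>: "\<exists>i\<le>m. \<alpha> i \<noteq> 0" "(\<Sum>i\<le>m. cscale (\<alpha> i) (unit_seq i)) \<in> V"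
      using codim_dependent[OF V] by blast
    have "coord (\<Sum>i\<le>m. cscale (\<alpha> i) (unit_seq i)) n = (if n \<le> m then \<alpha> n else 0)" for n
      by (simp add: if_distrib[of "\<lambda>c. \<alpha> _ * c"] cong: if_cong)
    then have "(\<Sum>i\<le>m. cscale (\<alpha> i) (unit_seq i)) \<noteq> 0"
      using \<alpha>(1) by (metis coord_simps(1))
    with \<alpha>(2) show ?thesis by blast
  qed
  have P: polyL2
  proof (rule ccontr)
    assume "\<not> polyL2"
    define S where "S k \<longleftrightarrow> summable (\<lambda>n. tau n ^ (2 * k) * mu n)" for k
    \<comment> \<open>Only polynomials of degree below k0 lie in L2(mu). All annihilators come from
      polynomials, so they span at most k0 dimensions, too few for codimension
      \<open>Suc k0\<close>.\<close>
    define k0 where "k0 = (LEAST k. \<not> S k)"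
    have "\<exists>k. \<not> S k"
      using \<open>\<not> polyL2\<close> by (auto simp: polyL2_def S_def)
    then have k0: "\<not> S k0" and less: "\<And>k. k < k0 \<Longrightarrow> S k"
      unfolding k0_def using LeastI_ex[of "\<lambda>k. \<not> S k"] not_less_Least[of _ "\<lambda>k. \<not> S k"] by blast+
    have S_mono: "S j" if "S k" "j \<le> k" for j k
      unfolding S_def
    proof (rule summable_comparison_test'[where N = 0])
      show "summable (\<lambda>n. tau n ^ (2 * k) * mu n)"
        using that by (simp add: S_def)
      show "norm (tau n ^ (2 * j) * mu n) \<le> tau n ^ (2 * k) * mu n" for n
        using that(2) tau_ge_1[of n] tau_pos[of n] by (auto intro!: mult_right_mono power_increasing simp: abs_mult)
    qed
    obtain V where V: "ninv V" "codim V (Suc k0)"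
      using ex by blast
    then have csub: "csub V" by (simp add: ninv_def)
    obtain x0 where x0: "x0 \<in> V" "x0 \<noteq> 0"
      using nontrivial[OF csub V(2)] by blast
    obtain B where B: "finite B" "card B = Suc k0" "\<And>a. (\<Sum>b\<in>B. cscale (a b) b) \<in> V \<Longrightarrow> \<forall>b\<in>B. a b = 0"
      using V(2) unfolding codim_def by blast
    \<comment> \<open>k0 + 1 complement vectors against k0 equations: a nontrivial combination y is
      annihilated by all annihilators of V and hence lies in V.\<close>
    obtain a where a: "\<exists>b\<in>B. a b \<noteq> 0" "\<forall>i<k0. (\<Sum>b\<in>B. a b * pairing b (pvec (monom 1 i))) = 0"
      using homogeneous_nontrivial[of B k0 "\<lambda>b i. pairing b (pvec (monom 1 i))"] B by auto
    define y where "y = (\<Sum>b\<in>B. cscale (a b) b)"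
    have "y \<in> V"
    proof (rule csub_bipolar[OF csub])
      fix u assume "\<And>v. v \<in> V \<Longrightarrow> pairing v u = 0"
      then have "annihilates u V" by (simp add: annihilates_def)
      then obtain q where q: "\<And>n. coord u n = of_real (sqrt (mu n)) * poly q (t n)"
        using finite_codim_annihilator[OF V(1) x0 V(2)] by blast
      have "(cmod (poly q (t n)))\<^sup>2 * mu n = (cmod (coord u n))\<^sup>2" for n
        by (simp only: q cmod_sqrt_mu_sq)
      then have "summable (\<lambda>n. (cmod (poly q (t n)))\<^sup>2 * mu n)"
        by (simp add: coord_summable)
      then have "q = 0 \<or> degree q < k0"
        using in_L2mu_poly_growth[of q] S_mono[of "degree q" k0] k0 by (auto simp: S_def not_less[symmetric])
      then have small: "i < k0" if "coeff q i \<noteq> 0" for i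
        using that le_degree[of q i] by auto
      have u: "u = (\<Sum>i<k0. cscale (coeff q i) (pvec (monom 1 i)))"
      proof (rule ell2_eqI)
        fix n
        have "poly q (t n) = (\<Sum>i<k0. coeff q i * t n ^ i)"
          unfolding poly_altdef
        proof (rule sum.mono_neutral_cong)
          show "coeff q i * t n ^ i = 0" if "i \<in> {..<k0} - {..degree q}" for i
            using that coeff_eq_0[of q i] by auto
          show "coeff q i * t n ^ i = 0" if "i \<in> {..degree q} - {..<k0}" for i
            using that small[of i] by auto
        qed auto
        moreover have "coord (pvec (monom 1 i)) n = of_real (sqrt (mu n)) * t n ^ i" if "i < k0" for i
          using coord_pvec[OF summable_poly_mu[of i "monom 1 i"], of n] less[OF that]
          by (simp add: S_def degree_monom_le poly_monom)
        ultimately show "coord u n = coord (\<Sum>i<k0. cscale (coeff q i) (pvec (monom 1 i))) n"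
          by (simp add: q sum_distrib_left mult_ac)
      qed
      have "pairing y u = (\<Sum>i<k0. coeff q i * pairing y (pvec (monom 1 i)))"
        unfolding u pairing_commute[of y] by (simp add: pairing_sum pairing_cscale)
      also have "\<dots> = 0"
        using a(2) by (simp add: y_def pairing_sum pairing_cscale)
      finally show "pairing y u = 0" .
    qed
    then show False
      using B(3) a(1) by (auto simp: y_def)
  qed
  \<comment> \<open>A nonzero x with vanishing moments makes \<open>Wsub UNIV\<close> a nonzero
    nearly invariant subspace; its codimension is infinite, since it contains no nontrivial finite
    combination of unit vectors.\<close>
  have "x = 0" if x: "\<forall>j. mom j (res x) = 0" for x
  proof (rule ccontr)
    assume "x \<noteq> 0"
    have W: "ninv (Wsub UNIV)"
      by (intro ninv_Wsub P) auto
    moreover have "x \<in> Wsub UNIV"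
      using x by (simp add: Wsub_def)
    ultimately obtain m where m: "codim (Wsub UNIV) m"
      using fin \<open>x \<noteq> 0\<close> by blast
    have "csub (Wsub UNIV)"
      using W by (simp add: ninv_def)
    then obtain \<alpha> where \<alpha>: "\<exists>i\<le>m. \<alpha> i \<noteq> 0" "(\<Sum>i\<le>m. cscale (\<alpha> i) (unit_seq i)) \<in> Wsub UNIV"
      using codim_dependent[OF _ m] by blast
    then show False
      using unit_seq_independent[OF P, of "Suc m" UNIV \<alpha>] by (auto simp: lessThan_Suc_atMost)
  qed
  with P show ?thesis
    by (simp add: polys_dense_iff)
qed

end

section \<open>Power separated points\<close>

text \<open>Power separation with the real exponent rounded up to a natural number p and C lowered
  to at most 1 (\<open>power_separated_imp_sep\<close>), which keeps the radii
  \<open>rho q n\<close> at most 1 / 4.\<close>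

locale cdb_sep = cdb +
  fixes C :: real and p :: nat
  assumes C_pos: "C > 0" and C_le_1: "C \<le> 1"
    and sep: "m \<noteq> n \<Longrightarrow> C / tau n ^ p \<le> cmod (t n - t m)"
begin

text \<open>For q >= p the factor 1 / 4 leaves room: a point of the disk around t n has distance at
  least 3 / 4 |t m - t n| from every other t m. A larger q gives polynomially smaller disks.\<close>

definition rho :: "nat \<Rightarrow> nat \<Rightarrow> real" where
  "rho q n = (C / 4) / tau n ^ q"

lemma rho_pos: "rho q n > 0"
  using C_pos tau_pos[of n] by (simp add: rho_def)

lemma rho_le_quarter: "rho q n \<le> 1 / 4"
proof -
  have "rho q n \<le> (C / 4) / 1"
    unfolding rho_def using C_pos tau_ge_1[of n] by (intro divide_left_mono) auto
  then show ?thesis using C_le_1 by simp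
qed

lemma rho_sep:
  assumes "p \<le> q" "m \<noteq> n"
  shows "4 * rho q n \<le> cmod (t n - t m)" "4 * rho q n \<le> cmod (t m - t n)"
proof -
  have "C / tau n ^ q \<le> C / tau n ^ p"
    using C_pos tau_ge_1[of n] assms(1) by (intro divide_left_mono power_increasing mult_pos_pos) auto
  then show "4 * rho q n \<le> cmod (t n - t m)"
    using sep[OF assms(2)] by (simp add: rho_def)
  then show "4 * rho q n \<le> cmod (t m - t n)"
    by (simp add: norm_minus_commute)
qed

lemma near_far:
  assumes "p \<le> q" "m \<noteq> n" "cmod (z - t n) \<le> rho q n"
  shows "3 / 4 * cmod (t m - t n) \<le> cmod (z - t m)" "rho q m \<le> cmod (z - t m)"
    "rho q n \<le> cmod (z - t m)" "z \<noteq> t m"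
proof -
  have "cmod (t m - t n) \<le> cmod (z - t m) + cmod (z - t n)"
    using norm_triangle_ineq[of "t m - z" "z - t n"] by (simp add: norm_minus_commute)
  then show 1: "3 / 4 * cmod (t m - t n) \<le> cmod (z - t m)"
    using assms(3) rho_sep[OF assms(1,2)] by linarith
  have "4 * rho q m \<le> cmod (t m - t n)" "4 * rho q n \<le> cmod (t m - t n)"
    using rho_sep[OF assms(1), of n m] rho_sep[OF assms(1), of m n] assms(2) by auto
  then show "rho q m \<le> cmod (z - t m)" "rho q n \<le> cmod (z - t m)"
    using 1 rho_pos[of q m] rho_pos[of q n] by linarith+
  then show "z \<noteq> t m"
    using rho_pos[of q m] by auto
qed

text \<open>An area count: disks of radius r = C / (4 R^p) around the points are disjoint and lie in
  the disk of radius 2 R; the bound is (2 R)^2 / r^2.\<close>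

lemma card_tau_le:
  assumes "finite F" "\<And>n. n \<in> F \<Longrightarrow> tau n \<le> R" "R \<ge> 1"
  shows "real (card F) \<le> (64 / C\<^sup>2) * R ^ (2 * p + 2)"
proof -
  define r where "r = (C / 4) / R ^ p"
  have "r > 0"
    using C_pos assms(3) by (simp add: r_def)
  have "r \<le> (C / 4) / 1"
    unfolding r_def using C_pos assms(3) by (intro divide_left_mono) auto
  then have "r \<le> 1" using C_le_1 by simp
  have far: "2 * r \<le> cmod (t n - t m)" if "n \<in> F" "m \<noteq> n" for m n
  proof -
    have "C / R ^ p \<le> C / tau n ^ p"
      using C_pos tau_pos[of n] assms(2)[OF that(1)] assms(3)
      by (intro divide_left_mono power_mono mult_pos_pos) auto
    then show ?thesis
      using sep[OF that(2)] \<open>r > 0\<close> by (simp add: r_def)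
  qed
  have disj: "disjoint_family_on (\<lambda>n. ball (t n) r) F"
    unfolding disjoint_family_on_def
  proof (intro ballI impI)
    fix m n assume mn: "m \<in> F" "n \<in> F" "m \<noteq> n"
    show "ball (t m) r \<inter> ball (t n) r = {}"
      using far[of m n] mn by (intro disjoint_ballI) (auto simp: dist_norm)
  qed
  have "(\<Sum>n\<in>F. measure lborel (ball (t n) r)) = measure lborel (\<Union>n\<in>F. ball (t n) r)"
  proof (rule measure_finite_Union[symmetric, OF assms(1) _ disj])
    show "emeasure lborel (ball (t n) r) \<noteq> \<infinity>" for n
      using emeasure_lborel_ball_finite[of "t n" r] by (metis less_irrefl)
  qed auto
  also have "\<dots> \<le> measure lborel (ball (0::complex) (2 * R))"
  proof (rule measure_mono_fmeasurable)
    show "(\<Union>n\<in>F. ball (t n) r) \<subseteq> ball 0 (2 * R)"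
    proof
      fix z assume "z \<in> (\<Union>n\<in>F. ball (t n) r)"
      then obtain n where n: "n \<in> F" "cmod (z - t n) < r"
        by (auto simp: dist_norm norm_minus_commute)
      have "cmod z \<le> cmod (z - t n) + cmod (t n)"
        using norm_triangle_ineq[of "z - t n" "t n"] by simp
      also have "\<dots> < 2 * R"
        using n assms(2)[OF n(1)] assms(3) \<open>r \<le> 1\<close> by (simp add: tau_def)
      finally show "z \<in> ball 0 (2 * R)" by simp
    qed
    show "(\<Union>n\<in>F. ball (t n) r) \<in> sets lborel"
      using assms(1) by auto
    show "ball (0::complex) (2 * R) \<in> fmeasurable lborel"
      using emeasure_lborel_ball_finite[of "0::complex" "2 * R"] by (simp add: fmeasurable_def)
  qed
  finally have "real (card F) * (pi * r\<^sup>2) \<le> pi * (2 * R)\<^sup>2"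
    using \<open>r > 0\<close> assms(3) by (simp add: content_ball unit_ball_vol_2)
  then have "pi * (real (card F) * r\<^sup>2) \<le> pi * (2 * R)\<^sup>2"
    by (simp only: mult.left_commute)
  then have "real (card F) * r\<^sup>2 \<le> (2 * R)\<^sup>2"
    by (simp del: power_mult_distrib)
  then have "real (card F) \<le> (2 * R)\<^sup>2 / r\<^sup>2"
    using \<open>r > 0\<close> by (simp add: pos_le_divide_eq)
  also have "\<dots> = (64 / C\<^sup>2) * R ^ (2 * p + 2)"
  proof -
    have "R ^ (2 * p + 2) = (R ^ p)\<^sup>2 * R\<^sup>2"
      by (simp only: power_add power_mult[symmetric] mult.commute)
    then show ?thesis
      by (simp add: r_def power_divide power_mult_distrib)
  qed
  finally show ?thesis .
qed

text \<open>Grouping by j = floor of tau: each group has at most a multiple of j^(2 p + 2) points,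
  and the exponent 2 p + 4 leaves 1 / j^2. The power of 2 in c comes from tau <= j + 1 <= 2
  j.\<close>

lemma summable_tau_power: "summable (\<lambda>n. 1 / tau n ^ (2 * p + 4))"
proof -
  define K where "K = 2 * p + 4"
  define c where "c = (64 / C\<^sup>2) * 2 ^ (2 * p + 2)"
  have "c > 0" using C_pos by (simp add: c_def)
  have sumj: "summable (\<lambda>j. c * inverse (real j ^ 2))"
    by (intro summable_mult inverse_power_summable) auto
  define B where "B = (\<Sum>j. c * inverse (real j ^ 2))"
  define f where "f n = nat \<lfloor>tau n\<rfloor>" for n
  have f: "real (f n) \<le> tau n" "tau n \<le> real (f n) + 1" "f n \<ge> 1" for n
    using tau_ge_1[of n] by (auto simp: f_def le_nat_floor)
  have "(\<Sum>n<N. 1 / tau n ^ K) \<le> B" for N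
  proof -
    have "(\<Sum>n<N. 1 / tau n ^ K) = (\<Sum>j\<in>f ` {..<N}. \<Sum>n\<in>{n \<in> {..<N}. f n = j}. 1 / tau n ^ K)"
      by (rule sum.image_gen) simp
    also have "\<dots> \<le> (\<Sum>j\<in>f ` {..<N}. c * inverse (real j ^ 2))"
    proof (rule sum_mono)
      fix j assume "j \<in> f ` {..<N}"
      then have j: "j \<ge> 1" using f(3) by auto
      let ?F = "{n \<in> {..<N}. f n = j}"
      have "(\<Sum>n\<in>?F. 1 / tau n ^ K) \<le> real (card ?F) * (1 / real j ^ K)"
      proof (rule sum_bounded_above)
        fix n assume "n \<in> ?F"
        then have "real j \<le> tau n" using f(1)[of n] by auto
        then show "1 / tau n ^ K \<le> 1 / real j ^ K"
          using j tau_pos[of n] by (intro divide_left_mono power_mono mult_pos_pos) auto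
      qed
      also have "\<dots> \<le> (64 / C\<^sup>2) * (real j + 1) ^ (2 * p + 2) * (1 / real j ^ K)"
        using f(2) by (intro mult_right_mono card_tau_le) auto
      also have "\<dots> \<le> (64 / C\<^sup>2) * (2 * real j) ^ (2 * p + 2) * (1 / real j ^ K)"
        using j by (intro mult_right_mono mult_left_mono power_mono) auto
      also have "\<dots> = c * (real j ^ (2 * p + 2) / real j ^ K)"
        by (simp add: c_def power_mult_distrib)
      also have "real j ^ (2 * p + 2) / real j ^ K = inverse (real j ^ 2)"
      proof -
        have "real j ^ K = real j ^ (2 * p + 2) * real j ^ 2"
          unfolding K_def power_add[symmetric] by (rule arg_cong[where f = "\<lambda>k. real j ^ k"]) simp
        moreover have "real j ^ (2 * p + 2) \<noteq> 0"
          using j by simp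
        ultimately show ?thesis
          by (simp only: nonzero_divide_mult_cancel_left inverse_eq_divide not_False_eq_True)
      qed
      finally show "(\<Sum>n\<in>?F. 1 / tau n ^ K) \<le> c * inverse (real j ^ 2)" .
    qed
    also have "\<dots> \<le> B"
      unfolding B_def using sumj \<open>c > 0\<close> by (intro sum_le_suminf) auto
    finally show ?thesis .
  qed
  then show ?thesis
    unfolding K_def[symmetric] using tau_pos
    by (intro summableI_nonneg_bounded[of _ B]) (auto intro: less_imp_le)
qed

section \<open>Cauchy transforms off small disks\<close>

definition off :: "nat \<Rightarrow> complex \<Rightarrow> bool" where
  "off q z \<longleftrightarrow> (\<forall>n. rho q n \<le> cmod (z - t n))"

lemma off_not_t: "off q z \<Longrightarrow> z \<notin> range t"
  using rho_pos[of q] by (auto simp: off_def not_le[symmetric]) (metis norm_zero right_minus_eq)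

lemma off_sphere: "p \<le> q \<Longrightarrow> cmod (z - t n) = rho q n \<Longrightarrow> off q z"
  unfolding off_def using near_far(2)[of q _ n z] by (metis order_refl)

text \<open>Off the disks 1 / |z - t n| is at most (4 / C) tau^q, so the tail of the series is small
  uniformly in z by rapid decay; the finitely many remaining terms tend to 0.\<close>

lemma cauchy_small:
  assumes "rapid a" "e > 0"
  obtains R where "\<And>z. off q z \<Longrightarrow> cmod z \<ge> R \<Longrightarrow> cmod (cauchy a z) < e"
proof -
  have "summable (\<lambda>n. (4 / C) * (cmod (a n) * tau n ^ q))"
    using assms(1) unfolding rapid_def by (intro summable_mult) blast
  then have sm: "summable (\<lambda>n. cmod (a n) / rho q n)"
    by (rule back_subst[of summable]) (auto simp: rho_def field_simps)
  obtain N where N: "norm (\<Sum>i. cmod (a (i + N)) / rho q (i + N)) < e / 2"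
    using suminf_exist_split[of "e / 2", OF _ sm] assms(2) by auto
  define M where "M = (\<Sum>n<N. cmod (a n))"
  define T where "T = (\<Sum>n<N. cmod (t n))"
  have "M \<ge> 0" by (simp add: M_def sum_nonneg)
  \<comment> \<open>Beyond T + 2 M / e + 1 each of the first N points is at distance at least 2 M /
    e + 1, so their terms total less than e / 2.\<close>
  have "cmod (cauchy a z) < e" if z: "off q z" "cmod z \<ge> T + 2 * M / e + 1" for z
  proof -
    have z0: "cmod (a n / (z - t n)) \<le> cmod (a n) / rho q n" for n
      using z(1) rho_pos[of q n] by (auto simp: norm_divide off_def intro!: divide_left_mono mult_pos_pos
          intro: less_le_trans)
    have s: "summable (\<lambda>n. cmod (a n / (z - t n)))"
      by (intro summable_cauchy_norm rapid_imp_adm assms)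
    have "cmod (cauchy a z) \<le> (\<Sum>n. cmod (a n / (z - t n)))"
      unfolding cauchy_def by (rule summable_norm[OF s])
    also have "\<dots> = (\<Sum>n. cmod (a (n + N) / (z - t (n + N)))) + (\<Sum>n<N. cmod (a n / (z - t n)))"
      by (rule suminf_split_initial_segment[OF s])
    also have "(\<Sum>n. cmod (a (n + N) / (z - t (n + N)))) \<le> (\<Sum>n. cmod (a (n + N)) / rho q (n + N))"
      by (intro suminf_le z0 summable_ignore_initial_segment s sm)
    also have "(\<Sum>n<N. cmod (a n / (z - t n))) \<le> (\<Sum>n<N. cmod (a n) * (1 / (2 * M / e + 1)))"
    proof (rule sum_mono)
      fix n assume "n \<in> {..<N}"
      then have "cmod (t n) \<le> T"
        unfolding T_def by (intro member_le_sum) auto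
      then have "2 * M / e + 1 \<le> cmod (z - t n)"
        using z(2) norm_triangle_ineq2[of z "t n"] by linarith
      moreover have "0 < 2 * M / e + 1"
        using \<open>M \<ge> 0\<close> assms(2) by (simp add: add_nonneg_pos)
      ultimately have "cmod (a n) / cmod (z - t n) \<le> cmod (a n) / (2 * M / e + 1)"
        by (intro frac_le) auto
      then show "cmod (a n / (z - t n)) \<le> cmod (a n) * (1 / (2 * M / e + 1))"
        by (simp add: norm_divide)
    qed
    also have "\<dots> = M / (2 * M / e + 1)"
      by (simp add: M_def flip: sum_divide_distrib)
    also have "\<dots> < e / 2"
      using \<open>M \<ge> 0\<close> assms(2) by (simp add: field_simps add_nonneg_pos)
    finally show ?thesis
      using N by (simp add: abs_less_iff)
  qed
  then show ?thesis using that by blast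
qed

lemma rapid_mult_t: "rapid a \<Longrightarrow> rapid (\<lambda>n. a n * t n ^ k)"
  using tau_pos cmod_t_le_tau by (erule_tac rapid_le[where K = 1 and k = k])
    (auto simp: norm_mult norm_power mult.commute[of "cmod (a _)"] intro!: mult_right_mono power_mono)

text \<open>Iterates z / (z - t) = 1 + t / (z - t), whose constant part contributes a moment. The
  point z may lie in T if its residue is zero, as in the application in
  \<open>loc_imp_polyL2\<close>.\<close>

lemma cauchy_moments:
  assumes "rapid a" "\<And>n. t n = z \<Longrightarrow> a n = 0" "\<And>j. j < k \<Longrightarrow> mom j a = 0"
  shows "z ^ k * cauchy a z = cauchy (\<lambda>n. a n * t n ^ k) z"
  using assms(3)
proof (induction k)
  case (Suc k)
  let ?b = "\<lambda>n. a n * t n ^ k"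
  have adm: "adm ?b" "adm (\<lambda>n. a n * t n ^ Suc k)"
    by (intro rapid_imp_adm rapid_mult_t assms)+
  have "z * (?b n / (z - t n)) = ?b n + a n * t n ^ Suc k / (z - t n)" for n
    using assms(2)[of n] by (cases "t n = z") (auto simp: field_simps)
  moreover have "(\<lambda>n. ?b n + a n * t n ^ Suc k / (z - t n)) sums (mom k a + cauchy (\<lambda>n. a n * t n ^ Suc k) z)"
    unfolding cauchy_def mom_def
    by (intro sums_add summable_sums summable_cauchy adm rapid_summable_mom assms)
  moreover have "(\<lambda>n. z * (?b n / (z - t n))) sums (z * cauchy ?b z)"
    unfolding cauchy_def by (intro sums_mult summable_sums summable_cauchy adm)
  ultimately have "z * cauchy ?b z = mom k a + cauchy (\<lambda>n. a n * t n ^ Suc k) z"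
    by (simp add: sums_iff)
  moreover have "z ^ k * cauchy a z = cauchy ?b z"
    by (rule Suc.IH) (simp add: Suc.prems)
  ultimately show ?case
    using Suc.prems[of k] by (simp add: mult.assoc)
qed simp

text \<open>One step beyond the vanishing moments; the remainder is the transform of a rapid
  sequence and hence small off the disks by \<open>cauchy_small\<close>.\<close>

lemma cauchy_moments_first:
  assumes "rapid a" "z \<notin> range t" "\<And>j. j < k \<Longrightarrow> mom j a = 0"
  shows "z ^ Suc k * cauchy a z = mom k a + cauchy (\<lambda>n. a n * t n ^ Suc k) z"
proof -
  let ?b = "\<lambda>n. a n * t n ^ k"
  have adm: "adm ?b" "adm (\<lambda>n. a n * t n ^ Suc k)"
    by (intro rapid_imp_adm rapid_mult_t assms)+
  have "z * (?b n / (z - t n)) = ?b n + a n * t n ^ Suc k / (z - t n)" for n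
  proof -
    have "z - t n \<noteq> 0" using assms(2) by auto
    then show ?thesis by (simp add: field_simps)
  qed
  moreover have "(\<lambda>n. ?b n + a n * t n ^ Suc k / (z - t n)) sums (mom k a + cauchy (\<lambda>n. a n * t n ^ Suc k) z)"
    unfolding cauchy_def mom_def
    by (intro sums_add summable_sums summable_cauchy adm rapid_summable_mom assms)
  moreover have "(\<lambda>n. z * (?b n / (z - t n))) sums (z * cauchy ?b z)"
    unfolding cauchy_def by (intro sums_mult summable_sums summable_cauchy adm)
  ultimately have "z * cauchy ?b z = mom k a + cauchy (\<lambda>n. a n * t n ^ Suc k) z"
    by (simp add: sums_iff)
  moreover have "z ^ k * cauchy a z = cauchy ?b z"
    using assms by (intro cauchy_moments) auto
  ultimately show ?thesis
    by (simp add: mult.assoc)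
qed

text \<open>k is the least index of a nonzero moment. The error of one half serves both the lower
  bound in \<open>dense_imp_finite_codim\<close> and the comparison on circles in Rouche's
  theorem.\<close>

lemma cauchy_asymptotics:
  assumes "rapid a" "mom j a \<noteq> 0"
  obtains k R where "mom k a \<noteq> 0"
    "\<And>z. off q z \<Longrightarrow> cmod z \<ge> R \<Longrightarrow> cmod (z ^ Suc k * cauchy a z - mom k a) < cmod (mom k a) / 2"
proof -
  define k where "k = (LEAST k. mom k a \<noteq> 0)"
  have k: "mom k a \<noteq> 0" "\<And>j. j < k \<Longrightarrow> mom j a = 0"
    unfolding k_def using LeastI[of "\<lambda>k. mom k a \<noteq> 0" j] assms(2) not_less_Least[of _ "\<lambda>k. mom k a \<noteq> 0"]
    by blast+
  obtain R where R: "\<And>z. off q z \<Longrightarrow> cmod z \<ge> R \<Longrightarrow>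
      cmod (cauchy (\<lambda>n. a n * t n ^ Suc k) z) < cmod (mom k a) / 2"
    using cauchy_small[OF rapid_mult_t[OF assms(1), of "Suc k"], of "cmod (mom k a) / 2" q] k(1)
    by (metis half_gt_zero zero_less_norm_iff)
  have "cmod (z ^ Suc k * cauchy a z - mom k a) < cmod (mom k a) / 2" if "off q z" "cmod z \<ge> R" for z
    using R[OF that] cauchy_moments_first[OF assms(1) off_not_t[OF that(1)] k(2)] by simp
  then show ?thesis
    using that k(1) by blast
qed

text \<open>For sequences such as \<open>xu x u\<close> that are only absolutely summable. Either
  tau n <= 2 (1 + |z|), and the disk condition bounds the kernel by a power of 1 + |z|, or t n is so
  far out that the kernel is at most 1.\<close>

lemma cauchy_poly_bound:
  assumes "summable (\<lambda>n. cmod (a n))" "adm a"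
  obtains K where "K \<ge> 0" "\<And>z. off p z \<Longrightarrow> cmod (cauchy a z) \<le> K * (1 + cmod z) ^ p"
proof -
  define K where "K = (4 / C) * 2 ^ p * (\<Sum>n. cmod (a n))"
  have "cmod (cauchy a z) \<le> K * (1 + cmod z) ^ p" if z: "off p z" for z
  proof -
    define b where "b = (4 / C) * (2 * (1 + cmod z)) ^ p"
    have inv: "1 / cmod (z - t n) \<le> b" for n
    proof (cases "tau n \<le> 2 * (1 + cmod z)")
      case True
      have "rho p n \<le> cmod (z - t n)" using z by (simp add: off_def)
      then have "1 / cmod (z - t n) \<le> 1 / rho p n"
        using rho_pos[of p n] by (intro divide_left_mono mult_pos_pos) auto
      also have "\<dots> = (4 / C) * tau n ^ p"
        using C_pos by (simp add: rho_def)
      also have "\<dots> \<le> b"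
        unfolding b_def using True C_pos tau_pos[of n] by (intro mult_left_mono power_mono) auto
      finally show ?thesis .
    next
      case False
      then have "1 + 2 * cmod z < cmod (t n)"
        by (simp add: tau_def)
      moreover have "cmod (t n) - cmod z \<le> cmod (z - t n)"
        by (metis norm_minus_commute norm_triangle_ineq2)
      moreover have "0 \<le> cmod z"
        by simp
      ultimately have "1 \<le> cmod (z - t n)"
        by linarith
      then have "1 / cmod (z - t n) \<le> 1 / 1"
        by (intro divide_left_mono) auto
      also have "1 / 1 = (1 * 1 :: real)"
        by simp
      also have "1 * 1 \<le> (4 / C) * (2 * (1 + cmod z)) ^ p"
        using C_pos C_le_1 by (intro mult_mono one_le_power) (auto simp: field_simps)
      finally show ?thesis by (simp add: b_def)
    qed
    have "cmod (cauchy a z) \<le> (\<Sum>n. cmod (a n / (z - t n)))"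
      unfolding cauchy_def by (intro summable_norm summable_cauchy_norm assms)
    also have "\<dots> \<le> (\<Sum>n. b * cmod (a n))"
    proof (intro suminf_le summable_cauchy_norm summable_mult assms)
      show "cmod (a n / (z - t n)) \<le> b * cmod (a n)" for n
        using mult_left_mono[OF inv[of n], of "cmod (a n)"] by (simp add: norm_divide mult.commute)
    qed
    also have "\<dots> = K * (1 + cmod z) ^ p"
      unfolding suminf_mult[OF assms(1)] K_def b_def power_mult_distrib by (simp only: mult_ac)
    finally show ?thesis .
  qed
  moreover have "K \<ge> 0"
    using C_pos by (simp add: K_def suminf_nonneg assms)
  ultimately show ?thesis using that by blast
qed

text \<open>Maximum modulus fills in the disks: their circles satisfy \<open>off\<close> and stay
  within distance 1 of z, which accounts for R + 1 and the factor 2^D.\<close>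

lemma off_bound_imp_bound:
  assumes U: "U holomorphic_on UNIV" and "p \<le> q" "K \<ge> 0"
    and bound: "\<And>z. off q z \<Longrightarrow> cmod z \<ge> R \<Longrightarrow> cmod (U z) \<le> K * (1 + cmod z) ^ D"
    and z: "cmod z \<ge> R + 1"
  shows "cmod (U z) \<le> (K * 2 ^ D) * (1 + cmod z) ^ D"
proof -
  have "1 + cmod z \<le> 2 * (1 + cmod z)" by simp
  show ?thesis
  proof (cases "off q z")
    case True
    have "cmod (U z) \<le> K * (1 + cmod z) ^ D"
      using bound[OF True] z by simp
    also have "\<dots> \<le> K * (2 * (1 + cmod z)) ^ D"
      using \<open>K \<ge> 0\<close> by (intro mult_left_mono power_mono) auto
    finally show ?thesis by (simp only: power_mult_distrib mult.assoc)
  next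
    case False
    then obtain n where n: "cmod (z - t n) < rho q n"
      by (auto simp: off_def not_le)
    show ?thesis
    proof (rule maximum_modulus_frontier[where S = "cball (t n) (rho q n)" and f = U])
      show "U holomorphic_on interior (cball (t n) (rho q n))"
        using U by (rule holomorphic_on_subset) simp
      show "continuous_on (closure (cball (t n) (rho q n))) U"
        using holomorphic_on_imp_continuous_on[OF U] by (rule continuous_on_subset) simp
      show "z \<in> cball (t n) (rho q n)"
        using n by (simp add: dist_norm norm_minus_commute)
      fix y assume "y \<in> frontier (cball (t n) (rho q n))"
      then have y: "cmod (y - t n) = rho q n"
        using rho_pos[of q n] by (simp add: dist_norm norm_minus_commute)
      have "cmod (y - z) \<le> 1"
        using norm_triangle_ineq[of "y - t n" "t n - z"] n y rho_le_quarter[of q n]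
        by (simp add: norm_minus_commute)
      then have yz: "cmod y \<le> cmod z + 1" "cmod z \<le> cmod y + 1"
        using norm_triangle_ineq2[of y z] norm_triangle_ineq2[of z y] by (simp_all add: norm_minus_commute)
      have "cmod (U y) \<le> K * (1 + cmod y) ^ D"
        using bound[OF off_sphere[OF \<open>p \<le> q\<close> y]] yz z by simp
      also have "1 + cmod y \<le> 2 * (1 + cmod z)"
        using yz(1) norm_ge_zero[of z] unfolding distrib_left by linarith
      then have "K * (1 + cmod y) ^ D \<le> K * (2 * (1 + cmod z)) ^ D"
        using \<open>K \<ge> 0\<close> by (intro mult_left_mono power_mono) auto
      finally show "cmod (U y) \<le> (K * 2 ^ D) * (1 + cmod z) ^ D"
        by (simp only: power_mult_distrib mult.assoc)
    qed auto
  qed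
qed

text \<open>The lower bound for C(res x0) and the upper bound for C(x0 u) limit the degree of every
  multiplier by the same D, which depends on x0 only. So a vector whose moments up to D vanish is
  annihilated by all annihilators of V.\<close>

theorem dense_imp_finite_codim:
  assumes P: polyL2 and det: "\<And>x. (\<And>j. mom j (res x) = 0) \<Longrightarrow> x = 0"
    and V: "ninv V" "V \<noteq> {0}"
  shows "\<exists>m. codim V m"
proof -
  have csub: "csub V" using V(1) by (simp add: ninv_def)
  then obtain x0 where x0: "x0 \<in> V" "x0 \<noteq> 0"
    using V(2) by (auto simp: csub_def)
  then obtain j where "mom j (res x0) \<noteq> 0"
    using det by blast
  then obtain k R where kR: "mom k (res x0) \<noteq> 0"
    "\<And>z. off p z \<Longrightarrow> cmod z \<ge> R \<Longrightarrow>
      cmod (z ^ Suc k * cauchy (res x0) z - mom k (res x0)) < cmod (mom k (res x0)) / 2"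
    using cauchy_asymptotics[OF polyL2_rapid[OF P]] by blast
  define h where "h = cmod (mom k (res x0)) / 2"
  have "h > 0" using kR(1) by (simp add: h_def)
  have low: "h \<le> cmod (z ^ Suc k * cauchy (res x0) z)" if "off p z" "cmod z \<ge> R" for z
    using kR(2)[OF that] norm_triangle_ineq3[of "z ^ Suc k * cauchy (res x0) z" "mom k (res x0)"]
    unfolding h_def by linarith
  define D where "D = Suc k + p"
  have "Wsub {..<Suc D} \<subseteq> V"
  proof
    fix x assume x: "x \<in> Wsub {..<Suc D}"
    show "x \<in> V"
    proof (rule csub_bipolar[OF csub])
      fix u assume "\<And>v. v \<in> V \<Longrightarrow> pairing v u = 0"
      then have "annihilates u V" by (simp add: annihilates_def)
      then obtain U where U: "multiplier V u U"
        using multiplier_exists[OF V(1) x0] by blast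
      then have holo: "U holomorphic_on UNIV" by (simp add: multiplier_def)
      have "summable (\<lambda>n. cmod (xu x0 u n))"
        unfolding xu_def by (rule summable_coord_mult)
      then obtain K where K: "K \<ge> 0" "\<And>z. off p z \<Longrightarrow> cmod (cauchy (xu x0 u) z) \<le> K * (1 + cmod z) ^ p"
        using cauchy_poly_bound adm_xu by blast
      have "cmod (U z) \<le> (K / h) * (1 + cmod z) ^ D" if z: "off p z" "cmod z \<ge> R" for z
      proof -
        have "h * cmod (U z) \<le> cmod (z ^ Suc k * cauchy (res x0) z) * cmod (U z)"
          by (intro mult_right_mono low z) auto
        also have "\<dots> = cmod z ^ Suc k * cmod (cauchy (xu x0 u) z)"
          by (simp add: multiplier_off[OF U x0(1) off_not_t[OF z(1)]] norm_mult norm_power mult_ac)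
        also have "\<dots> \<le> (1 + cmod z) ^ Suc k * (K * (1 + cmod z) ^ p)"
          using K z by (intro mult_mono power_mono) auto
        also have "\<dots> = K * (1 + cmod z) ^ D"
          by (simp add: D_def power_add mult_ac)
        finally show ?thesis
          using \<open>h > 0\<close> by (simp add: field_simps)
      qed
      from off_bound_imp_bound[OF holo order_refl _ this]
      have "cmod (U z) \<le> ((K / h) * 2 ^ D) * (1 + cmod z) ^ D" if "cmod z \<ge> R + 1" for z
        using that \<open>h > 0\<close> K(1) by simp
      then obtain q where q: "degree q \<le> D" "\<And>z. U z = poly q z"
        using entire_poly_growth[OF holo] by blast
      have "pairing x u = (\<Sum>n. res x n * poly q (t n))"
        by (simp add: pairing_def multiplier_at_t[OF V(1) x0 U] q(2) res_def mult.assoc)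
      also have "\<dots> = 0"
        using x q(1) by (simp add: mom_poly polyL2_rapid[OF P] Wsub_def)
      finally show "pairing x u = 0" .
    qed
  qed
  then show ?thesis
    by (rule codim_of_supset_Wsub[OF P csub])
qed

end

lemma power_separated_imp_sep:
  assumes "power_separated t"
  obtains C :: real and p :: nat where "C > 0" "C \<le> 1"
    "\<And>m n. m \<noteq> n \<Longrightarrow> C / (1 + cmod (t n)) ^ p \<le> cmod (t n - t m)"
proof -
  obtain C0 N where C0: "C0 > 0" "\<And>m n. m \<noteq> n \<Longrightarrow> C0 * (cmod (t n) + 1) powr (- N) \<le> cmod (t n - t m)"
    using assms unfolding power_separated_def by blast
  \<comment> \<open>For negative N this is 0, which is still admissible as 1 + |t n| >= 1.\<close>
  define p where "p = nat \<lceil>N\<rceil>"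
  have "min C0 1 / (1 + cmod (t n)) ^ p \<le> cmod (t n - t m)" if "m \<noteq> n" for m n
  proof -
    have "N \<le> real p"
      by (simp add: p_def) linarith
    then have "(cmod (t n) + 1) powr (- real p) \<le> (cmod (t n) + 1) powr (- N)"
      by (intro powr_mono) auto
    moreover have "(cmod (t n) + 1) powr (- real p) = 1 / (1 + cmod (t n)) ^ p"
      using powr_realpow[of "1 + cmod (t n)" p]
      by (simp add: powr_minus add_pos_nonneg divide_inverse add.commute)
    ultimately have "min C0 1 * (1 / (1 + cmod (t n)) ^ p) \<le> C0 * (cmod (t n) + 1) powr (- N)"
      using C0(1) by (intro mult_mono) auto
    then show ?thesis
      using C0(2)[OF that] by simp
  qed
  then show ?thesis
    using that[of "min C0 1" p] C0(1) by simp
qed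

section \<open>Density implies strong localization\<close>

text \<open>\<open>Rouche_theorem\<close> weights the zeros by winding numbers. On the larger disk
  the circle has winding number 1 inside and 0 outside, and neither f nor f + g vanishes on it, so
  the weighted sums become plain counts.\<close>

lemma Rouche_disk:
  fixes f g :: "complex \<Rightarrow> complex"
  assumes r: "0 < r" "r < r'" and holo: "f holomorphic_on ball c r'" "g holomorphic_on ball c r'"
    and fin: "finite {z \<in> ball c r'. f z + g z = 0}" "finite {z \<in> ball c r'. f z = 0}"
    and less: "\<And>z. cmod (z - c) = r \<Longrightarrow> cmod (g z) < cmod (f z)"
  shows "(\<Sum>z | z \<in> ball c r \<and> f z + g z = 0. zorder (\<lambda>z. f z + g z) z) = (\<Sum>z | z \<in> ball c r \<and> f z = 0. zorder f z)"
proof -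
  let ?\<gamma> = "circlepath c r"
  have path: "path_image ?\<gamma> = sphere c r"
    using r by (simp add: path_image_circlepath)
  have out: "winding_number ?\<gamma> z = 0" if "z \<notin> cball c r" for z
    using that r by (intro winding_number_zero_outside[where s = "cball c r"])
      (auto simp: path dist_norm)
  have inside: "winding_number ?\<gamma> z = 1" if "z \<in> ball c r" for z
    using that by (intro winding_number_circlepath) (simp add: dist_norm norm_minus_commute)
  have count: "(\<Sum>z | z \<in> ball c r' \<and> h z = 0. winding_number ?\<gamma> z * of_int (zorder h z))
      = of_int (\<Sum>z | z \<in> ball c r \<and> h z = 0. zorder h z)"
    if "finite {z \<in> ball c r'. h z = 0}" "\<And>z. cmod (z - c) = r \<Longrightarrow> h z \<noteq> 0" for h
  proof -
    have "(\<Sum>z | z \<in> ball c r' \<and> h z = 0. winding_number ?\<gamma> z * of_int (zorder h z))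
        = (\<Sum>z | z \<in> ball c r \<and> h z = 0. of_int (zorder h z))"
    proof (rule sum.mono_neutral_cong_right)
      show "finite {z. z \<in> ball c r' \<and> h z = 0}" using that(1) by simp
      show "{z. z \<in> ball c r \<and> h z = 0} \<subseteq> {z. z \<in> ball c r' \<and> h z = 0}"
        using r by auto
      show "\<forall>z\<in>{z. z \<in> ball c r' \<and> h z = 0} - {z. z \<in> ball c r \<and> h z = 0}.
          winding_number ?\<gamma> z * of_int (zorder h z) = 0"
      proof
        fix z assume "z \<in> {z. z \<in> ball c r' \<and> h z = 0} - {z. z \<in> ball c r \<and> h z = 0}"
        then have "h z = 0" "\<not> cmod (z - c) < r"
          by (auto simp: dist_norm norm_minus_commute)
        then have "z \<notin> cball c r"
          using that(2)[of z] by (auto simp: dist_norm norm_minus_commute)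
        then show "winding_number ?\<gamma> z * of_int (zorder h z) = 0"
          using out by simp
      qed
    qed (use inside in auto)
    then show ?thesis by simp
  qed
  have R: "(\<Sum>z | z \<in> ball c r' \<and> f z + g z = 0. winding_number ?\<gamma> z * of_int (zorder (\<lambda>z. f z + g z) z))
      = (\<Sum>z | z \<in> ball c r' \<and> f z = 0. winding_number ?\<gamma> z * of_int (zorder f z))"
  proof (rule Rouche_theorem)
    show "path_image ?\<gamma> \<subseteq> ball c r'"
      using r by (auto simp: path)
    show "\<forall>z\<in>path_image ?\<gamma>. cmod (g z) < cmod (f z)"
      using less r by (auto simp: path dist_norm norm_minus_commute)
    show "\<forall>z. z \<notin> ball c r' \<longrightarrow> winding_number ?\<gamma> z = 0"
      using r out by auto
  qed (use holo fin in auto)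
  have nz: "f z + g z \<noteq> 0" "f z \<noteq> 0" if "cmod (z - c) = r" for z
    using less[OF that] by (auto simp: add_eq_0_iff)
  have "complex_of_int (\<Sum>z | z \<in> ball c r \<and> f z + g z = 0. zorder (\<lambda>z. f z + g z) z)
      = complex_of_int (\<Sum>z | z \<in> ball c r \<and> f z = 0. zorder f z)"
    by (rule trans[OF count[OF fin(1) nz(1), symmetric] trans[OF R count[OF fin(2) nz(2)]]])
  then show ?thesis
    by (simp only: of_int_eq_iff)
qed

context cdb
begin

lemma finite_Phi_zeros:
  assumes "x \<noteq> 0"
  shows "finite {z. cmod z \<le> R \<and> Phi x z = 0}"
proof (cases "Phi x constant_on UNIV")
  case True
  then obtain c where c: "\<And>z. Phi x z = c"
    by (auto simp: constant_on_def)
  then have "c \<noteq> 0"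
    using assms Phi_eq_0_iff[of x] by auto
  then show ?thesis by (simp add: c)
next
  case False
  then have "finite {z \<in> cball 0 R. Phi x z = 0}"
    by (intro holomorphic_compact_finite_zeros[OF Phi_holomorphic open_UNIV connected_UNIV]) auto
  then show ?thesis by simp
qed

end

context cdb_sep
begin

lemma rho_tendsto_0:
  assumes "q > 0"
  shows "rho q \<longlonglongrightarrow> 0"
proof -
  have "filterlim tau at_top sequentially"
    unfolding tau_def by (intro filterlim_tendsto_add_at_top[OF tendsto_const] t_lim)
  then have "filterlim (\<lambda>n. tau n ^ q) at_infinity sequentially"
    using assms by (intro filterlim_at_top_imp_at_infinity filterlim_pow_at_top)
  then show ?thesis
    unfolding rho_def by (rule tendsto_divide_0[OF tendsto_const])
qed

lemma rho_disjoint: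
  assumes "p \<le> q" "n \<noteq> m"
  shows "ball (t n) (rho q n) \<inter> ball (t m) (rho q m) = {}"
  using rho_sep[OF assms(1), of m n] rho_sep[OF assms(1), of n m] assms(2) rho_pos[of q n] rho_pos[of q m]
  by (intro disjoint_ballI) (auto simp: dist_norm)

theorem dense_imp_localization:
  assumes P: polyL2 and det: "\<And>x. (\<And>j. mom j (res x) = 0) \<Longrightarrow> x = 0"
  shows "strong_localization t A mu"
proof -
  \<comment> \<open>\<open>Suc p\<close> rather than p, since the radii have to tend to 0 also when
    p = 0. They do not depend on f.\<close>
  define q where "q = Suc p"
  have "p \<le> q" "q > 0" by (simp_all add: q_def)
  have main: "finite ({z. f z = 0} - (\<Union>n. ball (t n) (rho q n))) \<and>
      (\<forall>\<^sub>F n in sequentially. finite {z \<in> ball (t n) (rho q n). f z = 0} \<and>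
        (\<Sum>z\<in>{z \<in> ball (t n) (rho q n). f z = 0}. zorder f z) = 1)"
    if f: "f \<in> cdb_space t A mu" "f \<noteq> (\<lambda>_. 0)" for f
  proof -
    obtain x where fx: "f = Phi x"
      using f(1) by (auto simp: cdb_space_eq)
    then have "x \<noteq> 0"
      using f(2) Phi_eq_0_iff by blast
    then obtain j where "mom j (res x) \<noteq> 0"
      using det by blast
    then obtain k R where kR: "mom k (res x) \<noteq> 0"
      "\<And>z. off q z \<Longrightarrow> cmod z \<ge> R \<Longrightarrow>
        cmod (z ^ Suc k * cauchy (res x) z - mom k (res x)) < cmod (mom k (res x)) / 2"
      using cauchy_asymptotics[OF polyL2_rapid[OF P]] by blast
    define m where "m = mom k (res x)"
    have "m \<noteq> 0" using kR(1) by (simp add: m_def)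
    have C_approx: "cmod (z ^ Suc k * cauchy (res x) z - m) < cmod m / 2" if "off q z" "cmod z \<ge> R" for z
      using kR(2)[OF that] by (simp add: m_def)
    have "{z. f z = 0} - (\<Union>n. ball (t n) (rho q n)) \<subseteq> {z. cmod z \<le> R \<and> Phi x z = 0}"
    proof
      fix z assume z: "z \<in> {z. f z = 0} - (\<Union>n. ball (t n) (rho q n))"
      then have off: "off q z"
        by (auto simp: off_def dist_norm norm_minus_commute not_less)
      have "cauchy (res x) z = 0"
        using z ent_eq_0_off[OF off_not_t[OF off], of "res x"] by (simp add: fx Phi_def)
      then have "cmod z \<le> R"
        using C_approx[OF off] \<open>m \<noteq> 0\<close> by (cases "cmod z \<le> R") auto
      then show "z \<in> {z. cmod z \<le> R \<and> Phi x z = 0}"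
        using z by (simp add: fx)
    qed
    then have fin: "finite ({z. f z = 0} - (\<Union>n. ball (t n) (rho q n)))"
      using finite_Phi_zeros[OF \<open>x \<noteq> 0\<close>] by (rule finite_subset)
    \<comment> \<open>The bound on t n keeps the disk of radius 2 r away from the pole of the
      comparison function at 0 and within the range of the asymptotics.\<close>
    have one: "finite {z \<in> ball (t n) (rho q n). f z = 0} \<and>
        (\<Sum>z\<in>{z \<in> ball (t n) (rho q n). f z = 0}. zorder f z) = 1"
      if n: "cmod (t n) \<ge> max R 1 + 2" for n
    proof -
      define r where "r = rho q n"
      have r: "0 < r" "r \<le> 1 / 4"
        using rho_pos[of q n] rho_le_quarter[of q n] by (simp_all add: r_def)
      have big: "cmod z \<ge> max R 1 + 1" if "z \<in> ball (t n) (2 * r)" for z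
      proof -
        have "cmod (t n - z) \<le> 1 / 2"
          using that r by (simp add: dist_norm)
        then show ?thesis
          using n norm_triangle_ineq2[of "t n" z] by linarith
      qed
      then have nz: "z \<noteq> 0" if "z \<in> ball (t n) (2 * r)" for z
        using that by fastforce
      have A0: "A z = 0 \<longleftrightarrow> z = t n" if "z \<in> ball (t n) (2 * r)" for z
      proof -
        have "z \<noteq> t l" if "l \<noteq> n" for l
          using rho_sep[OF \<open>p \<le> q\<close> that] \<open>z \<in> ball (t n) (2 * r)\<close> r by (auto simp: r_def dist_norm)
        then show ?thesis
          unfolding A_eq_0_iff by (metis rangeE rangeI)
      qed
      \<comment> \<open>The leading term of A C(res x): its only zero in the disk is the simple zero
        t n of A, and on the circle it dominates the error G.\<close>
      define F where "F z = m * A z / z ^ Suc k" for z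
      define G where "G z = Phi x z - F z" for z
      have Fholo: "F holomorphic_on ball (t n) (2 * r)"
        unfolding F_def using nz by (intro holomorphic_intros holomorphic_on_subset[OF A_holo]) auto
      have Gholo: "G holomorphic_on ball (t n) (2 * r)"
        unfolding G_def by (intro holomorphic_intros Fholo holomorphic_on_subset[OF Phi_holomorphic]) auto
      have F0: "{z. z \<in> ball (t n) r' \<and> F z = 0} = {t n}" if "0 < r'" "r' \<le> 2 * r" for r'
      proof -
        have "F z = 0 \<longleftrightarrow> z = t n" if "z \<in> ball (t n) r'" for z
        proof -
          have "z \<in> ball (t n) (2 * r)" using that \<open>r' \<le> 2 * r\<close> by auto
          then show ?thesis
            using A0[of z] nz[of z] \<open>m \<noteq> 0\<close> by (auto simp: F_def)
        qed
        then show ?thesis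
          using \<open>0 < r'\<close> by auto
      qed
      have less: "cmod (G z) < cmod (F z)" if z: "cmod (z - t n) = r" for z
      proof -
        have off: "off q z"
          using off_sphere[OF \<open>p \<le> q\<close>] z by (simp add: r_def)
        have zb: "z \<in> ball (t n) (2 * r)"
          using z r by (simp add: dist_norm norm_minus_commute)
        then have "cmod z \<ge> R" using big[OF zb] by simp
        have "z \<noteq> 0" "A z \<noteq> 0"
          using nz[OF zb] off_not_t[OF off] by (auto simp: A_eq_0_iff)
        have "G z = (A z / z ^ Suc k) * (z ^ Suc k * cauchy (res x) z - m)"
          using off_not_t[OF off] \<open>z \<noteq> 0\<close> by (simp add: G_def F_def Phi_def ent_off field_simps)
        also have "cmod \<dots> = cmod (A z / z ^ Suc k) * cmod (z ^ Suc k * cauchy (res x) z - m)"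
          by (rule norm_mult)
        also have "cmod (z ^ Suc k * cauchy (res x) z - m) < cmod m"
          using C_approx[OF off \<open>cmod z \<ge> R\<close>] norm_ge_zero[of m] by linarith
        then have "cmod (A z / z ^ Suc k) * cmod (z ^ Suc k * cauchy (res x) z - m) < cmod (A z / z ^ Suc k) * cmod m"
          using \<open>A z \<noteq> 0\<close> \<open>z \<noteq> 0\<close> by (intro mult_strict_left_mono) auto
        also have "\<dots> = cmod (F z)"
          by (simp add: F_def norm_mult norm_divide mult.commute)
        finally show ?thesis .
      qed
      have FG: "(\<lambda>z. F z + G z) = f"
        by (simp add: G_def fx)
      have sub: "finite {z \<in> ball (t n) r'. f z = 0}" for r'
        using finite_Phi_zeros[OF \<open>x \<noteq> 0\<close>, of "cmod (t n) + r'"]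
      proof (rule finite_subset[rotated], safe)
        fix z assume "z \<in> ball (t n) r'" "f z = 0"
        then show "cmod z \<le> cmod (t n) + r'"
          using norm_triangle_ineq2[of z "t n"] by (simp add: dist_norm norm_minus_commute)
        show "Phi x z = 0" using \<open>f z = 0\<close> by (simp add: fx)
      qed
      have "(\<Sum>z | z \<in> ball (t n) r \<and> F z + G z = 0. zorder (\<lambda>z. F z + G z) z)
          = (\<Sum>z | z \<in> ball (t n) r \<and> F z = 0. zorder F z)"
        using r less sub[of "2 * r"] F0[of "2 * r"]
        by (intro Rouche_disk[where r' = "2 * r"] Fholo Gholo) (auto simp: fun_cong[OF FG])
      also have "\<dots> = zorder F (t n)"
        using F0[of r] r by simp
      also have "\<dots> = 1"
      proof (rule simple_zeroI)
        let ?g = "\<lambda>z. m * (if z = t n then deriv A (t n) else A z / (z - t n)) / z ^ Suc k"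
        have "(\<lambda>z. if z = t n then deriv A (t n) else A z / (z - t n)) holomorphic_on UNIV"
          by (rule quotient_holomorphic[OF A_holo]) (simp add: A_eq_0_iff)
        then show "?g holomorphic_on ball (t n) (2 * r)"
          using nz by (intro holomorphic_intros) (auto intro: holomorphic_on_subset)
        show "t n \<in> ball (t n) (2 * r)" using r by simp
        then show "?g (t n) \<noteq> 0"
          using nz[of "t n"] \<open>m \<noteq> 0\<close> deriv_A[of n] by simp
        show "F z = ?g z * (z - t n)" for z
          by (cases "z = t n") (auto simp: F_def A_eq_0_iff)
      qed auto
      finally show ?thesis
        using sub[of r] by (simp add: FG fun_cong[OF FG] r_def)
    qed
    have "\<forall>\<^sub>F n in sequentially. cmod (t n) \<ge> max R 1 + 2"
      using t_lim by (simp add: filterlim_at_top)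
    then show ?thesis
      using fin one by (auto elim: eventually_mono)
  qed
  show ?thesis
    unfolding strong_localization_def
    using rho_pos rho_tendsto_0[OF \<open>q > 0\<close>] rho_disjoint[OF \<open>p \<le> q\<close>] main
    by (intro exI[of _ "rho q"]) blast
qed

end

section \<open>Strong localization implies density\<close>

context cdb
begin

text \<open>For w off T this vector represents evaluation at w up to the factor A(w), so norm
  convergence implies pointwise convergence off T.\<close>

definition kern :: "complex \<Rightarrow> ell2" where
  "kern w = Ell2 (\<lambda>n. of_real (sqrt (mu n)) / (w - t n))"

lemma Phi_eq_pairing:
  assumes "w \<notin> range t"
  shows "Phi x w = A w * pairing x (kern w)"
proof -
  obtain \<kappa> where k: "\<kappa> > 0" "\<And>n. t n \<noteq> w \<Longrightarrow> \<kappa> * tau n \<le> cmod (w - t n)"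
    using t_lower by blast
  have "summable (\<lambda>n. (cmod (of_real (sqrt (mu n)) / (w - t n)))\<^sup>2)"
  proof (rule summable_comparison_test'[where N = 0])
    show "summable (\<lambda>n. (1 / \<kappa>)\<^sup>2 * (mu n / (tau n)\<^sup>2))"
      by (intro summable_mult summable_mu_tau)
    fix n
    have "t n \<noteq> w" using assms by auto
    then have "cmod (of_real (sqrt (mu n)) / (w - t n)) \<le> sqrt (mu n) / (\<kappa> * tau n)"
      using k tau_pos[of n] by (auto simp: norm_divide intro!: frac_le)
    then have "(cmod (of_real (sqrt (mu n)) / (w - t n)))\<^sup>2 \<le> (sqrt (mu n) / (\<kappa> * tau n))\<^sup>2"
      by (intro power_mono) auto
    then show "norm ((cmod (of_real (sqrt (mu n)) / (w - t n)))\<^sup>2) \<le> (1 / \<kappa>)\<^sup>2 * (mu n / (tau n)\<^sup>2)"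
      by (simp add: power_divide power_mult_distrib)
  qed
  then have "coord (kern w) n = of_real (sqrt (mu n)) / (w - t n)" for n
    by (simp add: kern_def coord_Ell2)
  then show ?thesis
    by (simp add: Phi_def ent_off[OF assms] cauchy_def pairing_def res_def)
qed

lemma tendsto_Phi:
  assumes "w \<notin> range t" "X \<longlonglongrightarrow> l"
  shows "(\<lambda>k. Phi (X k) w) \<longlonglongrightarrow> Phi l w"
  unfolding Phi_eq_pairing[OF assms(1)]
  by (intro tendsto_intros bounded_linear.tendsto[OF bounded_linear_pairing] assms(2))

text \<open>A gliding hump: zeros off the localizing disks are created one after another, so far out
  and with so small a perturbation that the zeros created before survive in the limit.\<close>

lemma gliding_hump:
  fixes G :: "ell2 set" and E :: "complex set"
  assumes fin: "\<And>x. x \<noteq> 0 \<Longrightarrow> finite ({z. Phi x z = 0} - E)" and "range t \<subseteq> E"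
    and step: "\<And>x e R. x \<in> G \<Longrightarrow> e > 0 \<Longrightarrow> \<exists>y\<in>G. \<exists>w. norm (y - x) < e \<and> cmod w > R \<and> w \<notin> E \<and>
      Phi y w = 0 \<and> (\<forall>v. cmod v \<le> R \<longrightarrow> Phi x v = 0 \<longrightarrow> Phi y v = 0)"
    and x0: "x0 \<in> G"
  shows "x0 = 0"
proof (rule ccontr)
  assume "x0 \<noteq> 0"
  define P where "P n p \<longleftrightarrow> fst p \<in> G \<and> (n = (0::nat) \<longrightarrow> fst p = x0)"
    for n and p :: "ell2 \<times> complex"
  \<comment> \<open>A pair holds the current vector and the last created zero, whose modulus is the
    radius R of the next step. The norm bounds sum to norm x0 / 2, so the limit is nonzero.\<close>
  define Q where "Q n p p' \<longleftrightarrow> norm (fst p' - fst p) < norm x0 / 4 * (1 / 2) ^ n \<and>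
      cmod (snd p') > cmod (snd p) \<and> snd p' \<notin> E \<and> Phi (fst p') (snd p') = 0 \<and>
      (\<forall>v. cmod v \<le> cmod (snd p) \<longrightarrow> Phi (fst p) v = 0 \<longrightarrow> Phi (fst p') v = 0)"
    for n :: nat and p p' :: "ell2 \<times> complex"
  have "\<exists>f. \<forall>n. P n (f n) \<and> Q n (f n) (f (Suc n))"
  proof (rule dependent_nat_choice)
    show "\<exists>p. P 0 p"
      using x0 by (auto simp: P_def)
    show "\<exists>p'. P (Suc n) p' \<and> Q n p p'" if "P n p" for p n
    proof -
      have "fst p \<in> G" using that by (simp add: P_def)
      moreover have "norm x0 / 4 * (1 / 2) ^ n > 0" using \<open>x0 \<noteq> 0\<close> by simp
      ultimately obtain y w where "y \<in> G" "norm (y - fst p) < norm x0 / 4 * (1 / 2) ^ n"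
        "cmod w > cmod (snd p)" "w \<notin> E" "Phi y w = 0"
        "\<forall>v. cmod v \<le> cmod (snd p) \<longrightarrow> Phi (fst p) v = 0 \<longrightarrow> Phi y v = 0"
        using step[of "fst p" "norm x0 / 4 * (1 / 2) ^ n" "cmod (snd p)"] by blast
      then show ?thesis
        by (intro exI[of _ "(y, w)"]) (auto simp: P_def Q_def)
    qed
  qed
  then obtain f where f: "\<And>n. P n (f n)" "\<And>n. Q n (f n) (f (Suc n))" by blast
  define X where "X n = fst (f n)" for n
  define W where "W n = snd (f (Suc n))" for n
  have X0: "X 0 = x0" using f(1)[of 0] by (simp add: P_def X_def)
  have dX: "norm (X (Suc n) - X n) < norm x0 / 4 * (1 / 2) ^ n" for n
    using f(2)[of n] by (simp add: Q_def X_def)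
  have W: "W n \<notin> E" "Phi (X (Suc n)) (W n) = 0" "cmod (W n) < cmod (W (Suc n))" for n
    using f(2)[of n] f(2)[of "Suc n"] by (simp_all add: Q_def X_def W_def)
  have W_mono: "strict_mono (\<lambda>n. cmod (W n))"
    using W(3) by (simp add: strict_mono_Suc_iff)
  \<comment> \<open>The moduli of the created zeros increase, so an old zero always lies in the
    radius protected by later steps.\<close>
  have zero: "Phi (X (Suc (n + j))) (W n) = 0" for n j
  proof (induction j)
    case (Suc j)
    have "cmod (W n) \<le> cmod (W (n + j))"
      using strict_mono_less_eq[OF W_mono, of n "n + j"] by simp
    then have "Phi (X (Suc (n + j))) (W n) = 0 \<longrightarrow> Phi (X (Suc (Suc (n + j)))) (W n) = 0"
      using f(2)[of "Suc (n + j)"] unfolding Q_def X_def W_def by blast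
    with Suc show ?case by simp
  qed (use W in simp)
  have geo: "(\<lambda>n. norm x0 / 4 * (1 / 2) ^ n) sums (norm x0 / 4 * 2)"
    using sums_mult[OF geometric_sums[of "1 / 2 :: real"], of "norm x0 / 4"] by simp
  have sumd: "summable (\<lambda>n. norm (X (Suc n) - X n))"
    by (rule summable_comparison_test'[where N = 0, OF sums_summable[OF geo]])
      (use dX in \<open>auto intro: less_imp_le\<close>)
  define l where "l = x0 + (\<Sum>n. X (Suc n) - X n)"
  have "(\<lambda>N. x0 + (\<Sum>n<N. X (Suc n) - X n)) \<longlonglongrightarrow> l"
    unfolding l_def by (intro tendsto_intros summable_LIMSEQ summable_norm_cancel[OF sumd])
  then have lim: "X \<longlonglongrightarrow> l"
    by (simp add: sum_lessThan_telescope X0)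
  have "norm (\<Sum>n. X (Suc n) - X n) \<le> (\<Sum>n. norm (X (Suc n) - X n))"
    by (rule summable_norm[OF sumd])
  also have "\<dots> \<le> (\<Sum>n. norm x0 / 4 * (1 / 2) ^ n)"
    using dX by (intro suminf_le sumd sums_summable[OF geo]) (auto intro: less_imp_le)
  also have "\<dots> = norm x0 / 2"
    using geo by (simp add: sums_iff)
  finally have "norm (l - x0) \<le> norm x0 / 2"
    by (simp add: l_def)
  then have "l \<noteq> 0"
    using \<open>x0 \<noteq> 0\<close> by auto
  have "Phi l (W n) = 0" for n
  proof -
    have "W n \<notin> range t" using W(1) \<open>range t \<subseteq> E\<close> by blast
    then have "(\<lambda>k. Phi (X k) (W n)) \<longlonglongrightarrow> Phi l (W n)"
      by (rule tendsto_Phi[OF _ lim])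
    then have "(\<lambda>k. Phi (X (k + Suc n)) (W n)) \<longlonglongrightarrow> Phi l (W n)"
      by (rule LIMSEQ_ignore_initial_segment)
    moreover have "(\<lambda>k. Phi (X (k + Suc n)) (W n)) = (\<lambda>_. 0)"
      using zero[of n] by (auto simp: add.commute)
    ultimately show ?thesis
      by (simp add: LIMSEQ_const_iff)
  qed
  then have "range W \<subseteq> {z. Phi l z = 0} - E"
    using W(1) by auto
  then have "finite (range W)"
    using fin[OF \<open>l \<noteq> 0\<close>] by (rule finite_subset)
  moreover have "inj W"
    using strict_mono_eq[OF W_mono] by (metis injI)
  ultimately show False
    using finite_imageD infinite_UNIV_nat by blast
qed

lemma coord_move_diff: "t n \<noteq> s \<Longrightarrow> coord (move x s w) n - coord x n = coord x n * ((s - w) / (t n - s))"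
  by (simp add: coord_move field_simps)

lemma quot_nonzero: "x \<noteq> 0 \<Longrightarrow> Phi x w = 0 \<Longrightarrow> quot x w \<noteq> 0"
proof
  assume "x \<noteq> 0" "Phi x w = 0" "quot x w = 0"
  have "Phi x = (\<lambda>_. 0)"
    by (rule entire_eqI[where w = w])
      (use Phi_quot_at[OF \<open>Phi x w = 0\<close>] \<open>quot x w = 0\<close> Phi_holomorphic in auto)
  then show False
    using \<open>x \<noteq> 0\<close> by (simp add: Phi_eq_0_iff)
qed

end

text \<open>Strong localization expressed for vectors; a sum of zero orders equal to 1 over a disk
  is turned into the existence of a zero there.\<close>

locale cdb_loc = cdb_sep +
  fixes r :: "nat \<Rightarrow> real"
  assumes r_pos: "r n > 0" and r_lim: "r \<longlonglongrightarrow> 0"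
    and r_disj: "m \<noteq> n \<Longrightarrow> ball (t m) (r m) \<inter> ball (t n) (r n) = {}"
    and loc_fin: "x \<noteq> 0 \<Longrightarrow> finite ({z. Phi x z = 0} - (\<Union>n. ball (t n) (r n)))"
    and loc_zero: "x \<noteq> 0 \<Longrightarrow> \<forall>\<^sub>F n in sequentially. \<exists>z\<in>ball (t n) (r n). Phi x z = 0"
begin

abbreviation E :: "complex set" where
  "E \<equiv> (\<Union>n. ball (t n) (r n))"

lemma range_t_E: "range t \<subseteq> E"
  using r_pos by auto

text \<open>Disjoint open disks do not meet each other's boundaries. Boundary points are the targets
  of displaced zeros: outside \<open>E\<close>, yet within bounded distance.\<close>

lemma boundary_not_E:
  assumes "cmod (w - t n) = r n"
  shows "w \<notin> E"
proof
  assume "w \<in> E"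
  then obtain m where m: "w \<in> ball (t m) (r m)" by auto
  then have "m \<noteq> n"
    using assms by (auto simp: dist_norm norm_minus_commute)
  have "w \<in> closure (ball (t n) (r n))"
    using assms r_pos[of n] by (simp add: dist_norm norm_minus_commute)
  then have "ball (t m) (r m) \<inter> closure (ball (t n) (r n)) \<noteq> {}"
    using m by blast
  then have "ball (t m) (r m) \<inter> ball (t n) (r n) \<noteq> {}"
    by (subst (asm) open_Int_closure_eq_empty) auto
  then show False
    using r_disj[OF \<open>m \<noteq> n\<close>] by simp
qed

lemma r_bounded: obtains L where "L > 0" "\<And>n. r n \<le> L"
proof -
  have "Bseq r" using r_lim by (meson convergentI convergent_imp_Bseq)
  then obtain L where "L > 0" "\<And>n. norm (r n) \<le> L" unfolding Bseq_def by blast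
  then show ?thesis
    using that by (metis abs_le_D1 real_norm_def)
qed

text \<open>L does not depend on s because the radii are bounded; so the displacement of a zero
  stays bounded while the zero itself goes to infinity.\<close>

lemma find_w:
  obtains L where "L > 0" "\<And>s. \<exists>w. w \<notin> E \<and> cmod (s - w) \<le> L"
proof -
  obtain L where L: "L > 0" "\<And>n. r n \<le> L" using r_bounded by blast
  have "\<exists>w. w \<notin> E \<and> cmod (s - w) \<le> 2 * L" for s
  proof (cases "s \<in> E")
    case False
    then show ?thesis using L(1) by (intro exI[of _ s]) auto
  next
    case True
    then obtain n where n: "s \<in> ball (t n) (r n)" by auto
    define w where "w = t n + of_real (r n)"
    have "cmod (w - t n) = r n"
      using r_pos[of n] by (simp add: w_def)
    then have "w \<notin> E" by (rule boundary_not_E)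
    moreover have "cmod (s - w) \<le> cmod (s - t n) + cmod (t n - w)"
      using norm_triangle_ineq[of "s - t n" "t n - w"] by simp
    then have "cmod (s - w) \<le> 2 * L"
      using n \<open>cmod (w - t n) = r n\<close> L(2)[of n] by (simp add: dist_norm norm_minus_commute)
    ultimately show ?thesis by blast
  qed
  then show ?thesis using that[of "2 * L"] L(1) by simp
qed

lemma polyL2_or_heavy:
  assumes "\<not> polyL2"
  obtains M where "infinite {n. 1 / tau n ^ (2 * M) \<le> mu n}"
proof -
  obtain k where k: "\<not> summable (\<lambda>n. tau n ^ (2 * k) * mu n)"
    using assms by (auto simp: polyL2_def)
  \<comment> \<open>Chosen so that 2 M - 2 k = 2 p + 4, the exponent of
    \<open>summable_tau_power\<close>.\<close>
  define M where "M = k + p + 2"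
  have "infinite {n. 1 / tau n ^ (2 * M) \<le> mu n}"
  proof
    assume fin: "finite {n. 1 / tau n ^ (2 * M) \<le> mu n}"
    have "summable (\<lambda>n. tau n ^ (2 * k) * mu n)"
    proof (rule summable_comparison_cofinite[OF summable_tau_power fin])
      fix n assume n: "n \<notin> {n. 1 / tau n ^ (2 * M) \<le> mu n}"
      have "tau n ^ (2 * k) * mu n \<le> tau n ^ (2 * k) * (1 / tau n ^ (2 * M))"
        using n tau_pos[of n] by (intro mult_left_mono) auto
      also have "\<dots> = 1 / tau n ^ (2 * p + 4)"
      proof -
        have "2 * M = 2 * k + (2 * p + 4)" by (simp add: M_def)
        then show ?thesis
          using tau_pos[of n] by (simp only: power_add) simp
      qed
      finally show "norm (tau n ^ (2 * k) * mu n) \<le> 1 / tau n ^ (2 * p + 4)"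
        using tau_pos[of n] by (simp add: abs_mult)
    qed
    with k show False by simp
  qed
  then show ?thesis using that by blast
qed

section \<open>Moments of all orders from strong localization\<close>

lemma norm_cscale_unit_seq: "norm (cscale a (unit_seq n)) = cmod a"
proof (rule power2_eq_imp_eq)
  have "(norm (cscale a (unit_seq n)))\<^sup>2 = (\<Sum>i\<in>{n}. (cmod (coord (cscale a (unit_seq n)) i))\<^sup>2)"
    unfolding norm_ell2_sq by (rule suminf_finite) auto
  then show "(norm (cscale a (unit_seq n)))\<^sup>2 = (cmod a)\<^sup>2" by simp
qed auto

lemma norm_finite_support:
  assumes "finite F" "\<And>n. n \<notin> F \<Longrightarrow> coord y n = 0"
  shows "norm y \<le> (\<Sum>n\<in>F. cmod (coord y n))"
proof -
  have "y = (\<Sum>n\<in>F. cscale (coord y n) (unit_seq n))"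
  proof (rule ell2_eqI)
    fix m
    show "coord y m = coord (\<Sum>n\<in>F. cscale (coord y n) (unit_seq n)) m"
      using assms by (simp add: if_distrib[of "\<lambda>c. coord y _ * c"] cong: if_cong)
  qed
  also have "norm \<dots> \<le> (\<Sum>n\<in>F. norm (cscale (coord y n) (unit_seq n)))"
    by (rule norm_sum)
  finally show ?thesis
    by (simp only: norm_cscale_unit_seq)
qed

text \<open>At a heavy index n outside the finite support of x, t n is a zero that can be displaced
  to the boundary of its disk. This creates a coefficient of size r n |C(t n)| / sqrt (mu n). The
  heaviness bounds 1 / sqrt (mu n) by tau^M, and M + 1 vanishing moments still leave O(1 / |t
  n|).\<close>

lemma loc_imp_polyL2: polyL2
proof (rule ccontr)
  assume "\<not> polyL2"
  then obtain M where M: "infinite {n. 1 / tau n ^ (2 * M) \<le> mu n}"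
    using polyL2_or_heavy by blast
  obtain L where L: "L > 0" "\<And>n. r n \<le> L" using r_bounded by blast
  define G where "G = {x. finite {n. coord x n \<noteq> 0} \<and> (\<forall>j<Suc M. mom j (res x) = 0)}"
  \<comment> \<open>M + 2 unknowns for M + 1 moment equations, so that \<open>G\<close> contains a
    nonzero vector.\<close>
  obtain \<alpha> where \<alpha>: "\<exists>i\<in>{..Suc M}. \<alpha> i \<noteq> 0"
    "\<forall>j<Suc M. (\<Sum>i\<in>{..Suc M}. \<alpha> i * (of_real (sqrt (mu i)) * t i ^ j)) = 0"
    using homogeneous_nontrivial[of "{..Suc M}" "Suc M" "\<lambda>i j. of_real (sqrt (mu i)) * t i ^ j"] by auto
  define x0 where "x0 = (\<Sum>i\<le>Suc M. cscale (\<alpha> i) (unit_seq i))"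
  have cx0: "coord x0 n = (if n \<le> Suc M then \<alpha> n else 0)" for n
    unfolding x0_def by (simp add: if_distrib[of "\<lambda>c. \<alpha> _ * c"] del: sum.atMost_Suc cong: if_cong)
  have "x0 = 0"
  proof (rule gliding_hump[OF loc_fin range_t_E, where G = G])
    have "mom j (res x0) = (\<Sum>n\<le>Suc M. \<alpha> n * (of_real (sqrt (mu n)) * t n ^ j))" for j
    proof -
      have "mom j (res x0) = (\<Sum>n\<in>{..Suc M}. res x0 n * t n ^ j)"
        by (rule mom_finite) (auto simp: res_def cx0)
      also have "\<dots> = (\<Sum>n\<le>Suc M. \<alpha> n * (of_real (sqrt (mu n)) * t n ^ j))"
        by (intro sum.cong) (auto simp: res_def cx0 mult.assoc)
      finally show ?thesis .
    qed
    moreover have "finite {n. coord x0 n \<noteq> 0}"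
      by (rule finite_subset[of _ "{..Suc M}"]) (auto simp: cx0)
    ultimately show "x0 \<in> G"
      using \<alpha>(2) by (simp add: G_def del: sum.atMost_Suc)
    fix x e R assume x: "x \<in> G" and e: "(e::real) > 0"
    define F where "F = {n. coord x n \<noteq> 0}"
    have F: "finite F" and mom0: "\<And>j. j < Suc M \<Longrightarrow> mom j (res x) = 0"
      using x by (auto simp: G_def F_def)
    have rap: "rapid (res x)"
      by (rule rapid_finite) (rule finite_subset[OF _ F], auto simp: F_def res_def)
    define T where "T = (\<Sum>n\<in>F. cmod (t n))"
    define B where "B = (\<Sum>n\<in>F. cmod (res x n * t n ^ Suc M))"
    define S where "S = (\<Sum>n\<in>F. cmod (coord x n))"
    have pos: "T \<ge> 0" "B \<ge> 0" "S \<ge> 0"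
      by (simp_all add: T_def B_def S_def sum_nonneg)
    \<comment> \<open>The total perturbation will be at most (2 S L + 2^M B L) / |t n|; beyond R1
      this is smaller than e.\<close>
    define R1 where "R1 = (2 * S * L + 2 ^ M * B * L) / e"
    obtain n where n: "1 / tau n ^ (2 * M) \<le> mu n" "n \<notin> F"
      "cmod (t n) > R1 + 2 * T + 2 + L + \<bar>R\<bar>"
    proof -
      have "infinite ({n. 1 / tau n ^ (2 * M) \<le> mu n} - F - {n. cmod (t n) \<le> R1 + 2 * T + 2 + L + \<bar>R\<bar>})"
        using M F finite_t_le by (intro Diff_infinite_finite)
      then have "{n. 1 / tau n ^ (2 * M) \<le> mu n} - F - {n. cmod (t n) \<le> R1 + 2 * T + 2 + L + \<bar>R\<bar>} \<noteq> {}"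
        by (metis finite.emptyI)
      then obtain n where "n \<in> {n. 1 / tau n ^ (2 * M) \<le> mu n} - F - {n. cmod (t n) \<le> R1 + 2 * T + 2 + L + \<bar>R\<bar>}"
        by blast
      then show ?thesis using that[of n] by (simp add: not_le)
    qed
    have "R1 \<ge> 0"
      using pos L(1) e by (simp add: R1_def)
    define h where "h = cmod (t n)"
    have h: "h > R1" "h \<ge> 2 * T + 2" "h \<ge> 1" "h > \<bar>R\<bar> + L"
      using n(3) \<open>R1 \<ge> 0\<close> pos L(1) unfolding h_def by linarith+
    define w where "w = t n + of_real (r n)"
    have w: "cmod (w - t n) = r n" "cmod (t n - w) = r n"
      using r_pos[of n] by (simp_all add: w_def)
    define y where "y = move x (t n) w"
    have xn: "coord x n = 0" using n(2) by (simp add: F_def)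
    have Phi0: "Phi x (t n) = 0" by (simp add: xn)
    have far: "h / 2 \<le> cmod (t m - t n)" "1 \<le> cmod (t m - t n)" if "m \<in> F" for m
    proof -
      have "cmod (t m) \<le> T"
        unfolding T_def using that F by (intro member_le_sum) auto
      moreover have "h - cmod (t m) \<le> cmod (t m - t n)"
        using norm_triangle_ineq2[of "t n" "t m"] by (simp add: h_def norm_minus_commute)
      ultimately show "h / 2 \<le> cmod (t m - t n)" "1 \<le> cmod (t m - t n)"
        using h pos by linarith+
    qed
    have d1: "cmod (coord (y - x) m) \<le> cmod (coord x m) * (2 * L / h)" if "m \<in> F" for m
    proof -
      have "m \<noteq> n" using that n(2) by auto
      then have "coord (y - x) m = coord x m * ((t n - w) / (t m - t n))"
        using coord_move_diff[of m "t n" x w] by (simp add: y_def)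
      moreover have "r n / cmod (t m - t n) \<le> L / (h / 2)"
        using far(1)[OF that] h(3) L(2)[of n] L(1) by (intro frac_le) auto
      then have "cmod (coord x m) * (r n / cmod (t m - t n)) \<le> cmod (coord x m) * (L / (h / 2))"
        by (intro mult_left_mono) auto
      ultimately show ?thesis
        by (simp add: norm_mult norm_divide w mult.commute)
    qed
    have d0: "coord (y - x) m = 0" if "m \<notin> F" "m \<noteq> n" for m
      using that coord_move[of m "t n" x w] by (simp add: y_def F_def)
    \<comment> \<open>Vanishing moments turn h^(M + 1) C(t n) into a transform bounded by B, as the
      support is at distance at least 1; dividing by sqrt (mu n) costs only (2 h)^M.\<close>
    have dn: "cmod (coord (y - x) n) \<le> 2 ^ M * B * L / h"
    proof -
      have "t n ^ Suc M * cauchy (res x) (t n) = cauchy (\<lambda>m. res x m * t m ^ Suc M) (t n)"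
        by (rule cauchy_moments[OF rap]) (auto simp: res_def xn mom0)
      also have "\<dots> = (\<Sum>m\<in>F. res x m * t m ^ Suc M / (t n - t m))"
        by (rule cauchy_finite[OF F]) (simp add: F_def res_def)
      also have "cmod \<dots> \<le> (\<Sum>m\<in>F. cmod (res x m * t m ^ Suc M))"
      proof (rule sum_norm_le)
        fix m assume "m \<in> F"
        have "cmod (res x m * t m ^ Suc M) / cmod (t n - t m) \<le> cmod (res x m * t m ^ Suc M) / 1"
          using far(2)[OF \<open>m \<in> F\<close>] by (intro divide_left_mono) (auto simp: norm_minus_commute)
        then show "cmod (res x m * t m ^ Suc M / (t n - t m)) \<le> cmod (res x m * t m ^ Suc M)"
          by (simp only: norm_divide div_by_1)
      qed
      finally have C: "h ^ Suc M * cmod (cauchy (res x) (t n)) \<le> B"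
        by (simp only: B_def norm_mult norm_power h_def)
      have "1 / tau n ^ M \<le> sqrt (mu n)"
        using n(1) tau_pos[of n] by (intro real_le_rsqrt) (simp add: power_divide power_mult mult.commute[of 2])
      then have "1 / sqrt (mu n) \<le> tau n ^ M"
        using tau_pos[of n] by (simp add: field_simps)
      also have "\<dots> \<le> (2 * h) ^ M"
        using h(3) tau_pos[of n] by (intro power_mono) (auto simp: tau_def h_def)
      finally have mu: "1 / sqrt (mu n) \<le> (2 * h) ^ M" .
      have "cmod (coord (y - x) n) = r n * (cmod (cauchy (res x) (t n)) * (1 / sqrt (mu n)))"
        by (simp add: y_def move_def coord_quot norm_mult norm_divide w)
      also have "\<dots> \<le> L * ((B / h ^ Suc M) * (2 * h) ^ M)"
        using L r_pos[of n] mu C h(3) pos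
        by (intro mult_mono) (auto simp: field_simps)
      also have "\<dots> = 2 ^ M * B * L / h"
        using h(3) by (simp add: power_mult_distrib field_simps)
      finally show ?thesis .
    qed
    have "norm (y - x) \<le> (\<Sum>m\<in>insert n F. cmod (coord (y - x) m))"
      by (rule norm_finite_support) (use F d0 in auto)
    also have "\<dots> = cmod (coord (y - x) n) + (\<Sum>m\<in>F. cmod (coord (y - x) m))"
      using F n(2) by simp
    also have "\<dots> \<le> 2 ^ M * B * L / h + (\<Sum>m\<in>F. cmod (coord x m) * (2 * L / h))"
      by (intro add_mono dn sum_mono d1)
    also have "\<dots> = 2 ^ M * B * L / h + S * (2 * L / h)"
      by (simp only: S_def sum_distrib_right)
    also have "\<dots> = (2 * S * L + 2 ^ M * B * L) / h"
      by (simp add: add_divide_distrib mult_ac)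
    also have "\<dots> < e"
      using h(1,3) e by (simp add: R1_def field_simps)
    finally have small: "norm (y - x) < e" .
    have "finite {m. coord y m \<noteq> 0}"
    proof (rule finite_subset)
      show "{m. coord y m \<noteq> 0} \<subseteq> insert n F"
        using d0 by (auto simp: F_def)
    qed (use F in simp)
    then have "y \<in> G"
      using mom_move[OF rap Phi0] mom0 by (simp add: G_def y_def)
    moreover have "cmod w > R"
    proof -
      have "h - cmod w \<le> L"
        using norm_triangle_ineq2[of "t n" w] w L(2)[of n] by (simp add: h_def)
      then show ?thesis using h(4) by linarith
    qed
    moreover have "w \<notin> E" by (rule boundary_not_E[OF w(1)])
    moreover have "Phi y w = 0"
      unfolding y_def by (rule Phi_move_zero[OF Phi0])
    moreover have "Phi y v = 0" if "cmod v \<le> R" "Phi x v = 0" for v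
      unfolding y_def using that h(4) L(1) by (intro Phi_move_keep[OF Phi0]) (auto simp: h_def)
    ultimately show "\<exists>y\<in>G. \<exists>w. norm (y - x) < e \<and> cmod w > R \<and> w \<notin> E \<and>
        Phi y w = 0 \<and> (\<forall>v. cmod v \<le> R \<longrightarrow> Phi x v = 0 \<longrightarrow> Phi y v = 0)"
      using small by blast
  qed
  then have "\<alpha> i = 0" if "i \<le> Suc M" for i
    using cx0[of i] that by simp
  then show False
    using \<alpha>(1) by auto
qed

section \<open>Displacing zeros of vectors with rapidly decaying coefficients\<close>

definition rapid2 :: "nat \<Rightarrow> ell2 \<Rightarrow> bool" where
  "rapid2 q x \<longleftrightarrow> summable (\<lambda>n. (cmod (coord x n) * tau n ^ q)\<^sup>2)"

lemma rapid2_le: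
  assumes "rapid2 q x" "\<And>n. cmod (coord y n) \<le> K * cmod (coord x n)"
  shows "rapid2 q y"
  unfolding rapid2_def
proof (rule summable_comparison_test'[where N = 0])
  show "summable (\<lambda>n. K\<^sup>2 * (cmod (coord x n) * tau n ^ q)\<^sup>2)"
    using assms(1) unfolding rapid2_def by (rule summable_mult)
  fix n
  have "cmod (coord y n) * tau n ^ q \<le> K * cmod (coord x n) * tau n ^ q"
    using assms(2) tau_pos[of n] by (intro mult_right_mono) auto
  then have "(cmod (coord y n) * tau n ^ q)\<^sup>2 \<le> (K * cmod (coord x n) * tau n ^ q)\<^sup>2"
    using tau_pos[of n] by (intro power_mono) auto
  then show "norm ((cmod (coord y n) * tau n ^ q)\<^sup>2) \<le> K\<^sup>2 * (cmod (coord x n) * tau n ^ q)\<^sup>2"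
    by (simp add: power_mult_distrib mult.assoc)
qed

text \<open>Dominated convergence for series. Up to a constant the weight \<open>tau n ^ q\<close>
  is 1 / \<open>rho q n\<close>, the worst factor produced by displacing a zero at distance
  \<open>rho q n\<close> from t n; hence the definition of \<open>rapid2\<close>.\<close>

lemma perturbation_tendsto:
  assumes "rapid2 q x" "\<And>i n. cmod (coord (Y i) n - coord x n) \<le> L * (cmod (coord x n) * tau n ^ q)"
    and "\<And>n. (\<lambda>i. coord (Y i) n - coord x n) \<longlonglongrightarrow> 0"
  shows "(\<lambda>i. norm (Y i - x)) \<longlonglongrightarrow> 0"
proof -
  have "((\<lambda>i. \<Sum>n. (cmod (coord (Y i) n - coord x n))\<^sup>2) \<longlonglongrightarrow> (\<Sum>n. 0))"
  proof (rule tannerys_theorem[THEN conjunct2, THEN conjunct2])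
    show "((\<lambda>i. (cmod (coord (Y i) n - coord x n))\<^sup>2) \<longlonglongrightarrow> 0)" for n
      using tendsto_power[OF tendsto_norm_zero[OF assms(3)[of n]], of 2] by simp
    show "summable (\<lambda>n. L\<^sup>2 * (cmod (coord x n) * tau n ^ q)\<^sup>2)"
      using assms(1) unfolding rapid2_def by (rule summable_mult)
    have "norm ((cmod (coord (Y i) n - coord x n))\<^sup>2) \<le> L\<^sup>2 * (cmod (coord x n) * tau n ^ q)\<^sup>2" for i n
      using power_mono[OF assms(2)[of i n], of 2] by (simp add: power_mult_distrib)
    then show "\<forall>\<^sub>F (n, i) in at_top \<times>\<^sub>F sequentially.
        norm ((cmod (coord (Y i) n - coord x n))\<^sup>2) \<le> L\<^sup>2 * (cmod (coord x n) * tau n ^ q)\<^sup>2"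
      by (intro always_eventually) auto
  qed simp
  then have "(\<lambda>i. sqrt ((norm (Y i - x))\<^sup>2)) \<longlonglongrightarrow> sqrt 0"
    unfolding norm_diff_sq by (intro tendsto_real_sqrt) simp
  then show ?thesis by simp
qed

lemma far_tendsto:
  assumes "\<And>i. cmod (s i) > real i"
  shows "(\<lambda>i. K / cmod (a - s i)) \<longlonglongrightarrow> 0"
proof -
  have "filterlim (\<lambda>i. - cmod a + real i) at_top sequentially"
    by (intro filterlim_tendsto_add_at_top[OF tendsto_const] filterlim_real_sequentially)
  then have "filterlim (\<lambda>i. cmod (a - s i)) at_top sequentially"
  proof (rule filterlim_at_top_mono)
    have "- cmod a + real i \<le> cmod (a - s i)" for i
      using assms[of i] norm_triangle_ineq2[of "s i" a] by (simp add: norm_minus_commute)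
    then show "\<forall>\<^sub>F i in sequentially. - cmod a + real i \<le> cmod (a - s i)" by simp
  qed
  then show ?thesis
    by (intro tendsto_divide_0[OF tendsto_const] filterlim_at_top_imp_at_infinity)
qed

lemma ratio_bounded:
  obtains K where "K > 0" "\<And>n. t n \<noteq> s \<Longrightarrow> cmod ((t n - w) / (t n - s)) \<le> K"
proof -
  obtain \<kappa> where k: "\<kappa> > 0" "\<And>n. t n \<noteq> s \<Longrightarrow> \<kappa> * tau n \<le> cmod (s - t n)"
    using t_lower by blast
  have "cmod ((t n - w) / (t n - s)) \<le> 1 + cmod (s - w) / \<kappa>" if "t n \<noteq> s" for n
  proof -
    have "\<kappa> * 1 \<le> \<kappa> * tau n"
      using k(1) tau_ge_1[of n] by (intro mult_left_mono) auto
    then have "\<kappa> \<le> cmod (t n - s)"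
      using k(2)[OF that] by (simp add: norm_minus_commute)
    then have "cmod (s - w) / cmod (t n - s) \<le> cmod (s - w) / \<kappa>"
      using k(1) by (intro frac_le) auto
    moreover have "(t n - w) / (t n - s) = 1 + (s - w) / (t n - s)"
      using that by (simp add: field_simps)
    ultimately show ?thesis
      using norm_triangle_ineq[of 1 "(s - w) / (t n - s)"] by (simp add: norm_divide)
  qed
  moreover have "1 + cmod (s - w) / \<kappa> > 0"
    using k(1) by (simp add: add_pos_nonneg)
  ultimately show ?thesis using that by blast
qed

lemma inverse_rho: "1 / rho q n = (4 / C) * tau n ^ q"
  using C_pos by (simp add: rho_def)

text \<open>Displacing a far zero s by at most L changes the n-th coefficient by the relative amount
  L / |t n - s| at most. For each n this tends to 0 as s goes to infinity, and for zeros off the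
  disks it is bounded by a multiple of tau^q, so some displacement is small enough for the gliding
  hump.\<close>

lemma zeros_off_bounded:
  assumes x: "rapid2 q x" and unb: "\<And>R. \<exists>s. cmod s > R \<and> Phi x s = 0 \<and> off q s"
  shows "x = 0"
proof -
  obtain L where L: "L > 0" "\<And>s. \<exists>w. w \<notin> E \<and> cmod (s - w) \<le> L" using find_w by blast
  define G where "G = {x. rapid2 q x \<and> (\<forall>R. \<exists>s. cmod s > R \<and> Phi x s = 0 \<and> off q s)}"
  show ?thesis
  proof (rule gliding_hump[OF loc_fin range_t_E, where G = G])
    show "x \<in> G" using x unb by (simp add: G_def)
    fix x e R assume x: "x \<in> G" and e: "(e::real) > 0"
    have "\<forall>i. \<exists>s. cmod s > real i + \<bar>R\<bar> + L \<and> Phi x s = 0 \<and> off q s"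
      using x by (simp add: G_def)
    then obtain s where s: "\<And>i. cmod (s i) > real i + \<bar>R\<bar> + L" "\<And>i. Phi x (s i) = 0" "\<And>i. off q (s i)"
      by metis
    have "\<forall>i. \<exists>w. w \<notin> E \<and> cmod (s i - w) \<le> L"
      using L(2) by blast
    from choice[OF this] obtain w where w: "\<And>i. w i \<notin> E" "\<And>i. cmod (s i - w i) \<le> L"
      by blast
    define Y where "Y i = move x (s i) (w i)" for i
    have big: "cmod (s i) > real i" for i using s(1)[of i] L(1) by linarith
    have ts: "t n \<noteq> s i" for n i using off_not_t[OF s(3)[of i]] by (metis rangeI)
    have diff: "cmod (coord (Y i) n - coord x n) \<le> cmod (coord x n) * (L / cmod (t n - s i))" for i n
    proof -
      have "cmod (s i - w i) / cmod (t n - s i) \<le> L / cmod (t n - s i)"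
        using w(2) by (intro divide_right_mono) auto
      then show ?thesis
        unfolding Y_def coord_move_diff[OF ts] norm_mult norm_divide by (intro mult_left_mono) auto
    qed
    have "(\<lambda>i. norm (Y i - x)) \<longlonglongrightarrow> 0"
    proof (rule perturbation_tendsto)
      show "rapid2 q x" using x by (simp add: G_def)
      show "cmod (coord (Y i) n - coord x n) \<le> (L * (4 / C)) * (cmod (coord x n) * tau n ^ q)" for i n
      proof -
        have "L / cmod (t n - s i) \<le> L / rho q n"
          using L(1) rho_pos[of q n] s(3)[of i] by (intro frac_le) (auto simp: off_def norm_minus_commute)
        also have "\<dots> = L * (1 / rho q n)"
          by simp
        also have "\<dots> = L * ((4 / C) * tau n ^ q)"
          by (simp only: inverse_rho)
        finally have "cmod (coord x n) * (L / cmod (t n - s i)) \<le> cmod (coord x n) * (L * ((4 / C) * tau n ^ q))"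
          by (intro mult_left_mono) auto
        then show ?thesis
          using diff[of i n] by (simp add: mult_ac)
      qed
      show "(\<lambda>i. coord (Y i) n - coord x n) \<longlonglongrightarrow> 0" for n
      proof (rule Lim_null_comparison)
        show "(\<lambda>i. cmod (coord x n) * (L / cmod (t n - s i))) \<longlonglongrightarrow> 0"
          by (intro tendsto_mult_right_zero far_tendsto big)
      qed (use diff in simp)
    qed
    then obtain i where i: "norm (Y i - x) < e"
      using e by (metis (no_types, lifting) eventually_happens' order_tendstoD(2) trivial_limit_sequentially)
    have "Y i \<in> G"
      unfolding G_def
    proof (intro CollectI conjI allI)
      obtain K where K: "K > 0" "\<And>n. t n \<noteq> s i \<Longrightarrow> cmod ((t n - w i) / (t n - s i)) \<le> K"
        using ratio_bounded by blast
      show "rapid2 q (Y i)"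
      proof (rule rapid2_le)
        show "rapid2 q x" using x by (simp add: G_def)
        show "cmod (coord (Y i) n) \<le> K * cmod (coord x n)" for n
          using mult_left_mono[OF K(2)[OF ts[of n i]], of "cmod (coord x n)"]
          unfolding Y_def coord_move[OF ts] norm_mult by (simp add: mult.commute)
      qed
      fix R'
      obtain z where z: "cmod z > max R' (cmod (s i))" "Phi x z = 0" "off q z"
        using x unfolding G_def by blast
      then have "Phi (Y i) z = 0"
        unfolding Y_def by (intro Phi_move_keep s) auto
      then show "\<exists>z. cmod z > R' \<and> Phi (Y i) z = 0 \<and> off q z"
        using z by auto
    qed
    moreover have "cmod (w i) > R"
      using s(1)[of i] w(2)[of i] norm_triangle_ineq2[of "s i" "w i"] by linarith
    moreover have "Phi (Y i) (w i) = 0"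
      unfolding Y_def by (rule Phi_move_zero[OF s(2)])
    moreover have "Phi (Y i) v = 0" if "cmod v \<le> R" "Phi x v = 0" for v
      unfolding Y_def using that s(1)[of i] L(1) by (intro Phi_move_keep s) auto
    ultimately show "\<exists>y\<in>G. \<exists>w. norm (y - x) < e \<and> cmod w > R \<and> w \<notin> E \<and>
        Phi y w = 0 \<and> (\<forall>v. cmod v \<le> R \<longrightarrow> Phi x v = 0 \<longrightarrow> Phi y v = 0)"
      using i w(1) by blast
  qed
qed

text \<open>Of two zeros close to t k one is moved into t k, which removes the k-th coefficient, so that
  the other one can be moved away although it may be arbitrarily close to t k.\<close>

lemma double_zeros_bounded:
  assumes "p \<le> q" and x: "rapid2 q x"
    and unb: "\<And>R. \<exists>k s s'. cmod (t k) > R \<and> s \<noteq> s' \<and> s' \<noteq> t k \<and> cmod (s - t k) < rho q k \<and>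
      cmod (s' - t k) < rho q k \<and> Phi x s = 0 \<and> Phi x s' = 0"
  shows "x = 0"
proof -
  obtain L where L: "L > 0" "\<And>s. \<exists>w. w \<notin> E \<and> cmod (s - w) \<le> L" using find_w by blast
  define D where "D x R k s s' \<longleftrightarrow> cmod (t k) > R \<and> s \<noteq> s' \<and> s' \<noteq> t k \<and> cmod (s - t k) < rho q k \<and>
      cmod (s' - t k) < rho q k \<and> Phi x s = 0 \<and> Phi x s' = 0" for x R k s s'
  define G where "G = {x. rapid2 q x \<and> (\<forall>R. \<exists>k s s'. D x R k s s')}"
  show ?thesis
  proof (rule gliding_hump[OF loc_fin range_t_E, where G = G])
    show "x \<in> G" using x unb by (simp add: G_def D_def)
    fix x e R assume x: "x \<in> G" and e: "(e::real) > 0"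
    have "\<forall>i. \<exists>k s s'. D x (real i + \<bar>R\<bar> + L + 1) k s s'"
      using x by (simp add: G_def)
    then obtain k s s' where D: "\<And>i. D x (real i + \<bar>R\<bar> + L + 1) (k i) (s i) (s' i)"
      by metis
    have ks: "cmod (t (k i)) > real i + \<bar>R\<bar> + L + 1" "s i \<noteq> s' i" "s' i \<noteq> t (k i)" "cmod (s i - t (k i)) < rho q (k i)"
      "cmod (s' i - t (k i)) < rho q (k i)" "Phi x (s i) = 0" "Phi x (s' i) = 0" for i
      using D[of i] by (auto simp: D_def)
    have sbig: "cmod (s i) > real i + \<bar>R\<bar> + L" "cmod (s' i) > real i + \<bar>R\<bar> + L" for i
      using ks(1,4,5)[of i] rho_le_quarter[of q "k i"] norm_triangle_ineq2[of "t (k i)" "s i"]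
        norm_triangle_ineq2[of "t (k i)" "s' i"] by (simp_all add: norm_minus_commute)
    then have big: "cmod (s i) > real i" "cmod (s' i) > real i" for i
      using L(1) by (smt (verit))+
    have "\<forall>i. \<exists>w. w \<notin> E \<and> cmod (s' i - w) \<le> L"
      using L(2) by blast
    from choice[OF this] obtain w where w: "\<And>i. w i \<notin> E" "\<And>i. cmod (s' i - w i) \<le> L"
      by blast
    \<comment> \<open>s is moved into t k, then s' out to w. The condition s' \<noteq> t k in
      \<open>D\<close> lets the zero created at t k survive the second move.\<close>
    define X where "X i = move x (s i) (t (k i))" for i
    define Y where "Y i = move (X i) (s' i) (w i)" for i
    have PhiX: "Phi (X i) (s' i) = 0" "Phi (X i) (t (k i)) = 0" for i
      unfolding X_def by (intro Phi_move_keep Phi_move_zero ks, metis ks(2)) (intro Phi_move_zero ks)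
    have far: "rho q n \<le> cmod (t n - s' i)" "cmod (s i - t (k i)) \<le> cmod (t n - s i)" "t n \<noteq> s i" "t n \<noteq> s' i"
      if "n \<noteq> k i" for n i
      using near_far[OF \<open>p \<le> q\<close> that, of "s i"] near_far[OF \<open>p \<le> q\<close> that, of "s' i"] ks(4,5)[of i]
      by (auto simp: norm_minus_commute)
    have Yk: "coord (Y i) (k i) = 0" for i
      using PhiX(2)[of i] ks(3)[of i] unfolding Y_def by (subst coord_move) auto
    have Yn: "coord (Y i) n = coord x n * ((t n - t (k i)) / (t n - s i)) * ((t n - w i) / (t n - s' i))"
      if "n \<noteq> k i" for n i
      unfolding Y_def X_def by (simp only: coord_move[OF far(4)[OF that]] coord_move[OF far(3)[OF that]])
    have diff: "cmod (coord (Y i) n - coord x n) \<le> cmod (coord x n) * ((1 / 4) / cmod (t n - s i) + 2 * (L / cmod (t n - s' i)))"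
      and alpha: "cmod (coord (Y i) n - coord x n) \<le> cmod (coord x n) * (1 + 2 * (L / cmod (t n - s' i)))"
      if n: "n \<noteq> k i" for n i
    proof -
      \<comment> \<open>\<alpha> and \<beta> are the relative changes in the two moves. |\<alpha>|
        <= 1 because t n is at least as far from s as t k is, so only \<beta> calls for the weight
        tau^q.\<close>
      define \<alpha> where "\<alpha> = (s i - t (k i)) / (t n - s i)"
      define \<beta> where "\<beta> = (s' i - w i) / (t n - s' i)"
      have \<alpha>: "cmod \<alpha> \<le> 1"
        using far(2)[OF n] by (simp add: \<alpha>_def norm_divide divide_le_eq_1)
      have \<alpha>': "cmod \<alpha> \<le> (1 / 4) / cmod (t n - s i)"
        unfolding \<alpha>_def norm_divide using ks(4)[of i] rho_le_quarter[of q "k i"]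
        by (intro divide_right_mono) auto
      have \<beta>: "cmod \<beta> \<le> L / cmod (t n - s' i)"
        unfolding \<beta>_def norm_divide using w(2) by (intro divide_right_mono) auto
      have "(t n - t (k i)) / (t n - s i) = 1 + \<alpha>" "(t n - w i) / (t n - s' i) = 1 + \<beta>"
        using far(3,4)[OF n] by (simp_all add: \<alpha>_def \<beta>_def field_simps)
      then have eq: "coord (Y i) n - coord x n = coord x n * (\<alpha> + \<beta> + \<alpha> * \<beta>)"
        by (simp add: Yn[OF n] algebra_simps)
      have "cmod (\<alpha> + \<beta> + \<alpha> * \<beta>) \<le> cmod \<alpha> + cmod \<beta> + cmod \<alpha> * cmod \<beta>"
        by (rule order_trans[OF norm_triangle_ineq]) (simp add: norm_mult norm_triangle_ineq)
      also have "cmod \<alpha> * cmod \<beta> \<le> 1 * cmod \<beta>"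
        using \<alpha> by (intro mult_right_mono) auto
      finally have *: "cmod (\<alpha> + \<beta> + \<alpha> * \<beta>) \<le> cmod \<alpha> + 2 * cmod \<beta>" by simp
      show "cmod (coord (Y i) n - coord x n) \<le> cmod (coord x n) * ((1 / 4) / cmod (t n - s i) + 2 * (L / cmod (t n - s' i)))"
        unfolding eq norm_mult using * \<alpha>' \<beta> by (intro mult_left_mono) auto
      show "cmod (coord (Y i) n - coord x n) \<le> cmod (coord x n) * (1 + 2 * (L / cmod (t n - s' i)))"
        unfolding eq norm_mult using * \<alpha> \<beta> by (intro mult_left_mono) auto
    qed
    have "(\<lambda>i. norm (Y i - x)) \<longlonglongrightarrow> 0"
    proof (rule perturbation_tendsto)
      show "rapid2 q x" using x by (simp add: G_def)
      show "cmod (coord (Y i) n - coord x n) \<le> ((1 + 2 * L) * (4 / C)) * (cmod (coord x n) * tau n ^ q)" for i n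
      proof -
        have one: "1 \<le> 1 / rho q n"
          using rho_pos[of q n] rho_le_quarter[of q n] by (simp add: field_simps)
        have "cmod (coord (Y i) n - coord x n) \<le> cmod (coord x n) * ((1 + 2 * L) * (1 / rho q n))"
        proof (cases "n = k i")
          case True
          have "1 * 1 \<le> (1 + 2 * L) * (1 / rho q n)"
            using one L(1) by (intro mult_mono) auto
          then have "cmod (coord x n) * 1 \<le> cmod (coord x n) * ((1 + 2 * L) * (1 / rho q n))"
            by (intro mult_left_mono) auto
          then show ?thesis
            using True by (simp add: Yk)
        next
          case False
          have "L / cmod (t n - s' i) \<le> L / rho q n"
            using L(1) rho_pos[of q n] far(1)[OF False] by (intro frac_le) auto
          then have "1 + 2 * (L / cmod (t n - s' i)) \<le> 1 / rho q n + 2 * (L / rho q n)"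
            using one by linarith
          also have "\<dots> = (1 + 2 * L) * (1 / rho q n)"
            by (simp add: add_divide_distrib)
          finally have "cmod (coord x n) * (1 + 2 * (L / cmod (t n - s' i))) \<le> cmod (coord x n) * ((1 + 2 * L) * (1 / rho q n))"
            by (intro mult_left_mono) auto
          then show ?thesis
            using alpha[OF False] by linarith
        qed
        then show ?thesis
          unfolding inverse_rho by (simp only: mult_ac)
      qed
      show "(\<lambda>i. coord (Y i) n - coord x n) \<longlonglongrightarrow> 0" for n
      proof (rule Lim_null_comparison)
        have "n \<noteq> k i" if "cmod (t n) \<le> real i" for i
          using that ks(1)[of i] L(1) by (smt (verit))
        then have "cmod (coord (Y i) n - coord x n) \<le> cmod (coord x n) * ((1 / 4) / cmod (t n - s i) + 2 * (L / cmod (t n - s' i)))"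
          if "cmod (t n) \<le> real i" for i
          using that diff by blast
        moreover have "\<forall>\<^sub>F i in sequentially. cmod (t n) \<le> real i"
          using filterlim_real_sequentially by (simp add: filterlim_at_top)
        ultimately show "\<forall>\<^sub>F i in sequentially. norm (coord (Y i) n - coord x n) \<le>
            cmod (coord x n) * ((1 / 4) / cmod (t n - s i) + 2 * (L / cmod (t n - s' i)))"
          by (auto elim: eventually_mono)
        have "(\<lambda>i. cmod (coord x n) * ((1 / 4) / cmod (t n - s i) + 2 * (L / cmod (t n - s' i)))) \<longlonglongrightarrow>
            cmod (coord x n) * (0 + 2 * 0)"
          by (intro tendsto_mult tendsto_add tendsto_const far_tendsto big)
        then show "(\<lambda>i. cmod (coord x n) * ((1 / 4) / cmod (t n - s i) + 2 * (L / cmod (t n - s' i)))) \<longlonglongrightarrow> 0"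
          by simp
      qed
    qed
    then obtain i where i: "norm (Y i - x) < e"
      using e by (metis (no_types, lifting) eventually_happens' order_tendstoD(2) trivial_limit_sequentially)
    have keep: "Phi (Y i) z = 0" if "Phi x z = 0" "z \<noteq> s i" "z \<noteq> s' i" for z
      unfolding Y_def using that(3)
      by (intro Phi_move_keep PhiX) (auto simp: X_def intro!: Phi_move_keep ks that)
    have "Y i \<in> G"
      unfolding G_def
    proof (intro CollectI conjI allI)
      obtain K where K: "K > 0" "\<And>n. t n \<noteq> s i \<Longrightarrow> cmod ((t n - t (k i)) / (t n - s i)) \<le> K"
        using ratio_bounded by blast
      obtain K' where K': "K' > 0" "\<And>n. t n \<noteq> s' i \<Longrightarrow> cmod ((t n - w i) / (t n - s' i)) \<le> K'"
        using ratio_bounded by blast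
      show "rapid2 q (Y i)"
      proof (rule rapid2_le)
        show "rapid2 q x" using x by (simp add: G_def)
        show "cmod (coord (Y i) n) \<le> (K * K') * cmod (coord x n)" for n
        proof (cases "n = k i")
          case True
          then show ?thesis using K(1) K'(1) by (simp add: Yk)
        next
          case False
          have "cmod (coord x n) * cmod ((t n - t (k i)) / (t n - s i)) * cmod ((t n - w i) / (t n - s' i))
              \<le> cmod (coord x n) * K * K'"
            using K(2)[OF far(3)[OF False]] K'(2)[OF far(4)[OF False]] K(1) by (intro mult_mono) auto
          then show ?thesis
            unfolding Yn[OF False] norm_mult by (simp only: mult_ac)
        qed
      qed
      fix R'
      obtain k1 z z' where z: "D x (max R' (cmod (t (k i)))) k1 z z'"
        using x unfolding G_def by blast
      then have "k1 \<noteq> k i" by (auto simp: D_def)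
      have ne: "v \<noteq> s i" "v \<noteq> s' i" if "cmod (v - t k1) < rho q k1" for v
        using near_far(2)[OF \<open>p \<le> q\<close> \<open>k1 \<noteq> k i\<close>, of v] that ks(4,5)[of i] by auto
      have "D (Y i) R' k1 z z'"
        using z ne keep by (auto simp: D_def)
      then show "\<exists>k s s'. D (Y i) R' k s s'" by blast
    qed
    moreover have "cmod (w i) > R"
      using sbig(2)[of i] w(2)[of i] norm_triangle_ineq2[of "s' i" "w i"] by linarith
    moreover have "Phi (Y i) (w i) = 0"
      unfolding Y_def by (rule Phi_move_zero[OF PhiX(1)])
    moreover have "Phi (Y i) v = 0" if "cmod v \<le> R" "Phi x v = 0" for v
      using that sbig[of i] L(1) by (intro keep) auto
    ultimately show "\<exists>y\<in>G. \<exists>w. norm (y - x) < e \<and> cmod w > R \<and> w \<notin> E \<and>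
        Phi y w = 0 \<and> (\<forall>v. cmod v \<le> R \<longrightarrow> Phi x v = 0 \<longrightarrow> Phi y v = 0)"
      using i w(1) by blast
  qed
qed

text \<open>The localizing disk of n contains a zero s, which for large n lies within
  \<open>rho q k\<close> of some t k, as only bounded zeros are \<open>off\<close>. If k were not n,
  disjointness would put s outside the localizing disk of k, making that disk the smaller one; its
  own zero s' would be a second zero within \<open>rho q k\<close> of t k.\<close>

lemma zeros_near_t:
  assumes "p \<le> q" "rapid2 q x" "x \<noteq> 0"
  shows "\<forall>\<^sub>F n in sequentially. \<exists>s. Phi x s = 0 \<and> cmod (s - t n) < rho q n"
proof (rule ccontr)
  assume neg: "\<not> ?thesis"
  have "\<not> (\<forall>R. \<exists>s. cmod s > R \<and> Phi x s = 0 \<and> off q s)"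
    using zeros_off_bounded[OF assms(2)] assms(3) by blast
  then obtain R1 where R1: "\<And>s. Phi x s = 0 \<Longrightarrow> off q s \<Longrightarrow> cmod s \<le> R1"
    unfolding not_all not_ex by (auto simp: not_less)
  have "\<not> (\<forall>R. \<exists>k s s'. cmod (t k) > R \<and> s \<noteq> s' \<and> s' \<noteq> t k \<and> cmod (s - t k) < rho q k \<and>
      cmod (s' - t k) < rho q k \<and> Phi x s = 0 \<and> Phi x s' = 0)"
    using double_zeros_bounded[OF assms(1,2)] assms(3) by blast
  then obtain R2 where R2: "\<And>k s s'. cmod (t k) > R2 \<Longrightarrow> s \<noteq> s' \<Longrightarrow> s' \<noteq> t k \<Longrightarrow> cmod (s - t k) < rho q k \<Longrightarrow>
      cmod (s' - t k) < rho q k \<Longrightarrow> Phi x s = 0 \<Longrightarrow> Phi x s' = 0 \<Longrightarrow> False"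
    unfolding not_all by blast
  \<comment> \<open>At most one of s and s' equals t k, so exchanging them removes the asymmetric
    condition s' \<noteq> t k.\<close>
  have R2': False if "cmod (t k) > R2" "s \<noteq> s'" "cmod (s - t k) < rho q k" "cmod (s' - t k) < rho q k"
    "Phi x s = 0" "Phi x s' = 0" for k s s'
    using R2[of k s s'] R2[of k s' s] that by metis
  obtain n0 where n0: "\<And>n. n \<ge> n0 \<Longrightarrow> \<exists>z\<in>ball (t n) (r n). Phi x z = 0"
    using loc_zero[OF assms(3)] by (auto simp: eventually_sequentially)
  obtain L where L: "L > 0" "\<And>n. r n \<le> L" using r_bounded by blast
  \<comment> \<open>A value |t k| > T forces k >= n0, so that the disk of k has a zero too.\<close>
  define T where "T = (\<Sum>n<n0. cmod (t n))"
  have "T \<ge> 0" by (simp add: T_def sum_nonneg)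
  define B where "B = \<bar>R1\<bar> + \<bar>R2\<bar> + T + L + 1"
  have ev: "\<forall>\<^sub>F n in sequentially. cmod (t n) > B \<and> n \<ge> n0"
    using t_lim by (intro eventually_conj eventually_ge_at_top) (simp add: filterlim_at_top_dense)
  have "\<exists>n. (cmod (t n) > B \<and> n \<ge> n0) \<and> \<not> (\<exists>s. Phi x s = 0 \<and> cmod (s - t n) < rho q n)"
  proof (rule ccontr)
    assume "\<not> ?thesis"
    then have "\<And>n. cmod (t n) > B \<and> n \<ge> n0 \<Longrightarrow> \<exists>s. Phi x s = 0 \<and> cmod (s - t n) < rho q n"
      by blast
    with ev have "\<forall>\<^sub>F n in sequentially. \<exists>s. Phi x s = 0 \<and> cmod (s - t n) < rho q n"
      by (rule eventually_mono)
    then show False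
      using neg by blast
  qed
  then obtain n where n: "cmod (t n) > B" "n \<ge> n0" "\<And>s. Phi x s = 0 \<Longrightarrow> \<not> cmod (s - t n) < rho q n"
    by blast
  obtain s where s: "cmod (s - t n) < r n" "Phi x s = 0"
    using n0[OF n(2)] by (auto simp: dist_norm norm_minus_commute)
  have sn: "cmod s > \<bar>R1\<bar> + \<bar>R2\<bar> + T + 1"
    using s(1) L(2)[of n] n(1) norm_triangle_ineq2[of "t n" s] by (simp add: B_def norm_minus_commute)
  then have "\<not> off q s"
    using R1[OF s(2)] \<open>T \<ge> 0\<close> by linarith
  then obtain k where k: "cmod (s - t k) < rho q k"
    by (auto simp: off_def not_le)
  then have "k \<noteq> n" using n(3)[OF s(2)] by auto
  have tk: "cmod (t k) > \<bar>R2\<bar> + T"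
    using k rho_le_quarter[of q k] sn norm_triangle_ineq2[of s "t k"] by linarith
  have "k \<ge> n0"
  proof (rule ccontr)
    assume "\<not> k \<ge> n0"
    then have "cmod (t k) \<le> T"
      unfolding T_def by (intro member_le_sum) auto
    then show False using tk by linarith
  qed
  then obtain s' where s': "cmod (s' - t k) < r k" "Phi x s' = 0"
    using n0[of k] by (auto simp: dist_norm norm_minus_commute)
  have notk: "\<not> cmod (s - t k) < r k"
  proof
    assume "cmod (s - t k) < r k"
    then have "s \<in> ball (t k) (r k) \<inter> ball (t n) (r n)"
      using s(1) by (simp add: dist_norm norm_minus_commute)
    then show False
      using r_disj[OF \<open>k \<noteq> n\<close>] by simp
  qed
  then have "cmod (s' - t k) < rho q k"
    using s'(1) k by linarith
  moreover have "s \<noteq> s'"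
    using notk s'(1) by auto
  moreover have "cmod (t k) > R2"
    using tk \<open>T \<ge> 0\<close> by linarith
  ultimately show False
    using R2'[of k s s'] k s(2) s'(2) by blast
qed

text \<open>Each division by a zero gains one power of tau in the coefficients, keeps all moments
  zero and, by \<open>quot_nonzero\<close>, the vector nonzero. Zeros to divide by are supplied by
  \<open>loc_zero\<close>.\<close>

lemma rapid2_quotient:
  assumes "x \<noteq> 0" "\<And>j. mom j (res x) = 0"
  obtains y where "y \<noteq> 0" "\<And>j. mom j (res y) = 0" "rapid2 q y"
proof -
  have "\<exists>y. y \<noteq> 0 \<and> (\<forall>j. mom j (res y) = 0) \<and> rapid2 q y"
  proof (induction q)
    case 0
    show ?case
      using assms coord_summable[of x] by (intro exI[of _ x]) (simp add: rapid2_def)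
  next
    case (Suc q)
    then obtain y where y: "y \<noteq> 0" "\<And>j. mom j (res y) = 0" "rapid2 q y" by blast
    obtain w where w: "Phi y w = 0"
      using eventually_happens[OF loc_zero[OF y(1)]] by auto
    obtain K where K: "\<And>n. t n \<noteq> w \<Longrightarrow> tau n * cmod (divc (res y) w n) \<le> K * cmod (res y n)" "K > 0"
      using divc_le by blast
    have le: "tau n * cmod (coord (quot y w) n) \<le> K * cmod (coord y n)" if "t n \<noteq> w" for n
    proof -
      have "(tau n * cmod (coord (quot y w) n)) * sqrt (mu n) \<le> (K * cmod (coord y n)) * sqrt (mu n)"
        using K(1)[OF that] unfolding res_quot[symmetric] res_def by (simp add: norm_mult mult.assoc)
      then show ?thesis
        by (rule mult_right_le_imp_le) simp
    qed
    have "rapid2 (Suc q) (quot y w)"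
      unfolding rapid2_def
    proof (rule summable_comparison_cofinite[OF _ finite_t_eq])
      show "summable (\<lambda>n. K\<^sup>2 * (cmod (coord y n) * tau n ^ q)\<^sup>2)"
        using y(3) unfolding rapid2_def by (rule summable_mult)
      fix n assume "n \<notin> {n. t n = w}"
      then have "(tau n * cmod (coord (quot y w) n)) * tau n ^ q \<le> (K * cmod (coord y n)) * tau n ^ q"
        using tau_pos[of n] by (intro mult_right_mono le) auto
      then have "((tau n * cmod (coord (quot y w) n)) * tau n ^ q)\<^sup>2 \<le> ((K * cmod (coord y n)) * tau n ^ q)\<^sup>2"
        using tau_pos[of n] by (intro power_mono) auto
      then show "norm ((cmod (coord (quot y w) n) * tau n ^ Suc q)\<^sup>2) \<le> K\<^sup>2 * (cmod (coord y n) * tau n ^ q)\<^sup>2"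
        by (simp add: power_mult_distrib mult_ac)
    qed
    moreover have "mom j (res (quot y w)) = 0" for j
      by (intro mom_quot polyL2_rapid loc_imp_polyL2 w y)
    ultimately show ?case
      using quot_nonzero[OF y(1) w] by blast
  qed
  then show ?thesis using that by blast
qed

end

section \<open>Moving nearby zeros into the points of T\<close>

context cdb_sep
begin

text \<open>As rho (p + k) n = rho p n / tau^k, the displacement relative to any other t m is at
  most f = 1 / tau^k. The form 1 + f <= exp f turns products of ratios into sums; the reciprocal
  ratio gives lower bounds for the coefficients.\<close>

lemma move_ratio:
  assumes "n \<noteq> m" "cmod (s - t n) < rho (p + k) n"
  shows "t m \<noteq> s" "cmod ((t m - t n) / (t m - s)) \<le> exp (1 / tau n ^ k)"
    "cmod ((t m - s) / (t m - t n)) \<le> exp (1 / tau n ^ k)"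
proof -
  define f where "f = 1 / tau n ^ k"
  have "f > 0" using tau_pos[of n] by (simp add: f_def)
  have rho: "rho (p + k) n = rho p n * f"
    using C_pos by (simp add: rho_def f_def power_add)
  note nf = near_far[of "p + k" m n s]
  have far: "4 * rho p n \<le> cmod (t m - t n)"
    using rho_sep(2)[of p m n] assms(1) by simp
  have s1: "3 / 4 * cmod (t m - t n) \<le> cmod (t m - s)"
    using nf(1) assms by (simp add: norm_minus_commute)
  show ne: "t m \<noteq> s"
    using nf(4) assms by auto
  have up: "cmod (s - t n) \<le> f * rho p n"
    using assms(2) by (simp add: rho mult.commute)
  have le: "cmod (s - t n) \<le> f * cmod (t m - s)" "cmod (s - t n) \<le> f * cmod (t m - t n)"
  proof -
    have "rho p n \<le> cmod (t m - s)" "rho p n \<le> cmod (t m - t n)"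
      using far s1 rho_pos[of p n] by linarith+
    then have "f * rho p n \<le> f * cmod (t m - s)" "f * rho p n \<le> f * cmod (t m - t n)"
      using \<open>f > 0\<close> by (auto intro: mult_left_mono)
    then show "cmod (s - t n) \<le> f * cmod (t m - s)" "cmod (s - t n) \<le> f * cmod (t m - t n)"
      using up by linarith+
  qed
  have tne: "t m \<noteq> t n" using assms(1) by auto
  have "(t m - t n) / (t m - s) = 1 + (s - t n) / (t m - s)"
    using ne by (simp add: field_simps)
  moreover have "cmod ((s - t n) / (t m - s)) \<le> f"
    using le(1) ne by (simp add: norm_divide divide_le_eq)
  ultimately have "cmod ((t m - t n) / (t m - s)) \<le> 1 + f"
    using norm_triangle_ineq[of 1 "(s - t n) / (t m - s)"] by simp
  then show "cmod ((t m - t n) / (t m - s)) \<le> exp (1 / tau n ^ k)"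
    using exp_ge_add_one_self[of f] unfolding f_def by linarith
  have "(t m - s) / (t m - t n) = 1 + - ((s - t n) / (t m - t n))"
    using tne by (simp add: field_simps)
  moreover have "cmod (- ((s - t n) / (t m - t n))) \<le> f"
    using le(2) tne by (simp add: norm_divide divide_le_eq)
  ultimately have "cmod ((t m - s) / (t m - t n)) \<le> 1 + f"
    using norm_triangle_ineq[of 1 "- ((s - t n) / (t m - t n))"] by simp
  then show "cmod ((t m - s) / (t m - t n)) \<le> exp (1 / tau n ^ k)"
    using exp_ge_add_one_self[of f] unfolding f_def by linarith
qed

text \<open>Moving the zeros s n into the points t n for all n from some index on removes the
  corresponding coefficients, changes the others by bounded factors only, and preserves the
  vanishing of all moments. In the limit this leaves a finitely supported sequence whose moments
  vanish.\<close>

lemma moments_and_near_zeros: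
  assumes rapid: "rapid (res x)" and mom: "\<And>j. mom j (res x) = 0"
    and s: "\<And>n. n \<ge> n0 \<Longrightarrow> Phi x (s n) = 0 \<and> cmod (s n - t n) < rho (p + (2 * p + 4)) n"
  shows "coord x i = 0"
proof (rule ccontr)
  assume xi: "coord x i \<noteq> 0"
  \<comment> \<open>The exponent of \<open>summable_tau_power\<close>, so that all moves together
    change an untouched coefficient at most by the factor b = exp (suminf f).\<close>
  define K where "K = 2 * p + 4"
  define f where "f n = 1 / tau n ^ K" for n
  have sf: "summable f"
    unfolding f_def K_def by (rule summable_tau_power)
  have f_pos: "f n \<ge> 0" for n using tau_pos[of n] by (simp add: f_def)
  \<comment> \<open>Zeros are moved only from n1 > i on, so the i-th coefficient is never
    removed.\<close>
  define n1 where "n1 = max n0 (Suc i)"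
  define X where "X = rec_nat x (\<lambda>k y. move y (s (n1 + k)) (t (n1 + k)))"
  have X: "X 0 = x" "X (Suc k) = move (X k) (s (n1 + k)) (t (n1 + k))" for k
    by (simp_all add: X_def)
  have near: "cmod (s (n1 + k) - t (n1 + k)) < rho (p + K) (n1 + k)" for k
    using s[of "n1 + k"] by (simp add: n1_def K_def)
  note ratio = move_ratio[OF _ near]
  have s_inj: "s (n1 + k) \<noteq> s (n1 + l)" if "k \<noteq> l" for k l
  proof
    assume eq: "s (n1 + k) = s (n1 + l)"
    have "rho (p + K) (n1 + l) \<le> cmod (s (n1 + k) - t (n1 + l))"
      using near_far(2)[of "p + K" "n1 + l" "n1 + k" "s (n1 + k)"] near[of k] that by simp
    then show False
      using near[of l] by (simp add: eq)
  qed
  define S where "S k = (\<Sum>l<k. f (n1 + l))" for k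
  have facts: "rapid (res (X k)) \<and> (\<forall>j. mom j (res (X k)) = 0) \<and> (\<forall>l\<ge>k. Phi (X k) (s (n1 + l)) = 0) \<and>
      (\<forall>l<k. coord (X k) (n1 + l) = 0) \<and>
      (\<forall>j. (\<forall>l<k. j \<noteq> n1 + l) \<longrightarrow> cmod (coord (X k) j) \<le> exp (S k) * cmod (coord x j) \<and>
        cmod (coord x j) \<le> exp (S k) * cmod (coord (X k) j))" for k
  proof (induction k)
    case 0
    show ?case
      using rapid mom s by (simp add: X S_def n1_def)
  next
    case (Suc k)
    let ?n = "n1 + k"
    have IH: "rapid (res (X k))" "\<And>j. mom j (res (X k)) = 0" "\<And>l. l \<ge> k \<Longrightarrow> Phi (X k) (s (n1 + l)) = 0"
      "\<And>l. l < k \<Longrightarrow> coord (X k) (n1 + l) = 0"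
      "\<And>j. \<forall>l<k. j \<noteq> n1 + l \<Longrightarrow> cmod (coord (X k) j) \<le> exp (S k) * cmod (coord x j)"
      "\<And>j. \<forall>l<k. j \<noteq> n1 + l \<Longrightarrow> cmod (coord x j) \<le> exp (S k) * cmod (coord (X k) j)"
      using Suc.IH by blast+
    have zero: "Phi (X k) (s ?n) = 0" by (rule IH(3)) simp
    have cm: "coord (X (Suc k)) j = coord (X k) j * ((t j - t ?n) / (t j - s ?n))" if "j \<noteq> ?n" for j
      unfolding X by (rule coord_move) (use ratio(1)[of k j] that in auto)
    have cn: "coord (X (Suc k)) ?n = 0"
      using Phi_move_zero[OF zero, of "t ?n"] by (simp add: X)
    have SS: "S (Suc k) = S k + f ?n" by (simp add: S_def)
    show ?case
    proof (intro conjI allI impI)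
      show "rapid (res (X (Suc k)))"
        unfolding X by (rule rapid_move[OF IH(1)])
      show "mom j (res (X (Suc k))) = 0" for j
        unfolding X by (intro mom_move IH zero)
      show "Phi (X (Suc k)) (s (n1 + l)) = 0" if "Suc k \<le> l" for l
        unfolding X using that s_inj[of l k] by (intro Phi_move_keep zero IH) auto
      show "coord (X (Suc k)) (n1 + l) = 0" if "l < Suc k" for l
      proof (cases "l = k")
        case False
        then show ?thesis using cm[of "n1 + l"] IH(4)[of l] that by simp
      qed (use cn in simp)
      fix j assume j: "\<forall>l<Suc k. j \<noteq> n1 + l"
      then have "j \<noteq> ?n" "\<forall>l<k. j \<noteq> n1 + l" by auto
      have "cmod (coord (X (Suc k)) j) = cmod (coord (X k) j) * cmod ((t j - t ?n) / (t j - s ?n))"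
        by (simp only: cm[OF \<open>j \<noteq> ?n\<close>] norm_mult)
      also have "\<dots> \<le> (exp (S k) * cmod (coord x j)) * exp (f ?n)"
        unfolding f_def by (intro mult_mono IH ratio) (use \<open>j \<noteq> ?n\<close> \<open>\<forall>l<k. j \<noteq> n1 + l\<close> in auto)
      finally show "cmod (coord (X (Suc k)) j) \<le> exp (S (Suc k)) * cmod (coord x j)"
        by (simp add: SS exp_add mult_ac)
      have ne: "t j - t ?n \<noteq> 0" "t j - s ?n \<noteq> 0"
        using \<open>j \<noteq> ?n\<close> ratio(1)[of k j] by auto
      have "coord (X k) j = coord (X (Suc k)) j * ((t j - s ?n) / (t j - t ?n))"
        using ne by (simp add: cm[OF \<open>j \<noteq> ?n\<close>])
      then have "cmod (coord (X k) j) = cmod (coord (X (Suc k)) j) * cmod ((t j - s ?n) / (t j - t ?n))"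
        by (simp only: norm_mult)
      also have "\<dots> \<le> cmod (coord (X (Suc k)) j) * exp (f ?n)"
        unfolding f_def by (intro mult_left_mono ratio) (use \<open>j \<noteq> ?n\<close> in auto)
      finally have "exp (S k) * cmod (coord (X k) j) \<le> exp (S k) * (cmod (coord (X (Suc k)) j) * exp (f ?n))"
        by (intro mult_left_mono) auto
      with IH(6)[OF \<open>\<forall>l<k. j \<noteq> n1 + l\<close>]
      have "cmod (coord x j) \<le> exp (S k) * (cmod (coord (X (Suc k)) j) * exp (f ?n))"
        by (rule order_trans)
      then show "cmod (coord x j) \<le> exp (S (Suc k)) * cmod (coord (X (Suc k)) j)"
        by (simp add: SS exp_add mult_ac)
    qed
  qed
  define b where "b = exp (suminf f)"
  have Sb: "exp (S k) \<le> b" for k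
  proof -
    have "S k = sum f ((\<lambda>l. n1 + l) ` {..<k})"
      by (simp add: S_def sum.reindex)
    also have "\<dots> \<le> suminf f"
      using sf f_pos by (intro sum_le_suminf) auto
    finally show ?thesis by (simp add: b_def)
  qed
  have "b > 0" by (simp add: b_def)
  \<comment> \<open>Q vanishes at t j for j < n1 other than i, and the treated indices carry zero
    coefficients: after k moves the vanishing moments leave only the term at i and a tail beyond n1
    + k.\<close>
  define Q where "Q = nodal n1 i"
  have "i < n1" by (simp add: n1_def)
  define g where "g j = cmod (res x j * poly Q (t j))" for j
  have sg: "summable g"
    unfolding g_def by (rule rapid_summable_poly_norm[OF rapid])
  have gi: "g i > 0"
    using xi poly_nodal_self[of n1 i] by (simp add: g_def res_def Q_def)
  \<comment> \<open>The tail has to beat b twice: once in passing from h to g in the tail, once from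
    g i back to h i. Finitely many moves with a small tail thus stand in for the limit
    vector.\<close>
  then obtain N where N: "\<And>n. n \<ge> N \<Longrightarrow> norm (\<Sum>j. g (j + n)) < g i / b\<^sup>2"
    using suminf_exist_split[OF _ sg, of "g i / b\<^sup>2"] \<open>b > 0\<close> by auto
  define k where "k = N"
  define h where "h j = res (X k) j * poly Q (t j)" for j
  have rapk: "rapid (res (X k))" and momk: "\<And>j. mom j (res (X k)) = 0" using facts[of k] by auto
  have sh: "summable h" "summable (\<lambda>j. cmod (h j))"
    unfolding h_def by (intro rapid_summable_poly rapid_summable_poly_norm rapk)+
  have "suminf h = 0"
    unfolding h_def mom_poly[OF rapk] by (simp add: momk)
  moreover have "suminf h = (\<Sum>j. h (j + (n1 + k))) + (\<Sum>j<n1 + k. h j)"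
    by (rule suminf_split_initial_segment[OF sh(1)])
  moreover have "(\<Sum>j<n1 + k. h j) = (\<Sum>j\<in>{i}. h j)"
  proof (rule sum.mono_neutral_right)
    show "\<forall>j\<in>{..<n1 + k} - {i}. h j = 0"
    proof
      fix j assume j: "j \<in> {..<n1 + k} - {i}"
      show "h j = 0"
      proof (cases "j < n1")
        case True
        then show ?thesis using j by (simp add: h_def Q_def poly_nodal_other)
      next
        case False
        then obtain l where "j = n1 + l" by (metis le_Suc_ex not_less)
        then have "coord (X k) j = 0" using j facts[of k] by auto
        then show ?thesis by (simp add: h_def res_def)
      qed
    qed
  qed (use \<open>i < n1\<close> in auto)
  ultimately have hi: "h i = - (\<Sum>j. h (j + (n1 + k)))"
    by (simp add: eq_neg_iff_add_eq_0 add.commute)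
  have hg: "cmod (h j) \<le> b * g j" "g j \<le> b * cmod (h j)" if "\<forall>l<k. j \<noteq> n1 + l" for j
  proof -
    define c where "c = sqrt (mu j) * cmod (poly Q (t j))"
    have c: "c \<ge> 0" "cmod (h j) = cmod (coord (X k) j) * c" "g j = cmod (coord x j) * c"
      by (simp_all add: c_def h_def g_def res_def norm_mult)
    have "cmod (coord (X k) j) \<le> exp (S k) * cmod (coord x j)" "cmod (coord x j) \<le> exp (S k) * cmod (coord (X k) j)"
      using facts[of k] that by blast+
    moreover have "exp (S k) * cmod (coord x j) \<le> b * cmod (coord x j)"
      "exp (S k) * cmod (coord (X k) j) \<le> b * cmod (coord (X k) j)"
      by (intro mult_right_mono Sb, simp)+
    ultimately have "cmod (coord (X k) j) \<le> b * cmod (coord x j)" "cmod (coord x j) \<le> b * cmod (coord (X k) j)"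
      by linarith+
    then show "cmod (h j) \<le> b * g j" "g j \<le> b * cmod (h j)"
      unfolding c(2,3) using c(1) by (simp_all add: mult_right_mono flip: mult.assoc)
  qed
  have "cmod (h i) \<le> (\<Sum>j. cmod (h (j + (n1 + k))))"
    unfolding hi norm_minus_cancel by (intro summable_norm summable_ignore_initial_segment sh)
  also have "\<dots> \<le> (\<Sum>j. b * g (j + (n1 + k)))"
    by (intro suminf_le hg(1) summable_mult summable_ignore_initial_segment sh sg) auto
  also have "\<dots> = b * (\<Sum>j. g (j + (n1 + k)))"
    by (intro suminf_mult summable_ignore_initial_segment sg)
  also have "\<dots> < b * (g i / b\<^sup>2)"
    using N[of "n1 + k"] \<open>b > 0\<close> by (intro mult_strict_left_mono) (auto simp: k_def abs_less_iff)
  also have "\<dots> = g i / b"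
    using \<open>b > 0\<close> by (simp add: power2_eq_square)
  also have "\<dots> \<le> cmod (h i)"
    using hg(2)[of i] \<open>i < n1\<close> \<open>b > 0\<close> by (simp add: divide_le_eq mult.commute)
  finally show False by simp
qed

end

context cdb_loc
begin

lemma loc_imp_moments_determine:
  assumes mom: "\<And>j. mom j (res x) = 0"
  shows "x = 0"
proof (rule ccontr)
  assume "x \<noteq> 0"
  \<comment> \<open>The exponent required by \<open>moments_and_near_zeros\<close>; the decay
    \<open>rapid2 q\<close> that places zeros in these disks is bought by passing to the quotient
    y.\<close>
  define q where "q = p + (2 * p + 4)"
  obtain y where y: "y \<noteq> 0" "\<And>j. mom j (res y) = 0" "rapid2 q y"
    using rapid2_quotient[OF \<open>x \<noteq> 0\<close> mom] by blast
  have "\<forall>\<^sub>F n in sequentially. \<exists>s. Phi y s = 0 \<and> cmod (s - t n) < rho q n"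
    by (rule zeros_near_t[OF _ y(3,1)]) (simp add: q_def)
  then obtain n0 where "\<forall>n\<ge>n0. \<exists>s. Phi y s = 0 \<and> cmod (s - t n) < rho q n"
    by (auto simp: eventually_sequentially)
  then obtain s where "\<And>n. n \<ge> n0 \<Longrightarrow> Phi y (s n) = 0 \<and> cmod (s n - t n) < rho q n"
    by metis
  then have "coord y i = 0" for i
    using moments_and_near_zeros[of y n0 s i] y(2) polyL2_rapid[OF loc_imp_polyL2] by (simp add: q_def)
  then show False
    using y(1) by (auto intro: ell2_eqI)
qed

end

lemma (in cdb_sep) localization_imp_dense:
  assumes "strong_localization t A mu"
  shows "polys_dense_L2 t mu"
proof -
  obtain r where r: "\<forall>n. r n > 0" "r \<longlonglongrightarrow> 0"
    "\<forall>n m. n \<noteq> m \<longrightarrow> ball (t n) (r n) \<inter> ball (t m) (r m) = {}"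
    "\<forall>f\<in>cdb_space t A mu. f \<noteq> (\<lambda>_. 0) \<longrightarrow> finite ({z. f z = 0} - (\<Union>n. ball (t n) (r n))) \<and>
      (\<forall>\<^sub>F n in sequentially. finite {z \<in> ball (t n) (r n). f z = 0} \<and>
        (\<Sum>z\<in>{z \<in> ball (t n) (r n). f z = 0}. zorder f z) = 1)"
    using assms unfolding strong_localization_def by (elim exE conjE)
  interpret loc: cdb_loc t A mu C p r
  proof
    fix x :: ell2 assume "x \<noteq> 0"
    then have x: "Phi x \<in> cdb_space t A mu" "Phi x \<noteq> (\<lambda>_. 0)"
      by (simp_all add: cdb_space_eq Phi_eq_0_iff)
    show "finite ({z. Phi x z = 0} - (\<Union>n. ball (t n) (r n)))"
      using r(4) x by blast
    show "\<forall>\<^sub>F n in sequentially. \<exists>z\<in>ball (t n) (r n). Phi x z = 0"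
      using r(4)[rule_format, OF x, THEN conjunct2]
    proof eventually_elim
      case (elim n)
      then have "{z \<in> ball (t n) (r n). Phi x z = 0} \<noteq> {}"
        by (metis sum.empty zero_neq_one)
      then show ?case by blast
    qed
  qed (use r in auto)
  show ?thesis
    using loc.loc_imp_polyL2 loc.loc_imp_moments_determine by (simp add: polys_dense_iff)
qed

theorem theorem8p1:
  fixes t :: "nat \<Rightarrow> complex" and A :: "complex \<Rightarrow> complex" and mu :: "nat \<Rightarrow> real"
  assumes "cdb_data t A mu" and "power_separated t"
  shows "(((\<forall>m::nat. \<exists>S. nearly_invariant t A mu S \<and> has_codim (cdb_space t A mu) S m) \<and>
          (\<forall>S. nearly_invariant t A mu S \<and> S \<noteq> {\<lambda>_. 0} \<longrightarrow>
               (\<exists>m. has_codim (cdb_space t A mu) S m)))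
         \<longleftrightarrow> polys_dense_L2 t mu) \<and>
         (polys_dense_L2 t mu \<longleftrightarrow> strong_localization t A mu)"
proof -
  obtain C p where Cp: "C > 0" "C \<le> 1" "\<And>m n. m \<noteq> n \<Longrightarrow> C / (1 + cmod (t n)) ^ p \<le> cmod (t n - t m)"
    using power_separated_imp_sep[OF assms(2)] by blast
  interpret cdb t A mu
    by standard (rule assms(1))
  interpret cdb_sep t A mu C p
    by standard (use Cp in \<open>simp_all add: tau_def\<close>)
  have zero: "Phi ` V = {\<lambda>_. 0} \<longleftrightarrow> V = {0}" for V
  proof -
    have "{\<lambda>_. 0} = Phi ` {0}" by auto
    then show ?thesis
      by (metis Phi_inj inj_def inj_image_eq_iff)
  qed
  have inv: "(\<exists>S. nearly_invariant t A mu S \<and> has_codim (cdb_space t A mu) S m) \<longleftrightarrow> (\<exists>V. ninv V \<and> codim V m)" for m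
    unfolding nearly_invariant_iff using has_codim_iff by blast
  have fin: "(\<forall>S. nearly_invariant t A mu S \<and> S \<noteq> {\<lambda>_. 0} \<longrightarrow> (\<exists>m. has_codim (cdb_space t A mu) S m)) \<longleftrightarrow>
      (\<forall>V. ninv V \<and> V \<noteq> {0} \<longrightarrow> (\<exists>m. codim V m))"
  proof -
    have "(\<forall>S. (\<exists>V. ninv V \<and> S = Phi ` V) \<and> S \<noteq> {\<lambda>_. 0} \<longrightarrow> Q S) \<longleftrightarrow>
        (\<forall>V. ninv V \<and> Phi ` V \<noteq> {\<lambda>_. 0} \<longrightarrow> Q (Phi ` V))" for Q
      by blast
    from this[of "\<lambda>S. \<exists>m. has_codim (cdb_space t A mu) S m"] show ?thesis
      unfolding nearly_invariant_iff zero has_codim_iff .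
  qed
  have dense: "(\<forall>m. \<exists>V. ninv V \<and> codim V m) \<and> (\<forall>V. ninv V \<and> V \<noteq> {0} \<longrightarrow> (\<exists>m. codim V m))"
    if "polys_dense_L2 t mu"
  proof -
    have P: polyL2 and det: "\<And>x. (\<And>j. mom j (res x) = 0) \<Longrightarrow> x = 0"
      using that by (auto simp: polys_dense_iff)
    have "ninv (Wsub {..<m})" for m
      by (rule ninv_Wsub[OF P]) auto
    then show ?thesis
      using codim_Wsub[OF P] dense_imp_finite_codim[OF P det] by blast
  qed
  have "strong_localization t A mu" if "polys_dense_L2 t mu"
    using that dense_imp_localization by (simp add: polys_dense_iff)
  then show ?thesis
    unfolding inv fin using dense finite_codim_imp_dense localization_imp_dense by blast
qed

end
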